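(* Let $n\ge 2$, let $\Omega\subset\mathbb{R}^n$ be open and bounded, let $0<s\le t<1$, $1<p\le q<\infty$, $\Lambda\ge 1$, and let the kernels $K_{sp},K_{tq}$ and the coefficient $a$ be as in the context. Suppose moreover that $0\le a\in L^\infty_{\rm loc}(\Omega\times\Omega)$. If $$\begin{cases}\dfrac{q}{p}\le 1+\dfrac{sp}{n-sp}, & \text{when } sp<n,\\[2mm] p\le q<\infty, & \text{when } sp\ge n,\end{cases}$$ then each minimizer $u\in\mathcal{A}(\Omega)\cap L^{p-1}_{sp}(\mathbb{R}^n)\cap L^{q-1}_{a,tq}(\Omega,\mathbb{R}^n)$ of the functional $\mathcal{F}(\cdot;\Omega)$ is locally bounded in $\Omega$.
   Context: Setting. The kernels $K_{sp},K_{tq}:\mathbb{R}^n\times\mathbb{R}^n\to[0,\infty)$ are measurable and satisfy $$\frac{\Lambda^{-1}}{|x-y|^{n+sp}}\le K_{sp}(x,y)\le\frac{\Lambda}{|x-y|^{n+sp}},\qquad \frac{\Lambda^{-1}}{|x-y|^{n+tq}}\le K_{tq}(x,y)\le\frac{\Lambda}{|x-y|^{n+tq}}.$$ The coefficient $a:\mathbb{R}^n\times\mathbb{R}^n\to\mathbb{R}$ is measurable with $0\le a(x,y)=a(y,x)$. Put $\mathcal{C}_\Omega=(\mathbb{R}^n\times\mathbb{R}^n)\setminus((\mathbb{R}^n\setminus\Omega)\times(\mathbb{R}^n\setminus\Omega))$ and $$\mathcal{F}(u;\Omega)=\iint_{\mathcal{C}_\Omega}\big[|u(x)-u(y)|^pK_{sp}(x,y)+a(x,y)|u(x)-u(y)|^qK_{tq}(x,y)\big]\,dx\,dy.$$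 Function spaces and minimizers (all functions measurable). $\mathcal{A}(\Omega)$ is the set of $u:\mathbb{R}^n\to\mathbb{R}$ with $u|_\Omega\in L^p(\Omega)$ and $$\iint_{\mathcal{C}_\Omega}\frac{|u(x)-u(y)|^p}{|x-y|^{n+sp}}+a(x,y)\frac{|u(x)-u(y)|^q}{|x-y|^{n+tq}}\,dx\,dy<\infty.$$ $L^{p-1}_{sp}(\mathbb{R}^n)$ is the set of $u$ with $\int_{\mathbb{R}^n}\frac{|u(x)|^{p-1}}{(1+|x|)^{n+sp}}\,dx<\infty$; $L^{q-1}_{a,tq}(\Omega,\mathbb{R}^n)$ is the set of $u$ with $\sup_{x\in\Omega}\int_{\mathbb{R}^n}a(x,y)\frac{|u(y)|^{q-1}}{(1+|y|)^{n+tq}}\,dy<\infty$. A function $u\in\mathcal{A}(\Omega)$ is a minimizer of $\mathcal{F}(\cdot;\Omega)$ if $\mathcal{F}(u;\Omega)\le\mathcal{F}(v;\Omega)$ for every $v\in\mathcal{A}(\Omega)$ with $v=u$ a.e. in $\mathbb{R}^n\setminus\Omega$. Locally bounded in $\Omega$ means $u\in L^\infty_{\rm loc}(\Omega)$. *)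

theory Defs
  imports "HOL-Analysis.Analysis"
begin

text \<open>
  Measurability is Lebesgue measurability throughout; the double integrals are taken with respect
  to Lebesgue measure on the product type \<open>(real^'n) \<times> (real^'n)\<close>.  Integrals of nonnegative
  functions are extended nonnegative integrals, so they are meaningful without assuming
  finiteness.  Quotients by \<open>norm (x - y)\<close> take the value 0 on the diagonal (a null set).
\<close>

definition cross_domain :: "(real^'n) set \<Rightarrow> ((real^'n) \<times> (real^'n)) set"
  where "cross_domain \<Omega> = UNIV - (- \<Omega>) \<times> (- \<Omega>)"

text \<open>The two-sided bound is only imposed off the diagonal, where the quotients make sense.\<close>

definition fractional_kernel ::
  "real \<Rightarrow> real \<Rightarrow> real \<Rightarrow> ((real^'n) \<times> (real^'n) \<Rightarrow> real) \<Rightarrow> bool"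
  where "fractional_kernel \<Lambda> s p K \<longleftrightarrow>
    K \<in> borel_measurable lebesgue \<and> (\<forall>z. 0 \<le> K z) \<and>
    (\<forall>x y. x \<noteq> y \<longrightarrow>
      inverse \<Lambda> / norm (x - y) powr (real CARD('n) + s * p) \<le> K (x, y) \<and>
      K (x, y) \<le> \<Lambda> / norm (x - y) powr (real CARD('n) + s * p))"

definition coefficient :: "((real^'n) \<times> (real^'n) \<Rightarrow> real) \<Rightarrow> bool"
  where "coefficient a \<longleftrightarrow>
    a \<in> borel_measurable lebesgue \<and> (\<forall>x y. 0 \<le> a (x, y) \<and> a (x, y) = a (y, x))"

definition double_phase_functional ::
  "((real^'n) \<times> (real^'n) \<Rightarrow> real) \<Rightarrow> ((real^'n) \<times> (real^'n) \<Rightarrow> real) \<Rightarrow>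
   ((real^'n) \<times> (real^'n) \<Rightarrow> real) \<Rightarrow> real \<Rightarrow> real \<Rightarrow> (real^'n) set \<Rightarrow>
   (real^'n \<Rightarrow> real) \<Rightarrow> ennreal"
  where "double_phase_functional Ksp Ktq a p q \<Omega> u =
    (\<integral>\<^sup>+ z \<in> cross_domain \<Omega>.
      (case z of (x, y) \<Rightarrow>
        ennreal (\<bar>u x - u y\<bar> powr p * Ksp (x, y) + a (x, y) * \<bar>u x - u y\<bar> powr q * Ktq (x, y)))
      \<partial>lebesgue)"

definition admissible ::
  "((real^'n) \<times> (real^'n) \<Rightarrow> real) \<Rightarrow> real \<Rightarrow> real \<Rightarrow> real \<Rightarrow> real \<Rightarrow> (real^'n) set \<Rightarrow>
   (real^'n \<Rightarrow> real) set"
  where "admissible a s t p q \<Omega> =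
    {u. u \<in> borel_measurable lebesgue \<and>
        (\<integral>\<^sup>+ x \<in> \<Omega>. ennreal (\<bar>u x\<bar> powr p) \<partial>lebesgue) < \<infinity> \<and>
        (\<integral>\<^sup>+ z \<in> cross_domain \<Omega>.
          (case z of (x, y) \<Rightarrow>
            ennreal (\<bar>u x - u y\<bar> powr p / norm (x - y) powr (real CARD('n) + s * p)
              + a (x, y) * (\<bar>u x - u y\<bar> powr q / norm (x - y) powr (real CARD('n) + t * q))))
          \<partial>lebesgue) < \<infinity>}"

definition tail_space :: "real \<Rightarrow> real \<Rightarrow> (real^'n \<Rightarrow> real) set"
  where "tail_space s p =
    {u. u \<in> borel_measurable lebesgue \<and>
        (\<integral>\<^sup>+ x. ennreal (\<bar>u x\<bar> powr (p - 1) / (1 + norm x) powr (real CARD('n) + s * p))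
          \<partial>lebesgue) < \<infinity>}"

text \<open>
  The supremum is over every \<open>x \<in> \<Omega>\<close>.  The section \<open>a (x, _)\<close> is measurable for almost every \<open>x\<close>
  only; on the remaining null set the integral is the lower integral.
\<close>

definition weighted_tail_space ::
  "((real^'n) \<times> (real^'n) \<Rightarrow> real) \<Rightarrow> real \<Rightarrow> real \<Rightarrow> (real^'n) set \<Rightarrow> (real^'n \<Rightarrow> real) set"
  where "weighted_tail_space a t q \<Omega> =
    {u. u \<in> borel_measurable lebesgue \<and>
        (SUP x\<in>\<Omega>. \<integral>\<^sup>+ y.
          ennreal (a (x, y) * (\<bar>u y\<bar> powr (q - 1) / (1 + norm y) powr (real CARD('n) + t * q)))
          \<partial>lebesgue) < \<infinity>}"

definition is_minimizer ::
  "((real^'n) \<times> (real^'n) \<Rightarrow> real) \<Rightarrow> ((real^'n) \<times> (real^'n) \<Rightarrow> real) \<Rightarrow>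
   ((real^'n) \<times> (real^'n) \<Rightarrow> real) \<Rightarrow> real \<Rightarrow> real \<Rightarrow> real \<Rightarrow> real \<Rightarrow> (real^'n) set \<Rightarrow>
   (real^'n \<Rightarrow> real) \<Rightarrow> bool"
  where "is_minimizer Ksp Ktq a s t p q \<Omega> u \<longleftrightarrow>
    u \<in> admissible a s t p q \<Omega> \<and>
    (\<forall>v \<in> admissible a s t p q \<Omega>.
      (AE x in lebesgue. x \<notin> \<Omega> \<longrightarrow> v x = u x) \<longrightarrow>
      double_phase_functional Ksp Ktq a p q \<Omega> u \<le> double_phase_functional Ksp Ktq a p q \<Omega> v)"

definition L_infinity_loc :: "'a::euclidean_space set \<Rightarrow> ('a \<Rightarrow> real) set"
  where "L_infinity_loc U =
    {f. set_borel_measurable lebesgue U f \<and>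
        (\<forall>C. compact C \<and> C \<subseteq> U \<longrightarrow>
          (\<exists>M. AE x in lebesgue. x \<in> C \<longrightarrow> \<bar>f x\<bar> \<le> M))}"

end

theory Submission
  imports Defs
begin

text \<open>
  The proof is De Giorgi's iteration, run directly on minimality: the convexity of the integrand takes
  the place of an Euler-Lagrange equation.

  Fix a level \<open>k \<ge> 0\<close>, put \<open>w = (u - k)\<^sup>+\<close>, let \<open>\<phi>\<close> be a Lipschitz cutoff on a small ball in \<open>\<Omega>\<close>, and
  compare \<open>u\<close> with \<open>v = u - f\<close>, where \<open>f = \<phi> powr q * w\<close>.  Convexity of \<open>\<bar>_\<bar> powr m\<close> gives, for each pair
  of points and for both \<open>m = p\<close> and \<open>m = q\<close>,
  \<open>\<bar>v x - v y\<bar>\<^sup>m + 2\<^sup>-\<^sup>m \<bar>f x - f y\<bar>\<^sup>m \<le> \<bar>u x - u y\<bar>\<^sup>m + error\<close> (\<open>comparison_pointwise\<close>).  The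
  increment of \<open>u\<close> carries the constant 1, so after integration minimality cancels the energies of \<open>u\<close>
  and \<open>v\<close> and leaves a bound of the Gagliardo energy of \<open>f\<close> by the errors (\<open>minimizer_Caccioppoli\<close>).  For two points near the ball the error contains the increment of \<open>\<phi>\<close>,
  which tames the singularity of the kernel because \<open>s, t < 1\<close>; for a point near and a point far away it
  is a multiple of \<open>w x * w y powr (m - 1)\<close>, which is what the tail conditions control.  Altogether the errors are
  bounded by integrals of \<open>w powr p\<close>, \<open>w powr q\<close> and \<open>w\<close> over the ball (\<open>total_error_bound\<close>).

  The hypothesis on \<open>q / p\<close> says exactly that some exponent \<open>r > p\<close> satisfies \<open>r \<ge> q\<close> and
  \<open>n (1 - p / r) \<le> s p\<close>; for such \<open>r\<close> the fractional Sobolev inequality \<open>fractional_Sobolev\<close> bounds the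
  integral of \<open>f powr r\<close> by a multiple of the power \<open>r / p > 1\<close> of the Gagliardo energy of \<open>f\<close>.  Let \<open>Y i\<close> be the
  integral of \<open>(u - k\<^sub>i)\<^sup>+ powr r\<close> over the ball of radius \<open>\<rho>\<^sub>i\<close>, for increasing levels and shrinking
  radii.  Where \<open>u > k\<^sub>i\<^sub>+\<^sub>1\<close>, the excess over \<open>k\<^sub>i\<close> is at least \<open>k\<^sub>i\<^sub>+\<^sub>1 - k\<^sub>i\<close>, so all the
  lower powers in the errors are bounded by multiples of \<open>Y i\<close>, and
  \<open>Y (Suc i) \<le> C b\<^sup>i (Y i) powr (r / p)\<close>.  Such a sequence tends to 0 if \<open>Y 0\<close> is small
  (\<open>fast_geometric_convergence\<close>).

  In the critical case \<open>q = n p / (n - s p)\<close> smallness cannot be bought by an interpolation gain.  It comes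
  from a large initial level: \<open>u\<^sup>+ powr r\<close> is integrable near the ball (\<open>higher_integrability\<close>), so
  dominated convergence makes \<open>Y 0\<close> as small as desired, and the constants of the iteration do not
  depend on the initial level.  This bounds \<open>u\<close> from above (\<open>minimizer_bounded_above\<close>); the lower bound
  is the same statement for \<open>-u\<close>, which is again a minimizer.
\<close>

section \<open>Comparison inequalities for a pair of points\<close>

lemma powr_abs_convex:
  fixes m A B l :: real
  assumes "1 \<le> m" "0 \<le> l" "l \<le> 1"
  shows "\<bar>(1 - l) * A + l * B\<bar> powr m \<le> (1 - l) * \<bar>A\<bar> powr m + l * \<bar>B\<bar> powr m"
proof -
  have "\<bar>(1 - l) * A + l * B\<bar> powr m \<le> ((1 - l) * \<bar>A\<bar> + l * \<bar>B\<bar>) powr m"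
    using assms by (intro powr_mono2) (auto simp: abs_mult intro!: order_trans[OF abs_triangle_ineq])
  also have "\<dots> \<le> (1 - l) * \<bar>A\<bar> powr m + l * \<bar>B\<bar> powr m"
  proof (cases "A = 0 \<or> B = 0")
    case True
    have "c powr m \<le> c" if "0 \<le> c" "c \<le> 1" for c :: real
      using powr_mono'[of 1 m c] that assms by auto
    from this[of l] this[of "1 - l"] show ?thesis
      using True assms by (auto simp: powr_mult mult_right_mono)
  next
    case False
    then show ?thesis
      using convex_onD[OF powr_convex[OF assms(1)], of l "\<bar>A\<bar>" "\<bar>B\<bar>"] assms by auto
  qed
  finally show ?thesis .
qed

lemma powr_abs_add_le:
  fixes m A B :: real
  assumes "1 \<le> m"
  shows "2 powr (-m) * \<bar>A + B\<bar> powr m \<le> (\<bar>A\<bar> powr m + \<bar>B\<bar> powr m) / 2"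
proof -
  have "2 powr (-m) * \<bar>A + B\<bar> powr m = \<bar>(1 - 1/2) * A + 1/2 * B\<bar> powr m"
  proof -
    have "(1 - 1/2) * A + 1/2 * B = (A + B) / 2" by simp
    then have "\<bar>(1 - 1/2) * A + 1/2 * B\<bar> powr m = (\<bar>A + B\<bar> / 2) powr m"
      by (simp only: abs_divide abs_numeral)
    then show ?thesis by (simp add: powr_divide powr_minus field_simps)
  qed
  also have "\<dots> \<le> (1 - 1/2) * \<bar>A\<bar> powr m + 1/2 * \<bar>B\<bar> powr m"
    by (rule powr_abs_convex) (use assms in auto)
  finally show ?thesis by (simp add: field_simps)
qed

lemma powr_superadditive:
  fixes m a b :: real
  assumes "1 \<le> m" "0 \<le> a" "0 \<le> b"
  shows "a powr m + b powr m \<le> (a + b) powr m"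
proof -
  have split: "c powr m = c * c powr (m - 1)" if "0 \<le> c" for c :: real
    using powr_mult_base[OF that, of "m - 1"] by simp
  have "a powr m \<le> a * (a + b) powr (m - 1)"
    unfolding split[OF assms(2)] by (intro mult_left_mono powr_mono2) (use assms in auto)
  moreover have "b powr m \<le> b * (a + b) powr (m - 1)"
    unfolding split[OF assms(3)] by (intro mult_left_mono powr_mono2) (use assms in auto)
  ultimately show ?thesis using split[of "a + b"] assms by (simp add: distrib_right)
qed

lemma Bernoulli_powr:
  fixes m z :: real
  assumes "1 \<le> m" "0 \<le> z"
  shows "1 - z powr m \<le> m * (1 - z)"
proof (cases "z = 0")
  case False
  have "z = (z powr m) powr (1/m) * 1 powr (1 - 1/m)"
    using assms by (simp add: powr_powr)
  also have "\<dots> \<le> 1/m * z powr m + (1 - 1/m) * 1"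
    by (rule Youngs_inequality_0) (use assms False in \<open>auto simp: field_simps\<close>)
  finally have "m * z \<le> m * (1/m * z powr m + (1 - 1/m) * 1)"
    using assms by (intro mult_left_mono) auto
  also have "\<dots> = z powr m + m - 1" using assms by (simp add: field_simps)
  finally show ?thesis by (simp add: right_diff_distrib)
qed (use assms in auto)

text \<open>
  The tangent line of the convex power at \<open>d + h\<close>; Bernoulli's inequality for \<open>d / (d + h)\<close> in disguise.
\<close>

lemma powr_add_diff_le:
  fixes m d h :: real
  assumes "1 \<le> m" "0 \<le> d" "0 \<le> h"
  shows "(d + h) powr m \<le> d powr m + m * h * (d + h) powr (m - 1)"
proof (cases "d + h = 0")
  case False
  define c where "c = d + h"
  have c: "c > 0" using False assms by (auto simp: c_def)
  have "1 - (d / c) powr m \<le> m * (1 - d / c)"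
    by (rule Bernoulli_powr) (use assms c in auto)
  also have "1 - d / c = h / c" using c by (simp add: c_def field_simps)
  finally have "c powr m * (1 - (d / c) powr m) \<le> c powr m * (m * (h / c))"
    by (rule mult_left_mono) simp
  moreover have "c powr m * (1 - (d / c) powr m) = c powr m - d powr m"
    using c assms by (simp add: powr_divide right_diff_distrib)
  moreover have "c powr m * (m * (h / c)) = m * h * c powr (m - 1)"
    using c by (simp add: powr_diff)
  ultimately show ?thesis unfolding c_def by simp
qed (use assms in auto)

text \<open>
  With \<open>z = \<psi> / \<phi>\<close>, the new increment is the convex combination
  \<open>(1 - \<alpha>) (X - Y) + \<alpha> (- (1 - z powr l) Y)\<close>.  Convexity therefore leaves the share \<open>\<alpha> \<bar>X - Y\<bar> powr m\<close>
  unused, which pays for the increment of the cut-off excess, and the remainder is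
  \<open>\<alpha> (1 - z powr l) powr m \<le> l powr m * \<bar>\<phi> - \<psi>\<bar> powr m\<close> by Bernoulli.  The last step uses
  \<open>\<alpha> = \<phi> powr l\<close> with \<open>l \<ge> m\<close>: this is why the cutoff enters with a power at least the growth exponent.
\<close>

lemma truncation_both_above:
  fixes m l X Y \<phi> \<psi> :: real
  assumes m: "1 \<le> m" "m \<le> l" and X: "0 < X" "0 < Y" and ph: "0 \<le> \<psi>" "\<psi> \<le> \<phi>" "\<phi> \<le> 1"
  defines "\<alpha> \<equiv> \<phi> powr l" and "\<beta> \<equiv> \<psi> powr l"
  shows "\<bar>(X - \<alpha> * X) - (Y - \<beta> * Y)\<bar> powr m + 2 powr (-m) * \<bar>\<alpha> * X - \<beta> * Y\<bar> powr m
    \<le> \<bar>X - Y\<bar> powr m + 2 * l powr m * \<bar>\<phi> - \<psi>\<bar> powr m * Y powr m"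
proof (cases "\<phi> = 0")
  case True
  then show ?thesis using ph by (simp add: \<alpha>_def \<beta>_def)
next
  case False
  then have ph0: "\<phi> > 0" using ph by auto
  define z where "z = \<psi> / \<phi>"
  have z: "0 \<le> z" "z \<le> 1" using ph ph0 by (auto simp: z_def)
  have \<alpha>: "0 < \<alpha>" "\<alpha> \<le> 1" using ph ph0 m by (auto simp: \<alpha>_def intro: powr_le1)
  have \<beta>: "0 \<le> \<beta>" "\<beta> = \<alpha> * z powr l" "\<beta> \<le> \<alpha>"
    using ph ph0 m by (auto simp: \<alpha>_def \<beta>_def z_def powr_divide intro: powr_mono2)
  have bern: "0 \<le> 1 - z powr l" "1 - z powr l \<le> l * (1 - z)"
    using Bernoulli_powr[of l z] m z by (auto intro: powr_le1)
  have E: "\<alpha> * (1 - z powr l) powr m \<le> l powr m * \<bar>\<phi> - \<psi>\<bar> powr m"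
  proof -
    have "\<alpha> * (1 - z powr l) powr m \<le> \<alpha> * (l * (1 - z)) powr m"
      using bern m \<alpha> by (intro mult_left_mono powr_mono2) auto
    also have "(1 - z) = \<bar>\<phi> - \<psi>\<bar> / \<phi>" using ph ph0 by (simp add: z_def field_simps)
    also have "\<alpha> * (l * (\<bar>\<phi> - \<psi>\<bar> / \<phi>)) powr m
        = \<phi> powr (l - m) * (l powr m * \<bar>\<phi> - \<psi>\<bar> powr m)"
      using ph0 m by (simp add: \<alpha>_def powr_mult powr_divide powr_diff)
    also have "\<dots> \<le> 1 * (l powr m * \<bar>\<phi> - \<psi>\<bar> powr m)"
      using ph ph0 m by (intro mult_right_mono) (auto intro: powr_le1)
    finally show ?thesis by simp
  qed
  have "(X - \<alpha> * X) - (Y - \<beta> * Y) = (1 - \<alpha>) * (X - Y) + \<alpha> * (- (1 - z powr l) * Y)"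
    unfolding \<beta>(2) by (simp add: algebra_simps)
  then have "\<bar>(X - \<alpha> * X) - (Y - \<beta> * Y)\<bar> powr m
     \<le> (1 - \<alpha>) * \<bar>X - Y\<bar> powr m + \<alpha> * \<bar>- (1 - z powr l) * Y\<bar> powr m"
    using powr_abs_convex[of m \<alpha>] m \<alpha> by auto
  also have "\<bar>- (1 - z powr l) * Y\<bar> powr m = (1 - z powr l) powr m * Y powr m"
    using bern X by (simp add: abs_mult powr_mult)
  also have "\<alpha> * ((1 - z powr l) powr m * Y powr m) \<le> l powr m * \<bar>\<phi> - \<psi>\<bar> powr m * Y powr m"
    using mult_right_mono[OF E, of "Y powr m"] by (simp add: mult.assoc)
  finally have v: "\<bar>(X - \<alpha> * X) - (Y - \<beta> * Y)\<bar> powr m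
     \<le> (1 - \<alpha>) * \<bar>X - Y\<bar> powr m + l powr m * \<bar>\<phi> - \<psi>\<bar> powr m * Y powr m" by simp
  have pw1: "\<alpha> powr m \<le> \<alpha>" using powr_mono'[of 1 m \<alpha>] m \<alpha> by simp
  have "\<alpha> * X - \<beta> * Y = \<alpha> * (X - Y) + \<alpha> * (1 - z powr l) * Y"
    unfolding \<beta>(2) by (simp add: algebra_simps)
  then have "2 powr (-m) * \<bar>\<alpha> * X - \<beta> * Y\<bar> powr m
     \<le> (\<bar>\<alpha> * (X - Y)\<bar> powr m + \<bar>\<alpha> * (1 - z powr l) * Y\<bar> powr m) / 2"
    using powr_abs_add_le[of m] m by auto
  also have "\<dots> \<le> \<bar>\<alpha> * (X - Y)\<bar> powr m + \<bar>\<alpha> * (1 - z powr l) * Y\<bar> powr m" by simp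
  also have "\<bar>\<alpha> * (X - Y)\<bar> powr m = \<alpha> powr m * \<bar>X - Y\<bar> powr m"
    using \<alpha> by (simp add: abs_mult powr_mult)
  also have "\<bar>\<alpha> * (1 - z powr l) * Y\<bar> powr m = \<alpha> powr m * (1 - z powr l) powr m * Y powr m"
    using \<alpha> bern X by (simp add: abs_mult powr_mult)
  also have "\<alpha> powr m * \<bar>X - Y\<bar> powr m \<le> \<alpha> * \<bar>X - Y\<bar> powr m"
    using pw1 by (intro mult_right_mono) auto
  also have "\<alpha> powr m * (1 - z powr l) powr m * Y powr m \<le> \<alpha> * (1 - z powr l) powr m * Y powr m"
    using pw1 by (intro mult_right_mono) auto
  also have "\<dots> \<le> l powr m * \<bar>\<phi> - \<psi>\<bar> powr m * Y powr m"
    using E by (intro mult_right_mono) auto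
  finally have "2 powr (-m) * \<bar>\<alpha> * X - \<beta> * Y\<bar> powr m
     \<le> \<alpha> * \<bar>X - Y\<bar> powr m + l powr m * \<bar>\<phi> - \<psi>\<bar> powr m * Y powr m" by simp
  with v show ?thesis by (simp add: left_diff_distrib)
qed

text \<open>
  If the second point lies below the level, lowering the first one costs no error: the new increment is
  \<open>(1 - \<alpha>) (X + b) + \<alpha> b\<close> with \<open>b = - Y \<ge> 0\<close>, and \<open>X powr m + b powr m \<le> (X + b) powr m\<close>.
\<close>

lemma truncation_across_level:
  fixes m X Y \<alpha> :: real
  assumes m: "1 \<le> m" and X: "0 < X" "Y \<le> 0" and \<alpha>: "0 \<le> \<alpha>" "\<alpha> \<le> 1"
  shows "\<bar>(X - \<alpha> * X) - Y\<bar> powr m + 2 powr (-m) * \<bar>\<alpha> * X\<bar> powr m \<le> \<bar>X - Y\<bar> powr m"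
proof -
  define b where "b = - Y"
  have b: "b \<ge> 0" using X by (simp add: b_def)
  have "(X - \<alpha> * X) - Y = (1 - \<alpha>) * (X + b) + \<alpha> * b" by (simp add: b_def algebra_simps)
  then have v: "\<bar>(X - \<alpha> * X) - Y\<bar> powr m \<le> (1 - \<alpha>) * (X + b) powr m + \<alpha> * b powr m"
    using powr_abs_convex[of m \<alpha> "X + b" b] m \<alpha> X b by auto
  have pw1: "\<alpha> powr m \<le> \<alpha>" using powr_mono'[of 1 m \<alpha>] m \<alpha> by simp
  have "2 powr (-m) \<le> (1::real)" using m by (simp add: powr_minus ge_one_powr_ge_zero inverse_le_1_iff)
  then have "2 powr (-m) * \<bar>\<alpha> * X\<bar> powr m \<le> 1 * (\<alpha> powr m * X powr m)"
    using X \<alpha> by (intro mult_mono) (auto simp: abs_mult powr_mult)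
  also have "\<dots> \<le> \<alpha> * X powr m" using pw1 by (simp add: mult_right_mono)
  also have "\<dots> \<le> \<alpha> * ((X + b) powr m - b powr m)"
    using powr_superadditive[of m X b] m X b \<alpha> by (intro mult_left_mono) auto
  finally have "2 powr (-m) * \<bar>\<alpha> * X\<bar> powr m \<le> \<alpha> * ((X + b) powr m - b powr m)" .
  then have "\<bar>(X - \<alpha> * X) - Y\<bar> powr m + 2 powr (-m) * \<bar>\<alpha> * X\<bar> powr m \<le> (X + b) powr m"
    using v by (simp add: algebra_simps)
  also have "(X + b) powr m = \<bar>X - Y\<bar> powr m" using X b by (simp add: b_def)
  finally show ?thesis .
qed

text \<open>
  The inequality for two points at which the cutoff may be positive; \<open>X\<close> and \<open>Y\<close> stand for \<open>u - k\<close> at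
  the two points.
\<close>

lemma truncation_near:
  fixes m l X Y \<phi> \<psi> :: real
  assumes m: "1 \<le> m" "m \<le> l" and ph: "0 \<le> \<phi>" "\<phi> \<le> 1" "0 \<le> \<psi>" "\<psi> \<le> 1"
  shows "\<bar>(X - \<phi> powr l * max X 0) - (Y - \<psi> powr l * max Y 0)\<bar> powr m
      + 2 powr (-m) * \<bar>\<phi> powr l * max X 0 - \<psi> powr l * max Y 0\<bar> powr m
    \<le> \<bar>X - Y\<bar> powr m
      + 2 * l powr m * \<bar>\<phi> - \<psi>\<bar> powr m * (max X 0 powr m + max Y 0 powr m)"
proof -
  have l: "\<phi> powr l \<le> 1" "\<psi> powr l \<le> 1" using ph m by (auto intro: powr_le1)
  have nn: "0 \<le> 2 * l powr m * \<bar>\<phi> - \<psi>\<bar> powr m * max X 0 powr m"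
    "0 \<le> 2 * l powr m * \<bar>\<phi> - \<psi>\<bar> powr m * max Y 0 powr m" by auto
  consider "X > 0" "Y > 0" | "X > 0" "Y \<le> 0" | "X \<le> 0" "Y > 0" | "X \<le> 0" "Y \<le> 0" by linarith
  then show ?thesis
  proof cases
    case 1
    have max1: "max X 0 = X" "max Y 0 = Y" using 1 by auto
    show ?thesis
    proof (cases "\<psi> \<le> \<phi>")
      case True
      have "2 * l powr m * \<bar>\<phi> - \<psi>\<bar> powr m * Y powr m
          \<le> 2 * l powr m * \<bar>\<phi> - \<psi>\<bar> powr m * (X powr m + Y powr m)"
        by (rule mult_left_mono) auto
      with truncation_both_above[of m l X Y \<psi> \<phi>, OF m 1 ph(3) True ph(2)] show ?thesis
        unfolding max1 by linarith
    next
      case False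
      then have "\<phi> \<le> \<psi>" by simp
      from truncation_both_above[of m l Y X \<phi> \<psi>, OF m 1(2) 1(1) ph(1) this ph(4)]
      have "\<bar>Y - \<psi> powr l * Y - (X - \<phi> powr l * X)\<bar> powr m
         + 2 powr - m * \<bar>\<psi> powr l * Y - \<phi> powr l * X\<bar> powr m
         \<le> \<bar>Y - X\<bar> powr m + 2 * l powr m * \<bar>\<psi> - \<phi>\<bar> powr m * X powr m" .
      then have "\<bar>X - \<phi> powr l * X - (Y - \<psi> powr l * Y)\<bar> powr m
         + 2 powr - m * \<bar>\<phi> powr l * X - \<psi> powr l * Y\<bar> powr m
         \<le> \<bar>X - Y\<bar> powr m + 2 * l powr m * \<bar>\<phi> - \<psi>\<bar> powr m * X powr m"
        by (simp only: abs_minus_commute)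
      moreover have "2 * l powr m * \<bar>\<phi> - \<psi>\<bar> powr m * X powr m
          \<le> 2 * l powr m * \<bar>\<phi> - \<psi>\<bar> powr m * (X powr m + Y powr m)"
        by (rule mult_left_mono) auto
      ultimately show ?thesis unfolding max1 by linarith
    qed
  next
    case 2
    have "max X 0 = X" "max Y 0 = 0" using 2 by auto
    moreover have "\<bar>X - \<phi> powr l * X - Y\<bar> powr m + 2 powr - m * \<bar>\<phi> powr l * X\<bar> powr m
        \<le> \<bar>X - Y\<bar> powr m"
      using truncation_across_level[of m X Y "\<phi> powr l"] 2 m l by auto
    ultimately show ?thesis using nn m by (simp add: add_increasing2)
  next
    case 3
    have "\<bar>Y - \<psi> powr l * Y - X\<bar> powr m + 2 powr - m * \<bar>\<psi> powr l * Y\<bar> powr m \<le> \<bar>Y - X\<bar> powr m"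
      using truncation_across_level[of m Y X "\<psi> powr l"] 3 m l by auto
    then have "\<bar>X - (Y - \<psi> powr l * Y)\<bar> powr m + 2 powr - m * \<bar>\<psi> powr l * Y\<bar> powr m \<le> \<bar>X - Y\<bar> powr m"
      by (simp add: abs_minus_commute)
    moreover have "max X 0 = 0" "max Y 0 = Y" using 3 by auto
    ultimately show ?thesis using nn m by (simp add: add_increasing2)
  next
    case 4
    then show ?thesis using m by simp
  qed
qed

text \<open>
  The inequality for a pair of which only the first point is affected by the cutoff.  The error must be
  linear in \<open>X\<^sup>+\<close> and of degree \<open>m - 1\<close> in \<open>Y\<^sup>+\<close>, because the weighted tail of \<open>u\<close> controls
  only the power \<open>m - 1\<close>.  An error occurs only if \<open>Y\<close> is positive and \<open>\<alpha> X > X - Y\<close>.  The power of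
  the cut-off excess is at most a multiple of \<open>X powr m\<close>: if \<open>Y > X / 2\<close>, this is dominated by the error,
  and otherwise the increment \<open>X - Y \<ge> X / 2\<close> absorbs it.
\<close>

lemma truncation_far:
  fixes m X Y \<alpha> :: real
  assumes m: "1 < m" and \<alpha>: "0 \<le> \<alpha>" "\<alpha> \<le> 1"
  shows "\<bar>(X - \<alpha> * max X 0) - Y\<bar> powr m + 2 powr (-m) * \<bar>\<alpha> * max X 0\<bar> powr m
    \<le> \<bar>X - Y\<bar> powr m + (m + 1) * (max X 0 * max Y 0 powr (m - 1))"
proof -
  have m1: "1 \<le> m" using m by simp
  have split: "c powr m = c * c powr (m - 1)" if "0 \<le> c" for c :: real
    using powr_mult_base[OF that, of "m - 1"] by simp
  have two: "2 powr (-m) \<le> (1::real)" using m by (simp add: powr_minus ge_one_powr_ge_zero inverse_le_1_iff)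
  have err: "0 \<le> max X 0 * max Y 0 powr (m - 1)" by simp
  consider "X \<le> 0" | "X > 0" "Y \<le> 0" | "X > 0" "Y > 0" "\<alpha> * X \<le> X - Y"
    | "X > 0" "Y > 0" "Y \<le> X" "X - Y < \<alpha> * X" | "X > 0" "X < Y" by linarith
  then show ?thesis
  proof cases
    case 1
    then show ?thesis using m by simp
  next
    case 2
    then show ?thesis using truncation_across_level[of m X Y \<alpha>] m \<alpha> by simp
  next
    case 3
    have aX: "0 \<le> \<alpha> * X" using 3 \<alpha> by simp
    have "(X - Y - \<alpha> * X) powr m + (\<alpha> * X) powr m \<le> (X - Y) powr m"
      using powr_superadditive[of m "X - Y - \<alpha> * X" "\<alpha> * X"] 3 m aX by simp
    moreover have "2 powr (-m) * (\<alpha> * X) powr m \<le> 1 * (\<alpha> * X) powr m"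
      by (intro mult_right_mono two) auto
    moreover have "\<bar>X - \<alpha> * X - Y\<bar> = X - Y - \<alpha> * X" "\<bar>X - Y\<bar> = X - Y" "\<bar>\<alpha> * X\<bar> = \<alpha> * X"
      using 3 aX by linarith+
    moreover have "0 \<le> (m + 1) * (max X 0 * max Y 0 powr (m - 1))" using m err by simp
    moreover have "max X 0 = X" using 3 by simp
    ultimately show ?thesis by simp
  next
    case 4
    have aX: "\<alpha> * X \<le> X" using 4 \<alpha> by (simp add: mult_left_le_one_le)
    have "\<bar>X - \<alpha> * X - Y\<bar> \<le> Y" using aX 4 by linarith
    then have "\<bar>X - \<alpha> * X - Y\<bar> powr m \<le> Y powr m" using m by (intro powr_mono2) auto
    also have "\<dots> \<le> X * Y powr (m - 1)"
      using split[of Y] 4 by (simp add: mult_right_mono)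
    finally have v: "\<bar>X - \<alpha> * X - Y\<bar> powr m \<le> X * Y powr (m - 1)" .
    have "2 powr (-m) * \<bar>\<alpha> * X\<bar> powr m \<le> 2 powr (-m) * X powr m"
      using aX 4 \<alpha> m by (intro mult_left_mono powr_mono2) auto
    also have "\<dots> = (X / 2) powr m" using 4 by (simp add: powr_divide powr_minus field_simps)
    also have "\<dots> \<le> \<bar>X - Y\<bar> powr m + X * Y powr (m - 1)"
    proof (cases "Y \<le> X / 2")
      case True
      then have "(X / 2) powr m \<le> \<bar>X - Y\<bar> powr m" using 4 m by (intro powr_mono2) auto
      then show ?thesis using 4 by (simp add: add_increasing2)
    next
      case False
      have "(X / 2) powr m = X / 2 * (X / 2) powr (m - 1)" using 4 split by simp
      also have "\<dots> \<le> X * Y powr (m - 1)" using False 4 m by (intro mult_mono powr_mono2) auto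
      finally show ?thesis by (simp add: add_increasing)
    qed
    finally have f: "2 powr (-m) * \<bar>\<alpha> * X\<bar> powr m \<le> \<bar>X - Y\<bar> powr m + X * Y powr (m - 1)" .
    have "2 * (X * Y powr (m - 1)) \<le> (m + 1) * (X * Y powr (m - 1))"
      using 4 m by (intro mult_right_mono) auto
    moreover have "max X 0 = X" "max Y 0 = Y" using 4 by auto
    ultimately show ?thesis using v f by simp
  next
    case 5
    have aX: "0 \<le> \<alpha> * X" "\<alpha> * X \<le> X" using 5 \<alpha> by (auto simp: mult_left_le_one_le)
    have le: "(Y - X + \<alpha> * X) powr (m - 1) \<le> Y powr (m - 1)" using aX 5 m by (intro powr_mono2) auto
    have "(Y - X + \<alpha> * X) powr m \<le> (Y - X) powr m + m * (\<alpha> * X) * (Y - X + \<alpha> * X) powr (m - 1)"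
      using powr_add_diff_le[of m "Y - X" "\<alpha> * X"] m 5 aX by auto
    also have "m * (\<alpha> * X) * (Y - X + \<alpha> * X) powr (m - 1) \<le> m * X * Y powr (m - 1)"
      using aX le m 5 by (intro mult_mono) auto
    finally have "(Y - X + \<alpha> * X) powr m \<le> (Y - X) powr m + m * X * Y powr (m - 1)" by simp
    moreover have "\<bar>X - \<alpha> * X - Y\<bar> = Y - X + \<alpha> * X" "\<bar>X - Y\<bar> = Y - X" using aX 5 by linarith+
    ultimately have v: "\<bar>X - \<alpha> * X - Y\<bar> powr m \<le> \<bar>X - Y\<bar> powr m + m * X * Y powr (m - 1)" by simp
    have "2 powr (-m) * \<bar>\<alpha> * X\<bar> powr m \<le> 1 * X powr m"
      using two aX m by (intro mult_mono powr_mono2) auto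
    also have "\<dots> \<le> X * Y powr (m - 1)"
      using split[of X] 5 m by (auto intro!: mult_left_mono powr_mono2)
    finally have "2 powr (-m) * \<bar>\<alpha> * X\<bar> powr m \<le> X * Y powr (m - 1)" .
    with v show ?thesis using 5 by (simp add: algebra_simps)
  qed
qed

section \<open>Lebesgue measure on products and the singular kernel\<close>

text \<open>
  Tonelli's theorem for the completed product measure.  Almost every section agrees almost everywhere with
  a section of a Borel representative, and a non-measurable integrand has its lower integral, so no
  exceptional set has to be carried along.
\<close>

lemma lebesgue_Tonelli:
  fixes F :: "'a::euclidean_space \<times> 'b::euclidean_space \<Rightarrow> ennreal"
  assumes F: "F \<in> borel_measurable lebesgue"
  shows nn_integral_lebesgue_fst:
      "(\<integral>\<^sup>+ z. F z \<partial>lebesgue) = (\<integral>\<^sup>+ x. \<integral>\<^sup>+ y. F (x, y) \<partial>lebesgue \<partial>lebesgue)"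
    and nn_integral_lebesgue_snd:
      "(\<integral>\<^sup>+ z. F z \<partial>lebesgue) = (\<integral>\<^sup>+ y. \<integral>\<^sup>+ x. F (x, y) \<partial>lebesgue \<partial>lebesgue)"
proof -
  obtain F' where F': "F' \<in> borel_measurable lborel" "AE z in lborel. F z = F' z"
    using completion_ex_borel_measurable[OF F] by blast
  have m: "F' \<in> borel_measurable (lborel \<Otimes>\<^sub>M lborel)" using F'(1) by (simp add: lborel_prod)
  have ae: "AE z in lborel \<Otimes>\<^sub>M lborel. F z = F' z" using F'(2) unfolding lborel_prod .
  have ae1: "AE x in lborel. AE y in lborel. F (x, y) = F' (x, y)"
    using lborel_pair.AE_pair[OF ae] .
  have "AE z in distr (lborel \<Otimes>\<^sub>M lborel) (lborel \<Otimes>\<^sub>M lborel) (\<lambda>(x, y). (y, x)). F z = F' z"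
    using ae lborel_pair.distr_pair_swap by metis
  then have "AE z in lborel \<Otimes>\<^sub>M lborel. F (snd z, fst z) = F' (snd z, fst z)"
    using AE_distrD[OF measurable_pair_swap'] by (force simp: case_prod_unfold)
  then have ae2: "AE y in lborel. AE x in lborel. F (x, y) = F' (x, y)"
    using lborel_pair.AE_pair by fastforce
  have i1: "AE x in lborel. (\<integral>\<^sup>+ y. F (x, y) \<partial>lborel) = (\<integral>\<^sup>+ y. F' (x, y) \<partial>lborel)"
    using ae1 by (auto intro: nn_integral_cong_AE)
  have i2: "AE y in lborel. (\<integral>\<^sup>+ x. F (x, y) \<partial>lborel) = (\<integral>\<^sup>+ x. F' (x, y) \<partial>lborel)"
    using ae2 by (auto intro: nn_integral_cong_AE)
  have eq: "(\<integral>\<^sup>+ z. F z \<partial>lebesgue) = (\<integral>\<^sup>+ z. F' z \<partial>(lborel \<Otimes>\<^sub>M lborel))"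
    by (simp add: nn_integral_completion lborel_prod nn_integral_cong_AE[OF F'(2)])
  show "(\<integral>\<^sup>+ z. F z \<partial>lebesgue) = (\<integral>\<^sup>+ x. \<integral>\<^sup>+ y. F (x, y) \<partial>lebesgue \<partial>lebesgue)"
    unfolding eq unfolding lborel.nn_integral_fst[OF m, symmetric] nn_integral_completion
    using i1 by (intro nn_integral_cong_AE) (auto elim: eventually_mono)
  show "(\<integral>\<^sup>+ z. F z \<partial>lebesgue) = (\<integral>\<^sup>+ y. \<integral>\<^sup>+ x. F (x, y) \<partial>lebesgue \<partial>lebesgue)"
    unfolding eq unfolding lborel_pair.nn_integral_snd[OF m, symmetric] nn_integral_completion
    using i2 by (intro nn_integral_cong_AE) (auto elim: eventually_mono)
qed

lemma measurable_fst_lebesgue [measurable]: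
  "(fst :: 'a::euclidean_space \<times> 'b::euclidean_space \<Rightarrow> 'a) \<in> lebesgue \<rightarrow>\<^sub>M lebesgue"
proof (rule completion.measurable_completion2)
  show meas: "(fst :: 'a \<times> 'b \<Rightarrow> 'a) \<in> lebesgue \<rightarrow>\<^sub>M lborel"
    by (intro measurable_completion) (simp add: borel_prod[symmetric])
  show "null_sets lborel \<subseteq> null_sets (distr lebesgue lborel (fst :: 'a \<times> 'b \<Rightarrow> 'a))"
  proof
    fix A :: "'a set" assume A: "A \<in> null_sets lborel"
    have "A \<times> UNIV \<in> null_sets (lborel \<Otimes>\<^sub>M lborel :: ('a \<times> 'b) measure)"
      using A by (intro lborel.times_in_null_sets1) auto
    then have "A \<times> UNIV \<in> null_sets (lebesgue :: ('a \<times> 'b) measure)"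
      by (simp add: lborel_prod null_sets_completionI)
    moreover have "(fst :: 'a \<times> 'b \<Rightarrow> 'a) -` A = A \<times> UNIV" by auto
    ultimately show "A \<in> null_sets (distr lebesgue lborel (fst :: 'a \<times> 'b \<Rightarrow> 'a))"
      using A meas by (subst null_sets_distr_iff) auto
  qed
qed

lemma measurable_snd_lebesgue [measurable]:
  "(snd :: 'a::euclidean_space \<times> 'b::euclidean_space \<Rightarrow> 'b) \<in> lebesgue \<rightarrow>\<^sub>M lebesgue"
proof (rule completion.measurable_completion2)
  show meas: "(snd :: 'a \<times> 'b \<Rightarrow> 'b) \<in> lebesgue \<rightarrow>\<^sub>M lborel"
    by (intro measurable_completion) (simp add: borel_prod[symmetric])
  show "null_sets lborel \<subseteq> null_sets (distr lebesgue lborel (snd :: 'a \<times> 'b \<Rightarrow> 'b))"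
  proof
    fix A :: "'b set" assume A: "A \<in> null_sets lborel"
    have "UNIV \<times> A \<in> null_sets (lborel \<Otimes>\<^sub>M lborel :: ('a \<times> 'b) measure)"
      using A by (intro lborel.times_in_null_sets2) auto
    then have "UNIV \<times> A \<in> null_sets (lebesgue :: ('a \<times> 'b) measure)"
      by (simp add: lborel_prod null_sets_completionI)
    moreover have "(snd :: 'a \<times> 'b \<Rightarrow> 'b) -` A = UNIV \<times> A" by auto
    ultimately show "A \<in> null_sets (distr lebesgue lborel (snd :: 'a \<times> 'b \<Rightarrow> 'b))"
      using A meas by (subst null_sets_distr_iff) auto
  qed
qed

lemma borel_measurable_lebesgue_fst_snd [measurable]:
  "(fst :: 'a::euclidean_space \<times> 'b::euclidean_space \<Rightarrow> 'a) \<in> borel_measurable lebesgue"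
  "(snd :: 'a::euclidean_space \<times> 'b::euclidean_space \<Rightarrow> 'b) \<in> borel_measurable lebesgue"
  by (rule measurable_completion, simp add: borel_prod[symmetric])+

lemma borel_measurable_compose_fst_snd [measurable (raw)]:
  fixes u :: "'a::euclidean_space \<Rightarrow> 'c::topological_space"
  assumes "u \<in> borel_measurable lebesgue"
  shows "(\<lambda>z :: 'a \<times> 'b::euclidean_space. u (fst z)) \<in> borel_measurable lebesgue"
    and "(\<lambda>z :: 'b::euclidean_space \<times> 'a. u (snd z)) \<in> borel_measurable lebesgue"
  by (rule measurable_compose[OF _ assms], rule measurable_fst_lebesgue measurable_snd_lebesgue)+

lemma ennreal_le_suminf: "f k \<le> (\<Sum>k. f k)" for f :: "nat \<Rightarrow> ennreal"
  using sum_le_suminf[of f "{k}"] by simp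

text \<open>
  A kernel with singularity of order less than the dimension is locally integrable, uniformly in the pole:
  on the annulus of outer radius \<open>\<rho> / 2\<^sup>k\<close> it is at most \<open>c k\<close>, and \<open>c k\<close> times the volume of that ball
  is a geometric sequence.
\<close>

lemma nn_integral_singular_kernel:
  fixes e \<rho> :: real
  assumes e: "0 < e" and \<rho>: "0 < \<rho>"
  obtains I where "0 \<le> I"
    "\<And>x :: 'a::euclidean_space.
      (\<integral>\<^sup>+ y. ennreal (indicator (ball x \<rho>) y * norm (x - y) powr (e - DIM('a))) \<partial>lebesgue) \<le> ennreal I"
proof -
  define n where "n = real DIM('a)"
  \<comment> \<open>Bounding \<open>r powr e\<close> at the outer and \<open>r powr (- n)\<close> at the inner radius separately covers both
    signs of \<open>e - n\<close>.\<close>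
  define c where "c k = (\<rho> / 2 ^ k) powr e * (\<rho> / 2 ^ Suc k) powr (- n)" for k
  define V where "V = unit_ball_vol (real DIM('a))"
  define A where "A = V * \<rho> powr e * 2 powr n"
  have c0: "c k \<ge> 0" for k by (simp add: c_def)
  have V0: "V \<ge> 0" by (simp add: V_def)
  have cv: "c k * (V * (\<rho> / 2 ^ k) ^ DIM('a)) = A * (2 powr (-e)) ^ k" for k
  proof -
    have p2: "(2::real) ^ k = 2 powr k" by (simp add: powr_realpow)
    have pos: "\<rho> / 2 ^ k > 0" using \<rho> by simp
    have "(\<rho> / 2 ^ k) ^ DIM('a) = (\<rho> / 2 ^ k) powr n" unfolding n_def using pos by (subst powr_realpow) auto
    moreover have "(\<rho> / 2 ^ Suc k) powr (- n) = (\<rho> / 2 ^ k) powr (- n) * 2 powr n"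
    proof -
      have "\<rho> / 2 ^ Suc k = (\<rho> / 2 ^ k) / 2" by simp
      show ?thesis using pos unfolding \<open>\<rho> / 2 ^ Suc k = (\<rho> / 2 ^ k) / 2\<close>
        by (subst powr_divide) (auto simp: powr_minus field_simps)
    qed
    moreover have "(\<rho> / 2 ^ k) powr (- n) * (\<rho> / 2 ^ k) powr n = 1"
      using pos by (metis powr_add add.left_inverse powr_zero_eq_one less_irrefl)
    moreover have "(\<rho> / 2 ^ k) powr e = \<rho> powr e * (2 powr (-e)) ^ k"
      using \<rho> by (simp add: powr_divide p2 powr_powr powr_power powr_minus field_simps)
    ultimately show ?thesis by (simp add: c_def A_def)
  qed
  have q: "2 powr (-e) < (1::real)" using e by (simp add: powr_minus field_simps)
  have summ: "summable (\<lambda>k. A * (2 powr (-e)) ^ k)"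
    using q by (intro summable_mult summable_geometric) auto
  define I where "I = (\<Sum>k. A * (2 powr (-e)) ^ k)"
  have A0: "A \<ge> 0" using V0 by (simp add: A_def)
  show ?thesis
  proof
    show "0 \<le> I" unfolding I_def using A0 by (intro suminf_nonneg summ) auto
    fix x :: 'a
    have ptw: "ennreal (indicator (ball x \<rho>) y * norm (x - y) powr (e - DIM('a)))
       \<le> (\<Sum>k. ennreal (c k) * indicator (cball x (\<rho> / 2 ^ k)) y)" for y
    proof (cases "y = x \<or> y \<notin> ball x \<rho>")
      case True
      then show ?thesis by auto
    next
      case False
      define r where "r = norm (x - y)"
      have r: "0 < r" "r < \<rho>" using False by (auto simp: r_def dist_norm)
      have "\<exists>k. \<rho> / 2 ^ Suc k \<le> r"
      proof -
        obtain k where "(1/2) ^ k < r / \<rho>" using real_arch_pow_inv[of "r / \<rho>" "1/2"] r \<rho> by auto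
        then have "\<rho> / 2 ^ k < r" using \<rho> by (simp add: field_simps power_one_over)
        moreover have "\<rho> / 2 ^ Suc k \<le> \<rho> / 2 ^ k" using \<rho> by (simp add: field_simps)
        ultimately show ?thesis by (intro exI[of _ k]) linarith
      qed
      then obtain k where k: "\<rho> / 2 ^ Suc k \<le> r" "\<And>j. j < k \<Longrightarrow> \<not> \<rho> / 2 ^ Suc j \<le> r"
        using exists_least_iff[of "\<lambda>k. \<rho> / 2 ^ Suc k \<le> r"] by blast
      have rk: "r \<le> \<rho> / 2 ^ k"
      proof (cases k)
        case 0 then show ?thesis using r by simp
      next
        case (Suc j) then show ?thesis using k(2)[of j] by simp
      qed
      have "r powr (e - n) = r powr e * r powr (- n)"
        by (simp add: powr_add[symmetric])
      also have "\<dots> \<le> c k" unfolding c_def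
        using r rk k(1) \<rho> e by (intro mult_mono powr_mono2 powr_mono2') (auto simp: n_def)
      finally have "ennreal (indicator (ball x \<rho>) y * r powr (e - n)) \<le> ennreal (c k) * indicator (cball x (\<rho> / 2 ^ k)) y"
        using rk False by (auto simp: r_def dist_norm indicator_def intro!: ennreal_leI)
      also have "\<dots> \<le> (\<Sum>k. ennreal (c k) * indicator (cball x (\<rho> / 2 ^ k)) y)"
        by (rule ennreal_le_suminf)
      finally show ?thesis unfolding r_def n_def .
    qed
    have "(\<integral>\<^sup>+ y. ennreal (indicator (ball x \<rho>) y * norm (x - y) powr (e - DIM('a))) \<partial>lebesgue)
       \<le> (\<integral>\<^sup>+ y. (\<Sum>k. ennreal (c k) * indicator (cball x (\<rho> / 2 ^ k)) y) \<partial>lebesgue)"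
      by (intro nn_integral_mono ptw)
    also have "\<dots> = (\<Sum>k. \<integral>\<^sup>+ y. ennreal (c k) * indicator (cball x (\<rho> / 2 ^ k)) y \<partial>lebesgue)"
      by (intro nn_integral_suminf borel_measurable_times_ennreal borel_measurable_const
          borel_measurable_indicator) auto
    also have "\<dots> = (\<Sum>k. ennreal (A * (2 powr (-e)) ^ k))"
    proof (rule arg_cong[where f = suminf], rule ext)
      fix k
      have "(\<integral>\<^sup>+ y. ennreal (c k) * indicator (cball x (\<rho> / 2 ^ k)) y \<partial>lebesgue)
          = ennreal (c k) * ennreal (V * (\<rho> / 2 ^ k) ^ DIM('a))"
        unfolding V_def using \<rho> by (subst nn_integral_cmult_indicator) (auto simp: emeasure_cball)
      also have "\<dots> = ennreal (A * (2 powr (-e)) ^ k)"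
        unfolding cv[symmetric] using c0 V0 \<rho> by (intro ennreal_mult[symmetric]) auto
      finally show "(\<integral>\<^sup>+ y. ennreal (c k) * indicator (cball x (\<rho> / 2 ^ k)) y \<partial>lebesgue)
          = ennreal (A * (2 powr (-e)) ^ k)" .
    qed
    also have "\<dots> = ennreal I" unfolding I_def
      using A0 by (intro suminf_ennreal2 summ) auto
    finally show "(\<integral>\<^sup>+ y. ennreal (indicator (ball x \<rho>) y * norm (x - y) powr (e - DIM('a))) \<partial>lebesgue) \<le> ennreal I" .
  qed
qed

section \<open>The fractional Sobolev inequality\<close>

definition gagliardo_energy :: "real \<Rightarrow> real \<Rightarrow> ('a::euclidean_space \<Rightarrow> real) \<Rightarrow> ennreal"
  where "gagliardo_energy s p f =
    (\<integral>\<^sup>+ z. ennreal (\<bar>f (fst z) - f (snd z)\<bar> powr p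
      / norm (fst z - snd z) powr (real DIM('a) + s * p)) \<partial>lebesgue)"

text \<open>
  The heart of the Sobolev inequality: a pointwise bound that yields it after one integration in \<open>x\<close>.
  Let \<open>a = f x\<close>.  By Chebyshev the set where \<open>f > a / 2\<close> has measure at most \<open>N / (a / 2) powr r\<close>, and at
  most the volume of the ball supporting \<open>f\<close>.  Take the ball around \<open>x\<close> whose volume is twice the smaller of these
  bounds: on at least half of it \<open>f x - f y \<ge> a / 2\<close>, and this half alone contributes the left-hand side.
  The second bound keeps the radius bounded, so that its surplus power can be estimated by a constant if
  \<open>n (1 - p / r) < s p\<close>.
\<close>

lemma fractional_Sobolev_pointwise:
  fixes x0 :: "'a::euclidean_space" and p r s \<rho> :: real
  assumes pr: "0 < p" "p < r" and sp: "real DIM('a) * (1 - p / r) \<le> s * p" and \<rho>: "0 < \<rho>"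
  obtains c where "0 < c"
    "\<And>f N x. f \<in> borel_measurable lebesgue \<Longrightarrow> (\<And>x. 0 \<le> f x) \<Longrightarrow> (\<And>x. x \<notin> ball x0 \<rho> \<Longrightarrow> f x = 0) \<Longrightarrow>
      0 < N \<Longrightarrow> (\<integral>\<^sup>+ x. ennreal (f x powr r) \<partial>lebesgue) \<le> ennreal N \<Longrightarrow>
      ennreal (c * N powr (p / r - 1) * f x powr r)
        \<le> (\<integral>\<^sup>+ y. ennreal (\<bar>f x - f y\<bar> powr p / norm (x - y) powr (real DIM('a) + s * p)) \<partial>lebesgue)"
proof -
  define n where "n = real DIM('a)"
  define \<omega> where "\<omega> = unit_ball_vol n"
  define \<theta> where "\<theta> = 1 - p / r"
  define V where "V = \<omega> * \<rho> ^ DIM('a)"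
  define d0 where "d0 = (2 * V / \<omega>) powr (1 / n)"
  define c where "c = (1/2) powr p * (\<omega> / 2) * d0 powr (n * \<theta> - s * p) * (2 * 2 powr r / \<omega>) powr (- \<theta>)"
  have n: "n > 0" by (simp add: n_def)
  have \<omega>: "\<omega> > 0" using n by (simp add: \<omega>_def)
  have V: "V > 0" using \<omega> \<rho> by (simp add: V_def)
  have d0: "d0 > 0" using V \<omega> by (simp add: d0_def)
  have r: "r > 0" using pr by simp
  have \<theta>: "0 < \<theta>" "\<theta> < 1" using pr r by (auto simp: \<theta>_def field_simps)
  have vol: "measure lebesgue (ball z d) = \<omega> * d powr n" if "d > 0" for z :: 'a and d
    using content_ball[of d z] that by (simp add: \<omega>_def n_def powr_realpow)
  have c: "c > 0" using d0 \<omega> by (simp add: c_def)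
  show ?thesis
  proof (rule that[OF c])
    fix f :: "'a \<Rightarrow> real" and N :: real and x :: 'a
    assume [measurable]: "f \<in> borel_measurable lebesgue"
      and f0: "\<And>x. 0 \<le> f x" and supp: "\<And>x. x \<notin> ball x0 \<rho> \<Longrightarrow> f x = 0"
      and N: "0 < N" "(\<integral>\<^sup>+ x. ennreal (f x powr r) \<partial>lebesgue) \<le> ennreal N"
    let ?int = "\<integral>\<^sup>+ y. ennreal (\<bar>f x - f y\<bar> powr p / norm (x - y) powr (n + s * p)) \<partial>lebesgue"
    have "ennreal (c * N powr (- \<theta>) * f x powr r) \<le> ?int"
    proof (cases "f x = 0")
      case False
      define a where "a = f x"
      have a: "a > 0" using False f0[of x] by (simp add: a_def)
      define m0 where "m0 = min (2 powr r * N / a powr r) V"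
      define d where "d = (2 * m0 / \<omega>) powr (1 / n)"
      have m0: "m0 > 0" using a N V by (simp add: m0_def)
      have d: "d > 0" using m0 \<omega> by (simp add: d_def)
      have dn: "d powr n = 2 * m0 / \<omega>" using n m0 \<omega> by (simp add: d_def powr_powr)
      define B where "B = {y \<in> ball x d. f y > a / 2}"
      define G where "G = ball x d - B"
      have "B = ball x d \<inter> {y \<in> space lebesgue. f y > a / 2}" by (auto simp: B_def)
      then have Bm[measurable]: "B \<in> sets lebesgue"
        by (simp only:) (intro sets.Int, simp, measurable)
      have Bsub: "B \<subseteq> ball x d" by (auto simp: B_def)
      have lm: "B \<in> lmeasurable"
        using fmeasurableI2[OF lmeasurable_ball Bsub Bm] .
      have "B \<subseteq> ball x0 \<rho>" using supp a by (force simp: B_def)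
      then have B1: "measure lebesgue B \<le> V"
        using measure_mono_fmeasurable[of B "ball x0 \<rho>" lebesgue] vol[OF \<rho>, of x0] \<rho>
        by (auto simp: V_def n_def powr_realpow)
      have "ennreal ((a / 2) powr r) * emeasure lebesgue B = (\<integral>\<^sup>+ y. ennreal ((a / 2) powr r) * indicator B y \<partial>lebesgue)"
        by (simp add: nn_integral_cmult_indicator)
      also have "\<dots> \<le> (\<integral>\<^sup>+ x. ennreal (f x powr r) \<partial>lebesgue)"
        using a r by (intro nn_integral_mono) (auto simp: B_def indicator_def intro!: ennreal_leI powr_mono2)
      also have "\<dots> \<le> ennreal N" by (rule N)
      finally have "ennreal ((a / 2) powr r * measure lebesgue B) \<le> ennreal N"
        using lm by (simp add: emeasure_eq_measure2 ennreal_mult)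
      then have "(a / 2) powr r * measure lebesgue B \<le> N"
        using N by simp
      then have B2: "measure lebesgue B \<le> 2 powr r * N / a powr r"
        using a by (simp add: powr_divide field_simps)
      have Bm0: "measure lebesgue B \<le> m0" using B1 B2 by (simp add: m0_def)
      have "measure lebesgue G = measure lebesgue (ball x d) - measure lebesgue B"
        unfolding G_def by (rule measurable_measure_Diff[OF lmeasurable_ball Bm Bsub])
      also have "measure lebesgue (ball x d) = 2 * m0" using vol[OF d, of x] dn \<omega> by simp
      finally have Gm: "m0 \<le> measure lebesgue G" using Bm0 by simp
      have lG: "G \<in> lmeasurable" unfolding G_def using lm by (intro fmeasurable.Diff) auto
      define \<kappa> where "\<kappa> = (a / 2) powr p * d powr (- (n + s * p))"
      have ptw: "ennreal \<kappa> * indicator G y \<le> ennreal (\<bar>f x - f y\<bar> powr p / norm (x - y) powr (n + s * p))" for y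
      proof (cases "y \<in> G")
        case True
        then have y: "f y \<le> a / 2" "norm (x - y) < d" by (auto simp: G_def B_def dist_norm)
        have "x \<noteq> y" using y(1) a by (auto simp: a_def)
        have sp0: "s * p \<ge> 0" using sp \<theta> n by (simp add: \<theta>_def[symmetric] n_def[symmetric]) (meson mult_nonneg_nonneg less_imp_le order_trans)
        have "(a / 2) powr p * d powr (- (n + s * p)) \<le> \<bar>f x - f y\<bar> powr p * norm (x - y) powr (- (n + s * p))"
          using y a d \<open>x \<noteq> y\<close> pr n sp0
          by (intro mult_mono powr_mono2 powr_mono2') (auto simp: a_def[symmetric])
        also have "norm (x - y) powr (- (n + s * p)) = 1 / norm (x - y) powr (n + s * p)"
          by (rule powr_minus_divide)
        finally have "\<kappa> \<le> \<bar>f x - f y\<bar> powr p / norm (x - y) powr (n + s * p)"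
          unfolding \<kappa>_def by simp
        then show ?thesis using True by (simp add: ennreal_leI)
      qed auto
      have "ennreal (\<kappa> * m0) \<le> ennreal \<kappa> * emeasure lebesgue G"
        unfolding emeasure_eq_measure2[OF lG]
        using mult_left_mono[OF Gm, of \<kappa>] by (simp add: ennreal_mult[symmetric] \<kappa>_def ennreal_leI)
      also have "\<dots> = (\<integral>\<^sup>+ y. ennreal \<kappa> * indicator G y \<partial>lebesgue)"
        using lG by (simp add: nn_integral_cmult_indicator fmeasurableD)
      also have "\<dots> \<le> ?int" by (intro nn_integral_mono ptw)
      finally have I: "ennreal (\<kappa> * m0) \<le> ?int" .
      have m0d: "m0 = d powr n * (\<omega> / 2)" using dn \<omega> by simp
      have dd0: "d \<le> d0" unfolding d_def d0_def
        using \<omega> m0 n by (intro powr_mono2) (auto simp: m0_def divide_right_mono)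
      have pw1: "d0 powr (n * \<theta> - s * p) \<le> d powr (n * \<theta> - s * p)"
        using dd0 d sp by (intro powr_mono2') (auto simp: n_def \<theta>_def)
      have "2 * m0 / \<omega> \<le> 2 * (2 powr r * N / a powr r) / \<omega>"
        using \<omega> by (intro divide_right_mono mult_left_mono) (auto simp: m0_def)
      then have pw2: "(2 * (2 powr r * N / a powr r) / \<omega>) powr (- \<theta>) \<le> (2 * m0 / \<omega>) powr (- \<theta>)"
        using \<omega> m0 \<theta> by (intro powr_mono2') auto
      \<comment> \<open>Since \<open>p + r \<theta> = r\<close>, the powers of \<open>a\<close> coming from the increment and from the radius combine
        to \<open>a powr r\<close>.\<close>
      have "c * N powr (- \<theta>) * a powr r = (a / 2) powr p * (\<omega> / 2) * (d0 powr (n * \<theta> - s * p) *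
          (((2 * 2 powr r / \<omega>) * N) powr (- \<theta>) * a powr (r * \<theta>)))"
      proof -
        have "a powr r = a powr p * a powr (r * \<theta>)"
          using r by (simp add: powr_add[symmetric] \<theta>_def right_diff_distrib)
        then show ?thesis using \<omega> N a by (simp add: c_def powr_mult powr_divide)
      qed
      also have "((2 * 2 powr r / \<omega>) * N) powr (- \<theta>) * a powr (r * \<theta>) = (2 * (2 powr r * N / a powr r) / \<omega>) powr (- \<theta>)"
        using \<omega> N a by (simp add: powr_mult powr_divide powr_powr powr_minus field_simps)
      also have "(a / 2) powr p * (\<omega> / 2) * (d0 powr (n * \<theta> - s * p) * (2 * (2 powr r * N / a powr r) / \<omega>) powr (- \<theta>))
         \<le> (a / 2) powr p * (\<omega> / 2) * (d powr (n * \<theta> - s * p) * (2 * m0 / \<omega>) powr (- \<theta>))"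
        using pw1 pw2 \<omega> by (intro mult_left_mono mult_mono) auto
      also have "(2 * m0 / \<omega>) powr (- \<theta>) = d powr (- (n * \<theta>))"
        unfolding dn[symmetric] by (simp add: powr_powr)
      also have "d powr (n * \<theta> - s * p) * d powr (- (n * \<theta>)) = d powr (- (n + s * p)) * d powr n"
        by (simp add: powr_add[symmetric])
      also have "(a / 2) powr p * (\<omega> / 2) * (d powr (- (n + s * p)) * d powr n) = \<kappa> * m0"
        unfolding m0d \<kappa>_def by simp
      finally have "c * N powr (- \<theta>) * a powr r \<le> \<kappa> * m0" .
      then have "ennreal (c * N powr (- \<theta>) * a powr r) \<le> ennreal (\<kappa> * m0)" by (rule ennreal_leI)
      then show ?thesis using I unfolding a_def by (rule order_trans)
    qed (use r in simp)
    then show "ennreal (c * N powr (p / r - 1) * f x powr r)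
        \<le> (\<integral>\<^sup>+ y. ennreal (\<bar>f x - f y\<bar> powr p / norm (x - y) powr (real DIM('a) + s * p)) \<partial>lebesgue)"
      unfolding \<theta>_def n_def by simp
  qed
qed

text \<open>
  Integrating the pointwise bound with \<open>N\<close> equal to the integral of \<open>f powr r\<close> gives
  \<open>c N powr (p / r) \<le> E\<close>, provided that \<open>N\<close> is finite.  The truncations \<open>min f i\<close> have finite \<open>N\<close>
  and no larger energy, so monotone convergence removes the proviso.
\<close>

lemma fractional_Sobolev:
  fixes x0 :: "'a::euclidean_space" and p r s \<rho> :: real
  assumes pr: "0 < p" "p < r" and sp: "real DIM('a) * (1 - p / r) \<le> s * p" and \<rho>: "0 < \<rho>"
  obtains C where "0 < C"
    "\<And>f E. f \<in> borel_measurable lebesgue \<Longrightarrow> (\<And>x. 0 \<le> f x) \<Longrightarrow> (\<And>x. x \<notin> ball x0 \<rho> \<Longrightarrow> f x = 0) \<Longrightarrow>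
      0 \<le> E \<Longrightarrow>
      gagliardo_energy s p f \<le> ennreal E \<Longrightarrow>
      (\<integral>\<^sup>+ x. ennreal (f x powr r) \<partial>lebesgue) \<le> ennreal (C * E powr (r / p))"
proof (rule fractional_Sobolev_pointwise[OF pr sp \<rho>, of x0])
  fix c :: real
  assume c: "0 < c" and main:
    "\<And>f N x. f \<in> borel_measurable lebesgue \<Longrightarrow> (\<And>x. 0 \<le> f x) \<Longrightarrow> (\<And>x. x \<notin> ball x0 \<rho> \<Longrightarrow> f x = 0) \<Longrightarrow>
      0 < N \<Longrightarrow> (\<integral>\<^sup>+ x. ennreal (f x powr r) \<partial>lebesgue) \<le> ennreal N \<Longrightarrow>
      ennreal (c * N powr (p / r - 1) * f x powr r)
        \<le> (\<integral>\<^sup>+ y. ennreal (\<bar>f x - f y\<bar> powr p / norm (x - y) powr (real DIM('a) + s * p)) \<partial>lebesgue)"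
  have r: "r > 0" using pr by simp
  define C where "C = (1 / c) powr (r / p)"
  have C: "C > 0" using c by (simp add: C_def)
  have fin: "(\<integral>\<^sup>+ x. ennreal (f x powr r) \<partial>lebesgue) \<le> ennreal (C * E powr (r / p))"
    if [measurable]: "f \<in> borel_measurable lebesgue" and f0: "\<And>x. 0 \<le> f x"
      and supp: "\<And>x. x \<notin> ball x0 \<rho> \<Longrightarrow> f x = 0" and E: "0 \<le> E"
      and I: "gagliardo_energy s p f \<le> ennreal E"
      and finite: "(\<integral>\<^sup>+ x. ennreal (f x powr r) \<partial>lebesgue) < \<infinity>" for f E
  proof -
    define N where "N = enn2real (\<integral>\<^sup>+ x. ennreal (f x powr r) \<partial>lebesgue)"
    have eN: "(\<integral>\<^sup>+ x. ennreal (f x powr r) \<partial>lebesgue) = ennreal N"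
      using finite by (simp add: N_def)
    show ?thesis
    proof (cases "N > 0")
      case False
      then show ?thesis using eN by (simp add: ennreal_neg)
    next
      case True
      define K where "K = c * N powr (p / r - 1)"
      have K: "K > 0" using c True by (simp add: K_def)
      have "ennreal (K * N) = (\<integral>\<^sup>+ x. ennreal K * ennreal (f x powr r) \<partial>lebesgue)"
        using K True eN by (simp add: nn_integral_cmult ennreal_mult)
      also have "\<dots> \<le> (\<integral>\<^sup>+ x. \<integral>\<^sup>+ y. ennreal (\<bar>f x - f y\<bar> powr p / norm (x - y) powr (real DIM('a) + s * p)) \<partial>lebesgue \<partial>lebesgue)"
        using main[of f N, OF _ f0 supp True] eN K
        by (intro nn_integral_mono) (simp add: K_def ennreal_mult[symmetric])
      also have "\<dots> = gagliardo_energy s p f"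
        unfolding gagliardo_energy_def by (subst nn_integral_lebesgue_fst) auto
      also have "\<dots> \<le> ennreal E" by (rule I)
      finally have "K * N \<le> E" using E by simp
      then have "c * N powr (p / r) \<le> E"
        using True by (simp add: K_def powr_diff)
      then have "N powr (p / r) \<le> E / c" using c by (simp add: field_simps)
      then have "(N powr (p / r)) powr (r / p) \<le> (E / c) powr (r / p)"
        using pr by (intro powr_mono2) auto
      then have "N \<le> C * E powr (r / p)"
        using pr True c E by (simp add: powr_powr C_def powr_divide)
      then show ?thesis using eN by (simp add: ennreal_leI)
    qed
  qed
  show ?thesis
  proof (rule that[OF C])
    fix f :: "'a \<Rightarrow> real" and E :: real
    assume [measurable]: "f \<in> borel_measurable lebesgue" and f0: "\<And>x. 0 \<le> f x"
      and supp: "\<And>x. x \<notin> ball x0 \<rho> \<Longrightarrow> f x = 0" and E: "0 \<le> E"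
      and I: "gagliardo_energy s p f \<le> ennreal E"
    define g where "g i x = min (f x) (real i)" for i x
    have gm[measurable]: "g i \<in> borel_measurable lebesgue" for i unfolding g_def by measurable
    have bound: "(\<integral>\<^sup>+ x. ennreal (g i x powr r) \<partial>lebesgue) \<le> ennreal (C * E powr (r / p))" for i
    proof (rule fin)
      show "0 \<le> g i x" "x \<notin> ball x0 \<rho> \<Longrightarrow> g i x = 0" for x using f0 supp by (auto simp: g_def)
      have "gagliardo_energy s p (g i) \<le> gagliardo_energy s p f"
        unfolding gagliardo_energy_def
        using pr by (intro nn_integral_mono ennreal_leI divide_right_mono powr_mono2) (auto simp: g_def)
      then show "gagliardo_energy s p (g i) \<le> ennreal E"
        using I by (rule order_trans)
      have "(\<integral>\<^sup>+ x. ennreal (g i x powr r) \<partial>lebesgue) \<le> (\<integral>\<^sup>+ x. ennreal (real i powr r) * indicator (ball x0 \<rho>) x \<partial>lebesgue)"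
        using r f0 supp by (intro nn_integral_mono) (auto simp: g_def indicator_def intro!: ennreal_leI powr_mono2)
      also have "\<dots> < \<infinity>" using \<rho>
        by (simp add: nn_integral_cmult_indicator ennreal_mult_less_top emeasure_ball)
      finally show "(\<integral>\<^sup>+ x. ennreal (g i x powr r) \<partial>lebesgue) < \<infinity>" .
    qed (use E in auto)
    have "(\<integral>\<^sup>+ x. ennreal (f x powr r) \<partial>lebesgue) = (\<integral>\<^sup>+ x. (SUP i. ennreal (g i x powr r)) \<partial>lebesgue)"
    proof (intro nn_integral_cong antisym)
      fix x
      obtain i where "f x \<le> real i" using real_arch_simple by blast
      then have "g i x = f x" by (simp add: g_def)
      then show "ennreal (f x powr r) \<le> (SUP i. ennreal (g i x powr r))"
        by (metis SUP_upper UNIV_I)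
      show "(SUP i. ennreal (g i x powr r)) \<le> ennreal (f x powr r)"
        using r f0 by (intro SUP_least ennreal_leI powr_mono2) (auto simp: g_def)
    qed
    also have "\<dots> = (SUP i. \<integral>\<^sup>+ x. ennreal (g i x powr r) \<partial>lebesgue)"
      using r f0 by (intro nn_integral_monotone_convergence_SUP)
        (auto simp: incseq_def le_fun_def g_def intro!: ennreal_leI powr_mono2)
    also have "\<dots> \<le> ennreal (C * E powr (r / p))" by (intro SUP_least bound)
    finally show "(\<integral>\<^sup>+ x. ennreal (f x powr r) \<partial>lebesgue) \<le> ennreal (C * E powr (r / p))" .
  qed
qed

section \<open>Cutting off the part above a level\<close>

text \<open>
  This half of homogeneity holds for arbitrary integrands, hence for sections that are not
  known to be measurable.
\<close>

lemma nn_integral_cmult_le: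
  assumes c: "0 \<le> c"
  shows "(\<integral>\<^sup>+ x. ennreal c * g x \<partial>M) \<le> ennreal c * (\<integral>\<^sup>+ x. g x \<partial>M)"
proof (cases "c = 0")
  case False
  then have c: "c > 0" using assms by simp
  have inv: "ennreal c * (ennreal (1 / c) * t) = t" "ennreal (1 / c) * (ennreal c * t) = t" for t
    using c by (simp_all add: mult.assoc[symmetric] ennreal_mult[symmetric])
  have "integral\<^sup>S M s \<le> ennreal c * (\<integral>\<^sup>+ x. g x \<partial>M)"
    if s: "simple_function M s" "s \<le> (\<lambda>x. ennreal c * g x)" for s
  proof -
    have "integral\<^sup>S M s = (\<integral>\<^sup>+ x. ennreal c * (ennreal (1 / c) * s x) \<partial>M)"
      using nn_integral_eq_simple_integral[OF s(1)] inv by simp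
    also have "\<dots> = ennreal c * (\<integral>\<^sup>+ x. ennreal (1 / c) * s x \<partial>M)"
      using borel_measurable_simple_function[OF s(1)] by (intro nn_integral_cmult) auto
    also have "\<dots> \<le> ennreal c * (\<integral>\<^sup>+ x. g x \<partial>M)"
    proof (intro mult_left_mono nn_integral_mono)
      fix x
      have "ennreal (1 / c) * s x \<le> ennreal (1 / c) * (ennreal c * g x)"
        using s(2) by (intro mult_left_mono) (auto simp: le_fun_def)
      then show "ennreal (1 / c) * s x \<le> g x" unfolding inv .
    qed auto
    finally show ?thesis .
  qed
  then show ?thesis unfolding nn_integral_def[of M "\<lambda>x. ennreal c * g x"] by (intro SUP_least) auto
qed simp

definition plateau :: "'a::euclidean_space \<Rightarrow> real \<Rightarrow> real \<Rightarrow> 'a \<Rightarrow> real"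
  where "plateau x0 \<sigma> \<delta> x = max 0 (min 1 ((\<sigma> - dist x0 x) / \<delta>))"

lemma plateau_bounds: "0 \<le> plateau x0 \<sigma> \<delta> x" "plateau x0 \<sigma> \<delta> x \<le> 1"
  by (auto simp: plateau_def)

lemma plateau_eq_1: "0 < \<delta> \<Longrightarrow> dist x0 x \<le> \<sigma> - \<delta> \<Longrightarrow> plateau x0 \<sigma> \<delta> x = 1"
  by (simp add: plateau_def field_simps)

lemma plateau_eq_0: "0 < \<delta> \<Longrightarrow> x \<notin> ball x0 \<sigma> \<Longrightarrow> plateau x0 \<sigma> \<delta> x = 0"
  by (simp add: plateau_def divide_nonpos_pos)

lemma plateau_lipschitz:
  assumes "0 < \<delta>"
  shows "\<bar>plateau x0 \<sigma> \<delta> x - plateau x0 \<sigma> \<delta> y\<bar> \<le> norm (x - y) / \<delta>"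
proof -
  have "\<bar>plateau x0 \<sigma> \<delta> x - plateau x0 \<sigma> \<delta> y\<bar> \<le> \<bar>(\<sigma> - dist x0 x) / \<delta> - (\<sigma> - dist x0 y) / \<delta>\<bar>"
    unfolding plateau_def by linarith
  also have "\<dots> = \<bar>dist x0 y - dist x0 x\<bar> / \<delta>"
    using assms by (simp add: diff_divide_distrib[symmetric])
  also have "\<dots> \<le> norm (x - y) / \<delta>"
    using assms dist_triangle3[of x0 y x] dist_triangle3[of x0 x y] abs_dist_diff_le[of y x0 x]
    by (intro divide_right_mono) (auto simp: dist_commute dist_norm norm_minus_commute)
  finally show ?thesis .
qed

lemma plateau_measurable [measurable]: "plateau x0 \<sigma> \<delta> \<in> borel_measurable lebesgue"
  by (rule measurable_completion) (simp add: plateau_def[abs_def])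

definition excess :: "('a \<Rightarrow> real) \<Rightarrow> real \<Rightarrow> 'a \<Rightarrow> real"
  where "excess u k x = max (u x - k) 0"

text \<open>
  The competitor for \<open>u\<close> is \<open>u - cut_excess l x0 \<sigma> \<delta> u k\<close>.
\<close>

definition cut_excess :: "real \<Rightarrow> 'a::euclidean_space \<Rightarrow> real \<Rightarrow> real \<Rightarrow> ('a \<Rightarrow> real) \<Rightarrow> real \<Rightarrow> 'a \<Rightarrow> real"
  where "cut_excess l x0 \<sigma> \<delta> u k x = plateau x0 \<sigma> \<delta> x powr l * excess u k x"

text \<open>
  The error terms of \<open>truncation_near\<close> and of \<open>truncation_far\<close>, the latter for either point being the
  far one.  The gap \<open>\<delta>\<close> between the support of the cutoff and the outer ball keeps far pairs at distance at
  least \<open>\<delta>\<close>.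
\<close>

definition comparison_error ::
  "real \<Rightarrow> real \<Rightarrow> 'a::euclidean_space \<Rightarrow> real \<Rightarrow> real \<Rightarrow> ('a \<Rightarrow> real) \<Rightarrow> real \<Rightarrow> 'a \<times> 'a \<Rightarrow> real"
  where "comparison_error m l x0 \<sigma> \<delta> u k = (\<lambda>(x, y).
    indicator (ball x0 (\<sigma> + \<delta>)) x * indicator (ball x0 (\<sigma> + \<delta>)) y *
      (2 * l powr m * \<bar>plateau x0 \<sigma> \<delta> x - plateau x0 \<sigma> \<delta> y\<bar> powr m * (excess u k x powr m + excess u k y powr m))
    + indicator (ball x0 \<sigma>) x * indicator (- ball x0 (\<sigma> + \<delta>)) y * ((m + 1) * (excess u k x * excess u k y powr (m - 1)))
    + indicator (- ball x0 (\<sigma> + \<delta>)) x * indicator (ball x0 \<sigma>) y * ((m + 1) * (excess u k y * excess u k x powr (m - 1))))"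

lemma excess_nonneg [simp]: "0 \<le> excess u k x"
  by (simp add: excess_def)

lemma excess_measurable [measurable]:
  "u \<in> borel_measurable M \<Longrightarrow> excess u k \<in> borel_measurable M"
  unfolding excess_def[abs_def] by (intro borel_measurable_max borel_measurable_diff) auto

lemma cut_excess_measurable [measurable]:
  "u \<in> borel_measurable lebesgue \<Longrightarrow> cut_excess l x0 \<sigma> \<delta> u k \<in> borel_measurable lebesgue"
  unfolding cut_excess_def[abs_def] by measurable

lemma comparison_error_nonneg: "0 \<le> m \<Longrightarrow> 0 \<le> comparison_error m l x0 \<sigma> \<delta> u k z"
  unfolding comparison_error_def by (auto split: prod.split)

lemma indicator_ball_measurable [measurable]:
  "(indicator (ball x r) :: 'a \<Rightarrow> real) \<in> borel_measurable (lebesgue :: 'a::euclidean_space measure)"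
  "(indicator (- ball x r) :: 'a \<Rightarrow> real) \<in> borel_measurable (lebesgue :: 'a::euclidean_space measure)"
  by (auto intro!: borel_measurable_indicator)

lemma comparison_error_measurable [measurable]:
  assumes [measurable]: "u \<in> borel_measurable lebesgue"
  shows "comparison_error m l x0 \<sigma> \<delta> u k \<in> borel_measurable lebesgue"
  unfolding comparison_error_def case_prod_unfold by measurable

lemma comparison_pointwise:
  fixes x0 :: "'a::euclidean_space" and u :: "'a \<Rightarrow> real" and k l m \<sigma> \<delta> :: real
  assumes m: "1 < m" "m \<le> l" and \<delta>: "0 < \<delta>"
  defines "f \<equiv> cut_excess l x0 \<sigma> \<delta> u k"
  shows "\<bar>(u x - f x) - (u y - f y)\<bar> powr m + 2 powr (-m) * \<bar>f x - f y\<bar> powr m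
    \<le> \<bar>u x - u y\<bar> powr m + comparison_error m l x0 \<sigma> \<delta> u k (x, y)"
proof -
  define \<phi> where "\<phi> = plateau x0 \<sigma> \<delta>"
  have \<phi>: "0 \<le> \<phi> z" "\<phi> z \<le> 1" for z by (simp_all add: \<phi>_def plateau_bounds)
  have \<alpha>: "0 \<le> \<phi> z powr l" "\<phi> z powr l \<le> 1" for z using \<phi>[of z] m by (auto intro: powr_le1)
  have f: "f z = \<phi> z powr l * max (u z - k) 0" for z
    by (simp add: f_def cut_excess_def excess_def \<phi>_def)
  have out: "f z = 0" if "z \<notin> ball x0 \<sigma>" for z
    using plateau_eq_0[OF \<delta> that] m by (simp add: f_def cut_excess_def)
  have vu: "(u x - f x) - (u y - f y) = (u x - k - f x) - (u y - k - f y)"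
    "u x - u y = (u x - k) - (u y - k)" by auto
  let ?B = "ball x0 (\<sigma> + \<delta>)" and ?S = "ball x0 \<sigma>"
  have SB: "?S \<subseteq> ?B" using \<delta> by (intro subset_ball) auto
  consider "x \<in> ?B" "y \<in> ?B" | "x \<in> ?S" "y \<notin> ?B" | "x \<notin> ?B" "y \<in> ?S"
    | "x \<notin> ?S" "y \<notin> ?S" using SB by blast
  then show ?thesis
  proof cases
    case 1
    then have "comparison_error m l x0 \<sigma> \<delta> u k (x, y)
        = 2 * l powr m * \<bar>\<phi> x - \<phi> y\<bar> powr m * (max (u x - k) 0 powr m + max (u y - k) 0 powr m)"
      by (simp add: comparison_error_def excess_def \<phi>_def)
    then show ?thesis
      using truncation_near[of m l "\<phi> x" "\<phi> y" "u x - k" "u y - k"] m \<phi>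
      unfolding f[symmetric] vu[symmetric] by simp
  next
    case 2
    then have "x \<in> ?B" "y \<notin> ?S" using SB by blast+
    then have "f y = 0" by (intro out)
    then have "comparison_error m l x0 \<sigma> \<delta> u k (x, y)
        = (m + 1) * (max (u x - k) 0 * max (u y - k) 0 powr (m - 1))"
      using 2 \<open>x \<in> ?B\<close> \<open>y \<notin> ?S\<close> by (simp add: comparison_error_def excess_def)
    moreover have e: "(u x - k - f x) - (u y - k) = (u x - f x) - (u y - f y)" using \<open>f y = 0\<close> by simp
    ultimately show ?thesis
      using truncation_far[of m "\<phi> x powr l" "u x - k" "u y - k"] m \<alpha>[of x] \<open>f y = 0\<close>
      unfolding f[symmetric] vu(2)[symmetric] e by simp
  next
    case 3
    then have "y \<in> ?B" "x \<notin> ?S" using SB by blast+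
    then have "f x = 0" by (intro out)
    then have "comparison_error m l x0 \<sigma> \<delta> u k (x, y)
        = (m + 1) * (max (u y - k) 0 * max (u x - k) 0 powr (m - 1))"
      using 3 \<open>y \<in> ?B\<close> \<open>x \<notin> ?S\<close> by (simp add: comparison_error_def excess_def)
    moreover have e: "(u y - k - f y) - (u x - k) = (u y - f y) - (u x - f x)" "(u y - k) - (u x - k) = u y - u x"
      using \<open>f x = 0\<close> by simp_all
    ultimately have "\<bar>(u y - f y) - (u x - f x)\<bar> powr m + 2 powr (-m) * \<bar>f y - f x\<bar> powr m
      \<le> \<bar>u y - u x\<bar> powr m + comparison_error m l x0 \<sigma> \<delta> u k (x, y)"
      using truncation_far[of m "\<phi> y powr l" "u y - k" "u x - k"] m \<alpha>[of y] \<open>f x = 0\<close>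
      unfolding f[symmetric] e by simp
    then show ?thesis by (simp only: abs_minus_commute)
  next
    case 4
    then have "f x = 0" "f y = 0" by (blast intro: out)+
    then show ?thesis using comparison_error_nonneg[of m] m by simp
  qed
qed

text \<open>
  Both summands have the same integral because the kernel is symmetric; each is estimated by integrating
  first over the variable that does not occur in \<open>w\<close>.
\<close>

lemma near_part_integral:
  fixes w :: "'a::euclidean_space \<Rightarrow> real" and e R I :: real
  assumes [measurable]: "w \<in> borel_measurable lebesgue" and w0: "\<And>x. 0 \<le> w x" and I0: "0 \<le> I"
    and I: "\<And>x :: 'a. (\<integral>\<^sup>+ y. ennreal (indicator (ball x R) y * norm (x - y) powr (e - DIM('a))) \<partial>lebesgue) \<le> ennreal I"
  shows "(\<integral>\<^sup>+ z. ennreal ((w (fst z) + w (snd z)) * (indicator (ball (fst z) R) (snd z) * norm (fst z - snd z) powr (e - DIM('a)))) \<partial>lebesgue)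
    \<le> ennreal (2 * I) * (\<integral>\<^sup>+ x. ennreal (w x) \<partial>lebesgue)"
proof -
  define J where "J z = (if dist (fst z) (snd z) < R then norm (fst z - snd z) powr (e - DIM('a)) else 0)" for z :: "'a \<times> 'a"
  have [measurable]: "J \<in> borel_measurable lebesgue" unfolding J_def by measurable
  have J: "J z = indicator (ball (fst z) R) (snd z) * norm (fst z - snd z) powr (e - DIM('a))"
    "J (x, y) = J (y, x)" for z x y
    by (auto simp: J_def indicator_def dist_commute norm_minus_commute)
  have J0: "J z \<ge> 0" for z by (simp add: J_def)
  have half: "(\<integral>\<^sup>+ x. \<integral>\<^sup>+ y. ennreal (w x * J (x, y)) \<partial>lebesgue \<partial>lebesgue) \<le> ennreal I * (\<integral>\<^sup>+ x. ennreal (w x) \<partial>lebesgue)"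
  proof -
    have "(\<integral>\<^sup>+ x. \<integral>\<^sup>+ y. ennreal (w x * J (x, y)) \<partial>lebesgue \<partial>lebesgue)
       \<le> (\<integral>\<^sup>+ x. ennreal I * ennreal (w x) \<partial>lebesgue)"
    proof (rule nn_integral_mono)
      fix x
      have "(\<integral>\<^sup>+ y. ennreal (w x * J (x, y)) \<partial>lebesgue) \<le> ennreal (w x) * (\<integral>\<^sup>+ y. ennreal (J (x, y)) \<partial>lebesgue)"
        using nn_integral_cmult_le[OF w0[of x]] w0 J0 by (simp add: ennreal_mult)
      also have "\<dots> \<le> ennreal (w x) * ennreal I"
        using I[of x] by (intro mult_left_mono) (simp_all add: J(1))
      finally show "(\<integral>\<^sup>+ y. ennreal (w x * J (x, y)) \<partial>lebesgue) \<le> ennreal I * ennreal (w x)"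
        by (simp add: mult.commute)
    qed
    also have "\<dots> = ennreal I * (\<integral>\<^sup>+ x. ennreal (w x) \<partial>lebesgue)"
      by (intro nn_integral_cmult) auto
    finally show ?thesis .
  qed
  have "(\<integral>\<^sup>+ z. ennreal ((w (fst z) + w (snd z)) * J z) \<partial>lebesgue)
    = (\<integral>\<^sup>+ z. ennreal (w (fst z) * J z) + ennreal (w (snd z) * J z) \<partial>lebesgue)"
    using w0 J0 by (intro nn_integral_cong) (simp add: distrib_right)
  also have "\<dots> = (\<integral>\<^sup>+ z. ennreal (w (fst z) * J z) \<partial>lebesgue) + (\<integral>\<^sup>+ z. ennreal (w (snd z) * J z) \<partial>lebesgue)"
    by (intro nn_integral_add) measurable
  also have "(\<integral>\<^sup>+ z. ennreal (w (fst z) * J z) \<partial>lebesgue) = (\<integral>\<^sup>+ x. \<integral>\<^sup>+ y. ennreal (w x * J (x, y)) \<partial>lebesgue \<partial>lebesgue)"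
    by (subst nn_integral_lebesgue_fst) auto
  also have "(\<integral>\<^sup>+ z. ennreal (w (snd z) * J z) \<partial>lebesgue) = (\<integral>\<^sup>+ x. \<integral>\<^sup>+ y. ennreal (w x * J (x, y)) \<partial>lebesgue \<partial>lebesgue)"
    by (subst nn_integral_lebesgue_snd) (auto simp: J(2))
  also have "\<dots> + \<dots> \<le> ennreal I * (\<integral>\<^sup>+ x. ennreal (w x) \<partial>lebesgue) + ennreal I * (\<integral>\<^sup>+ x. ennreal (w x) \<partial>lebesgue)"
    by (intro add_mono half)
  also have "\<dots> = ennreal (2 * I) * (\<integral>\<^sup>+ x. ennreal (w x) \<partial>lebesgue)"
    using I0 by (simp add: distrib_right[symmetric] ennreal_plus[symmetric] del: ennreal_plus)
  finally show ?thesis unfolding J(1) .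
qed

text \<open>
  Again the two summands agree by symmetry of \<open>b\<close>, and each is a tail integral of \<open>h\<close> integrated
  against \<open>w\<close>.
\<close>

lemma far_part_integral:
  fixes w h :: "'a::euclidean_space \<Rightarrow> real" and b :: "'a \<times> 'a \<Rightarrow> real" and T :: real
  assumes [measurable]: "w \<in> borel_measurable lebesgue" and w0: "\<And>x. 0 \<le> w x" and T0: "0 \<le> T"
    and [measurable]: "b \<in> borel_measurable lebesgue" "h \<in> borel_measurable lebesgue"
    and b: "\<And>x y. 0 \<le> b (x, y)" "\<And>x y. b (x, y) = b (y, x)" and h: "\<And>x. 0 \<le> h x"
    and T: "\<And>x. w x \<noteq> 0 \<Longrightarrow> (\<integral>\<^sup>+ y. ennreal (b (x, y) * h y) \<partial>lebesgue) \<le> ennreal T"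
  shows "(\<integral>\<^sup>+ z. ennreal (b z * (w (fst z) * h (snd z) + w (snd z) * h (fst z))) \<partial>lebesgue)
    \<le> ennreal (2 * T) * (\<integral>\<^sup>+ x. ennreal (w x) \<partial>lebesgue)"
proof -
  have half: "(\<integral>\<^sup>+ x. \<integral>\<^sup>+ y. ennreal (b (x, y) * (w x * h y)) \<partial>lebesgue \<partial>lebesgue) \<le> ennreal T * (\<integral>\<^sup>+ x. ennreal (w x) \<partial>lebesgue)"
  proof -
    have "(\<integral>\<^sup>+ x. \<integral>\<^sup>+ y. ennreal (b (x, y) * (w x * h y)) \<partial>lebesgue \<partial>lebesgue)
       \<le> (\<integral>\<^sup>+ x. ennreal T * ennreal (w x) \<partial>lebesgue)"
    proof (rule nn_integral_mono)
      fix x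
      have "(\<integral>\<^sup>+ y. ennreal (b (x, y) * (w x * h y)) \<partial>lebesgue) = (\<integral>\<^sup>+ y. ennreal (w x) * ennreal (b (x, y) * h y) \<partial>lebesgue)"
        using w0 b h by (simp add: ennreal_mult[symmetric] mult_ac)
      also have "\<dots> \<le> ennreal (w x) * (\<integral>\<^sup>+ y. ennreal (b (x, y) * h y) \<partial>lebesgue)"
        by (rule nn_integral_cmult_le[OF w0])
      also have "\<dots> \<le> ennreal (w x) * ennreal T"
        using T[of x] by (cases "w x = 0") (auto intro: mult_left_mono)
      finally show "(\<integral>\<^sup>+ y. ennreal (b (x, y) * (w x * h y)) \<partial>lebesgue) \<le> ennreal T * ennreal (w x)"
        by (simp add: mult.commute)
    qed
    also have "\<dots> = ennreal T * (\<integral>\<^sup>+ x. ennreal (w x) \<partial>lebesgue)"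
      by (intro nn_integral_cmult) auto
    finally show ?thesis .
  qed
  have "(\<integral>\<^sup>+ z. ennreal (b z * (w (fst z) * h (snd z) + w (snd z) * h (fst z))) \<partial>lebesgue)
    = (\<integral>\<^sup>+ z. ennreal (b z * (w (fst z) * h (snd z))) + ennreal (b z * (w (snd z) * h (fst z))) \<partial>lebesgue)"
    using w0 b(1) h by (intro nn_integral_cong) (auto simp: distrib_left)
  also have "\<dots> = (\<integral>\<^sup>+ z. ennreal (b z * (w (fst z) * h (snd z))) \<partial>lebesgue) + (\<integral>\<^sup>+ z. ennreal (b z * (w (snd z) * h (fst z))) \<partial>lebesgue)"
    by (intro nn_integral_add) measurable
  also have "(\<integral>\<^sup>+ z. ennreal (b z * (w (fst z) * h (snd z))) \<partial>lebesgue) = (\<integral>\<^sup>+ x. \<integral>\<^sup>+ y. ennreal (b (x, y) * (w x * h y)) \<partial>lebesgue \<partial>lebesgue)"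
    by (subst nn_integral_lebesgue_fst) auto
  also have "(\<integral>\<^sup>+ z. ennreal (b z * (w (snd z) * h (fst z))) \<partial>lebesgue) = (\<integral>\<^sup>+ x. \<integral>\<^sup>+ y. ennreal (b (x, y) * (w x * h y)) \<partial>lebesgue \<partial>lebesgue)"
    by (subst nn_integral_lebesgue_snd) (measurable, simp add: b(2))
  also have "\<dots> + \<dots> \<le> ennreal T * (\<integral>\<^sup>+ x. ennreal (w x) \<partial>lebesgue) + ennreal T * (\<integral>\<^sup>+ x. ennreal (w x) \<partial>lebesgue)"
    by (intro add_mono half)
  also have "\<dots> = ennreal (2 * T) * (\<integral>\<^sup>+ x. ennreal (w x) \<partial>lebesgue)"
    using T0 by (simp add: distrib_right[symmetric] ennreal_plus[symmetric] del: ennreal_plus)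
  finally show ?thesis .
qed

text \<open>
  One growth exponent \<open>m\<close>, one differentiability order \<open>\<tau>\<close> and one coefficient \<open>b\<close> at a time; both
  phases are instances.  The constant \<open>C\<close> must not depend on the level \<open>k\<close> and the dependence on the gap
  \<open>\<delta>\<close> must be a fixed power, since both vary along the iteration.
\<close>

lemma comparison_error_integral:
  fixes x0 :: "'a::euclidean_space" and u :: "'a \<Rightarrow> real" and b :: "'a \<times> 'a \<Rightarrow> real"
    and m l \<tau> R M T :: real
  defines "n \<equiv> real DIM('a)" and "A \<equiv> 2 * R + 1 + norm x0"
  assumes m: "1 < m" "m \<le> l" and \<tau>: "0 < \<tau>" "\<tau> < 1" and R: "0 < R"
    and u[measurable]: "u \<in> borel_measurable lebesgue" and bm[measurable]: "b \<in> borel_measurable lebesgue"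
    and b: "\<And>x y. 0 \<le> b (x, y)" "\<And>x y. b (x, y) = b (y, x)"
    and M: "0 \<le> M" "AE z in lebesgue. z \<in> ball x0 R \<times> ball x0 R \<longrightarrow> b z \<le> M"
    and T: "0 \<le> T" "\<And>x. x \<in> ball x0 R \<Longrightarrow>
      (\<integral>\<^sup>+ y. ennreal (b (x, y) * (\<bar>u y\<bar> powr (m - 1) / (1 + norm y) powr (n + \<tau> * m))) \<partial>lebesgue) \<le> ennreal T"
  obtains C where "0 \<le> C"
    "\<And>k \<sigma> \<delta>. 0 \<le> k \<Longrightarrow> 0 < \<sigma> \<Longrightarrow> 0 < \<delta> \<Longrightarrow> \<sigma> + \<delta> \<le> R \<Longrightarrow>
      (\<integral>\<^sup>+ z. ennreal (b z * (comparison_error m l x0 \<sigma> \<delta> u k z / norm (fst z - snd z) powr (n + \<tau> * m))) \<partial>lebesgue)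
      \<le> ennreal (C * (A / \<delta>) powr (n + 2 * m))
        * (\<integral>\<^sup>+ x. ennreal (indicator (ball x0 (\<sigma> + \<delta>)) x * (excess u k x powr m + excess u k x)) \<partial>lebesgue)"
proof -
  define e where "e = m * (1 - \<tau>)"
  have e: "e > 0" using m \<tau> by (simp add: e_def)
  have n: "n > 0" by (simp add: n_def)
  show thesis
  proof (rule nn_integral_singular_kernel[OF e, of "2 * R"])
    show "0 < 2 * R" using R by simp
    fix I assume I0: "0 \<le> I"
      and I: "\<And>x :: 'a. (\<integral>\<^sup>+ y. ennreal (indicator (ball x (2 * R)) y * norm (x - y) powr (e - DIM('a))) \<partial>lebesgue) \<le> ennreal I"
    define C where "C = 4 * l powr m * M * I + 2 * (m + 1) * T"
    show thesis
    proof (rule that[of C])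
      show "0 \<le> C" using M T I0 m by (simp add: C_def)
      fix k \<sigma> \<delta> :: real
      assume k: "0 \<le> k" and \<sigma>: "0 < \<sigma>" and \<delta>: "0 < \<delta>" and \<sigma>R: "\<sigma> + \<delta> \<le> R"
      \<comment> \<open>\<open>D\<close> is a bound for \<open>(1 + norm y) / norm (x - y)\<close> on far pairs, which transfers the tail weight
        centred at the origin to the kernel.\<close>
      define D where "D = A / \<delta>"
      have A1: "A \<ge> 1" using R by (simp add: A_def)
      have "\<delta> \<le> A" using \<sigma>R \<sigma> R norm_ge_zero[of x0] unfolding A_def by linarith
      then have D1: "D \<ge> 1" using \<delta> by (simp add: D_def)
      let ?B = "ball x0 (\<sigma> + \<delta>)" and ?S = "ball x0 \<sigma>"
      define w where "w = excess u k"
      have [measurable]: "w \<in> borel_measurable lebesgue" by (simp add: w_def)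
      have w0[simp]: "0 \<le> w x" for x by (simp add: w_def)
      define W1 where "W1 x = indicator ?B x * w x powr m" for x
      define W2 where "W2 x = indicator ?S x * w x" for x
      define h where "h y = \<bar>u y\<bar> powr (m - 1) / (1 + norm y) powr (n + \<tau> * m)" for y
      have [measurable]: "norm \<in> borel_measurable (lebesgue :: 'a measure)"
        by (rule measurable_completion) simp
      have meas[measurable]: "W1 \<in> borel_measurable lebesgue" "W2 \<in> borel_measurable lebesgue"
        "h \<in> borel_measurable lebesgue"
        unfolding W1_def[abs_def] W2_def[abs_def] h_def[abs_def] by measurable
      have W0: "0 \<le> W1 x" "0 \<le> W2 x" "0 \<le> h x" for x
        by (simp_all add: W1_def W2_def h_def)
      define J where "J z = indicator (ball (fst z) (2 * R)) (snd z) * norm (fst z - snd z) powr (e - DIM('a))" for z :: "'a \<times> 'a"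
      have J0: "J z \<ge> 0" for z by (simp add: J_def)
      define c1 where "c1 = 2 * l powr m * M * (1 / \<delta>) powr m"
      define c2 where "c2 = (m + 1) * D powr (n + \<tau> * m)"
      have c0: "c1 \<ge> 0" "c2 \<ge> 0" using M m by (simp_all add: c1_def c2_def)
      have far: "w x * w y powr (m - 1) / norm (x - y) powr (n + \<tau> * m) \<le> D powr (n + \<tau> * m) * (w x * h y)"
        if xy: "x \<in> ?S" "y \<notin> ?B" for x y
      proof -
        have d: "\<delta> \<le> norm (x - y)"
          using xy dist_triangle[of x0 y x] by (simp add: dist_norm)
        have "1 + norm y \<le> 1 + norm x0 + norm (x - x0) + norm (x - y)"
          using norm_triangle_ineq4[of x "x - y"] norm_triangle_ineq[of x0 "x - x0"] by simp
        also have "norm (x - x0) \<le> R" using xy \<sigma>R \<delta> by (simp add: dist_norm norm_minus_commute)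
        finally have "1 + norm y \<le> (1 + norm x0 + R) * 1 + norm (x - y)" by simp
        also have "\<dots> \<le> (1 + norm x0 + R) * (norm (x - y) / \<delta>) + R * (norm (x - y) / \<delta>)"
        proof (intro add_mono mult_left_mono)
          show "1 \<le> norm (x - y) / \<delta>" using d \<delta> by simp
          have "norm (x - y) = \<delta> * (norm (x - y) / \<delta>)" using \<delta> by simp
          also have "\<dots> \<le> R * (norm (x - y) / \<delta>)" using \<sigma>R \<sigma> \<delta> by (intro mult_right_mono) auto
          finally show "norm (x - y) \<le> R * (norm (x - y) / \<delta>)" .
        qed (use R in simp)
        also have "\<dots> = D * norm (x - y)" using \<delta> by (simp add: D_def A_def field_simps)
        finally have "(1 + norm y) powr (n + \<tau> * m) \<le> (D * norm (x - y)) powr (n + \<tau> * m)"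
          using n \<tau> m by (intro powr_mono2) auto
        then have le: "(1 + norm y) powr (n + \<tau> * m) \<le> D powr (n + \<tau> * m) * norm (x - y) powr (n + \<tau> * m)"
          using D1 by (simp add: powr_mult)
        have pos: "(1 + norm y) powr (n + \<tau> * m) > 0" "norm (x - y) powr (n + \<tau> * m) > 0"
          using d \<delta> norm_ge_zero[of y] by (auto simp: add_pos_nonneg powr_gt_zero simp del: norm_ge_zero)
        have "w y \<le> \<bar>u y\<bar>" using k by (auto simp: w_def excess_def)
        then have wy: "w y powr (m - 1) \<le> \<bar>u y\<bar> powr (m - 1)" using m by (intro powr_mono2) auto
        have "w x * w y powr (m - 1) / norm (x - y) powr (n + \<tau> * m)
           \<le> w x * \<bar>u y\<bar> powr (m - 1) / norm (x - y) powr (n + \<tau> * m)"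
          using wy by (intro divide_right_mono mult_left_mono) auto
        also have "\<dots> = (w x * \<bar>u y\<bar> powr (m - 1)) * (1 / norm (x - y) powr (n + \<tau> * m))" by simp
        also have "\<dots> \<le> (w x * \<bar>u y\<bar> powr (m - 1)) * (D powr (n + \<tau> * m) / (1 + norm y) powr (n + \<tau> * m))"
          using le pos by (intro mult_left_mono) (auto simp: field_simps)
        finally show ?thesis by (simp add: h_def mult_ac)
      qed
      have ptw: "b z * (comparison_error m l x0 \<sigma> \<delta> u k z / norm (fst z - snd z) powr (n + \<tau> * m))
          \<le> c1 * ((W1 (fst z) + W1 (snd z)) * J z) + c2 * (b z * (W2 (fst z) * h (snd z) + W2 (snd z) * h (fst z)))"
        if bz: "z \<in> ball x0 R \<times> ball x0 R \<longrightarrow> b z \<le> M" for z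
      proof -
        obtain x y where z: "z = (x, y)" by fastforce
        have b0: "b z \<ge> 0" using b by (simp add: z)
        have r0: "0 \<le> c1 * ((W1 (fst z) + W1 (snd z)) * J z)"
            "0 \<le> c2 * (b z * (W2 (fst z) * h (snd z) + W2 (snd z) * h (fst z)))"
          using c0 W0 b0 J0[of z] by simp_all
        have SB: "?S \<subseteq> ?B" using \<delta> by (intro subset_ball) auto
        have BR: "?B \<subseteq> ball x0 R" using \<sigma>R by (intro subset_ball) auto
        consider "x = y" | "x \<noteq> y" "x \<in> ?B" "y \<in> ?B" | "x \<in> ?S" "y \<notin> ?B" | "x \<notin> ?B" "y \<in> ?S"
          | "\<not> (x \<in> ?B \<and> y \<in> ?B)" "\<not> (x \<in> ?S \<and> y \<notin> ?B)" "\<not> (x \<notin> ?B \<and> y \<in> ?S)" by blast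
        then show ?thesis
        proof cases
          case 1
          then show ?thesis using r0 by (simp add: z)
        next
          case 2
          have "dist x y < 2 * R" using 2 BR dist_triangle3[of x y x0] by (auto simp: subset_iff) (smt (verit) 2 BR mem_ball subsetD)
          then have J: "J z = norm (x - y) powr (e - n)" by (simp add: J_def z n_def)
          have nz: "norm (x - y) > 0" using 2 by simp
          have bM: "b z \<le> M" using bz 2 BR z by auto
          have err: "comparison_error m l x0 \<sigma> \<delta> u k z
            = 2 * l powr m * \<bar>plateau x0 \<sigma> \<delta> x - plateau x0 \<sigma> \<delta> y\<bar> powr m * (w x powr m + w y powr m)"
            using 2 by (simp add: z comparison_error_def w_def)
          also have "\<dots> \<le> 2 * l powr m * (norm (x - y) / \<delta>) powr m * (w x powr m + w y powr m)"
            using plateau_lipschitz[OF \<delta>, of x0 \<sigma> x y] m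
            by (intro mult_right_mono mult_left_mono powr_mono2) auto
          finally have "comparison_error m l x0 \<sigma> \<delta> u k z / norm (x - y) powr (n + \<tau> * m)
            \<le> 2 * l powr m * (norm (x - y) / \<delta>) powr m * (w x powr m + w y powr m) / norm (x - y) powr (n + \<tau> * m)"
            by (intro divide_right_mono) auto
          also have "\<dots> = 2 * l powr m * (1 / \<delta>) powr m * ((w x powr m + w y powr m)
              * (norm (x - y) powr m / norm (x - y) powr (n + \<tau> * m)))"
            using \<delta> by (simp add: powr_divide)
          also have "norm (x - y) powr m / norm (x - y) powr (n + \<tau> * m) = norm (x - y) powr (e - n)"
            by (simp add: powr_diff[symmetric] e_def algebra_simps)
          finally have le: "comparison_error m l x0 \<sigma> \<delta> u k z / norm (x - y) powr (n + \<tau> * m)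
             \<le> 2 * l powr m * (1 / \<delta>) powr m * ((w x powr m + w y powr m) * norm (x - y) powr (e - n))" .
          have "b z * (comparison_error m l x0 \<sigma> \<delta> u k z / norm (x - y) powr (n + \<tau> * m))
             \<le> M * (2 * l powr m * (1 / \<delta>) powr m * ((w x powr m + w y powr m) * norm (x - y) powr (e - n)))"
            using comparison_error_nonneg[of m l x0 \<sigma> \<delta> u k z] m M(1) by (intro mult_mono bM le) auto
          also have "\<dots> = c1 * ((W1 (fst z) + W1 (snd z)) * J z)"
            using 2 J unfolding z by (simp add: c1_def W1_def)
          finally show ?thesis using r0(2) by (simp add: z)
        next
          case 3
          then have "x \<in> ?B" "y \<notin> ?S" using SB by blast+
          then have err: "comparison_error m l x0 \<sigma> \<delta> u k z = (m + 1) * (w x * w y powr (m - 1))"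
            using 3 by (simp add: z comparison_error_def w_def)
          have "b z * (comparison_error m l x0 \<sigma> \<delta> u k z / norm (x - y) powr (n + \<tau> * m))
            = b z * ((m + 1) * (w x * w y powr (m - 1) / norm (x - y) powr (n + \<tau> * m)))"
            unfolding err by simp
          also have "\<dots> \<le> b z * ((m + 1) * (D powr (n + \<tau> * m) * (w x * h y)))"
            using far[OF 3] b0 m by (intro mult_left_mono) auto
          also have "\<dots> = c2 * (b z * (W2 (fst z) * h (snd z) + W2 (snd z) * h (fst z)))"
            using 3 \<open>y \<notin> ?S\<close> by (simp add: z c2_def W2_def)
          finally show ?thesis using r0(1) by (simp add: z)
        next
          case 4
          then have "y \<in> ?B" "x \<notin> ?S" using SB by blast+
          then have err: "comparison_error m l x0 \<sigma> \<delta> u k z = (m + 1) * (w y * w x powr (m - 1))"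
            using 4 by (simp add: z comparison_error_def w_def)
          have "b z * (comparison_error m l x0 \<sigma> \<delta> u k z / norm (x - y) powr (n + \<tau> * m))
            = b z * ((m + 1) * (w y * w x powr (m - 1) / norm (y - x) powr (n + \<tau> * m)))"
            unfolding err by (simp add: norm_minus_commute)
          also have "\<dots> \<le> b z * ((m + 1) * (D powr (n + \<tau> * m) * (w y * h x)))"
            using far[OF 4(2,1)] b0 m by (intro mult_left_mono) auto
          also have "\<dots> = c2 * (b z * (W2 (fst z) * h (snd z) + W2 (snd z) * h (fst z)))"
            using 4 \<open>x \<notin> ?S\<close> by (simp add: z c2_def W2_def)
          finally show ?thesis using r0(1) by (simp add: z)
        next
          case 5
          then have "comparison_error m l x0 \<sigma> \<delta> u k z = 0"
            by (auto simp: z comparison_error_def indicator_def simp del: mem_ball)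
          then show ?thesis using r0 by simp
        qed
      qed
      have Jm[measurable]: "J \<in> borel_measurable lebesgue"
      proof -
        have "J = (\<lambda>z. if dist (fst z) (snd z) < 2 * R then norm (fst z - snd z) powr (e - DIM('a)) else 0)"
          by (auto simp: J_def fun_eq_iff)
        then show ?thesis by simp
      qed
      let ?I = "\<lambda>F. \<integral>\<^sup>+ z. ennreal (F z) \<partial>lebesgue"
      have "?I (\<lambda>z. b z * (comparison_error m l x0 \<sigma> \<delta> u k z / norm (fst z - snd z) powr (n + \<tau> * m)))
        \<le> (\<integral>\<^sup>+ z. ennreal c1 * ennreal ((W1 (fst z) + W1 (snd z)) * J z)
            + ennreal c2 * ennreal (b z * (W2 (fst z) * h (snd z) + W2 (snd z) * h (fst z))) \<partial>lebesgue)"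
      proof (rule nn_integral_mono_AE, rule AE_mp[OF M(2)], rule AE_I2, rule impI)
        fix z assume "z \<in> ball x0 R \<times> ball x0 R \<longrightarrow> b z \<le> M"
        from ennreal_leI[OF ptw[OF this]]
        show "ennreal (b z * (comparison_error m l x0 \<sigma> \<delta> u k z / norm (fst z - snd z) powr (n + \<tau> * m)))
          \<le> ennreal c1 * ennreal ((W1 (fst z) + W1 (snd z)) * J z)
            + ennreal c2 * ennreal (b z * (W2 (fst z) * h (snd z) + W2 (snd z) * h (fst z)))"
          using c0 W0 J0[of z] b(1)[of "fst z" "snd z"] by (simp add: ennreal_mult[symmetric] ennreal_plus[symmetric] del: ennreal_plus)
      qed
      also have "\<dots> = ennreal c1 * ?I (\<lambda>z. (W1 (fst z) + W1 (snd z)) * J z)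
          + ennreal c2 * ?I (\<lambda>z. b z * (W2 (fst z) * h (snd z) + W2 (snd z) * h (fst z)))"
        by (simp add: nn_integral_add nn_integral_cmult)
      also have "\<dots> \<le> ennreal c1 * (ennreal (2 * I) * (\<integral>\<^sup>+ x. ennreal (W1 x) \<partial>lebesgue))
          + ennreal c2 * (ennreal (2 * T) * (\<integral>\<^sup>+ x. ennreal (W2 x) \<partial>lebesgue))"
      proof (intro add_mono mult_left_mono)
        show "?I (\<lambda>z. (W1 (fst z) + W1 (snd z)) * J z) \<le> ennreal (2 * I) * (\<integral>\<^sup>+ x. ennreal (W1 x) \<partial>lebesgue)"
          unfolding J_def by (rule near_part_integral[OF meas(1) W0(1) I0 I])
        show "?I (\<lambda>z. b z * (W2 (fst z) * h (snd z) + W2 (snd z) * h (fst z))) \<le> ennreal (2 * T) * (\<integral>\<^sup>+ x. ennreal (W2 x) \<partial>lebesgue)"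
        proof (rule far_part_integral[OF meas(2) W0(2) T(1) bm meas(3) b W0(3)])
          fix x assume "W2 x \<noteq> 0"
          then have "x \<in> ball x0 R" using \<sigma>R \<delta> by (auto simp: W2_def indicator_def split: if_splits)
          then show "(\<integral>\<^sup>+ y. ennreal (b (x, y) * h y) \<partial>lebesgue) \<le> ennreal T"
            unfolding h_def by (rule T(2))
        qed
      qed auto
      also have "\<dots> = ennreal (2 * c1 * I) * (\<integral>\<^sup>+ x. ennreal (W1 x) \<partial>lebesgue) + ennreal (2 * c2 * T) * (\<integral>\<^sup>+ x. ennreal (W2 x) \<partial>lebesgue)"
        using c0 I0 T(1) by (simp add: mult.assoc[symmetric] ennreal_mult[symmetric]) (simp add: mult_ac)
      also have "\<dots> \<le> ennreal (C * D powr (n + 2 * m)) * (\<integral>\<^sup>+ x. ennreal (W1 x) \<partial>lebesgue)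
          + ennreal (C * D powr (n + 2 * m)) * (\<integral>\<^sup>+ x. ennreal (W2 x) \<partial>lebesgue)"
      proof (intro add_mono mult_right_mono ennreal_leI)
        have "(1 / \<delta>) powr m \<le> D powr m" using A1 \<delta> m by (intro powr_mono2) (auto simp: D_def divide_right_mono)
        also have "\<dots> \<le> D powr (n + 2 * m)" using D1 n m by (intro powr_mono) auto
        finally have "4 * l powr m * M * I * (1 / \<delta>) powr m \<le> 4 * l powr m * M * I * D powr (n + 2 * m)"
          using M I0 by (intro mult_left_mono) auto
        also have "\<dots> \<le> C * D powr (n + 2 * m)" using m T unfolding C_def by (intro mult_right_mono) auto
        also have "4 * l powr m * M * I * (1 / \<delta>) powr m = 2 * c1 * I" by (simp add: c1_def)
        finally show "2 * c1 * I \<le> C * D powr (n + 2 * m)" .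
        have "D powr (n + \<tau> * m) \<le> D powr (n + 2 * m)" using D1 n m \<tau> by (intro powr_mono) auto
        then have "2 * (m + 1) * T * D powr (n + \<tau> * m) \<le> 2 * (m + 1) * T * D powr (n + 2 * m)"
          using T m by (intro mult_left_mono) auto
        also have "\<dots> \<le> C * D powr (n + 2 * m)" using M I0 unfolding C_def by (intro mult_right_mono) auto
        also have "2 * (m + 1) * T * D powr (n + \<tau> * m) = 2 * c2 * T" by (simp add: c2_def)
        finally show "2 * c2 * T \<le> C * D powr (n + 2 * m)" .
      qed auto
      also have "\<dots> = ennreal (C * D powr (n + 2 * m)) * (\<integral>\<^sup>+ x. ennreal (W1 x) + ennreal (W2 x) \<partial>lebesgue)"
        by (simp add: distrib_left nn_integral_add)
      also have "\<dots> \<le> ennreal (C * D powr (n + 2 * m))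
          * (\<integral>\<^sup>+ x. ennreal (indicator ?B x * (excess u k x powr m + excess u k x)) \<partial>lebesgue)"
      proof (intro mult_left_mono nn_integral_mono)
        fix x
        have "W1 x + W2 x \<le> indicator ?B x * (w x powr m + w x)"
          using \<delta> by (auto simp: W1_def W2_def indicator_def)
        then show "ennreal (W1 x) + ennreal (W2 x) \<le> ennreal (indicator ?B x * (excess u k x powr m + excess u k x))"
          unfolding w_def[symmetric] using W0 by (simp add: ennreal_plus[symmetric] ennreal_leI del: ennreal_plus)
      qed auto
      finally show "?I (\<lambda>z. b z * (comparison_error m l x0 \<sigma> \<delta> u k z / norm (fst z - snd z) powr (n + \<tau> * m)))
        \<le> ennreal (C * (A / \<delta>) powr (n + 2 * m))
        * (\<integral>\<^sup>+ x. ennreal (indicator ?B x * (excess u k x powr m + excess u k x)) \<partial>lebesgue)"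
        unfolding D_def .
    qed
  qed
qed

section \<open>Energy estimate for minimizers\<close>

lemma fractional_kernelD:
  assumes "fractional_kernel \<Lambda> s p (K :: (real^'n) \<times> (real^'n) \<Rightarrow> real)"
  shows "K \<in> borel_measurable lebesgue" "0 \<le> K z"
    "x \<noteq> y \<Longrightarrow> inverse \<Lambda> / norm (x - y) powr (real CARD('n) + s * p) \<le> K (x, y)"
    "x \<noteq> y \<Longrightarrow> K (x, y) \<le> \<Lambda> / norm (x - y) powr (real CARD('n) + s * p)"
  using assms unfolding fractional_kernel_def by blast+

lemma coefficientD:
  assumes "coefficient a"
  shows "a \<in> borel_measurable lebesgue" "0 \<le> a z" "a (x, y) = a (y, x)"
  using assms unfolding coefficient_def by (auto simp: split_paired_all) (metis surj_pair)

text \<open>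
  Admissibility is finiteness of the functional with these kernels, together with integrability of the
  \<open>p\<close>-th power on \<open>\<Omega>\<close>; so the comparison lemma also yields the admissibility of competitors.
\<close>

lemma model_kernel: "fractional_kernel 1 s p
   (\<lambda>z :: (real^'n) \<times> (real^'n). 1 / norm (fst z - snd z) powr (real CARD('n) + s * p))"
  unfolding fractional_kernel_def by auto

lemma cross_domain_measurable [measurable]:
  assumes "open (\<Omega> :: (real^'n) set)"
  shows "cross_domain \<Omega> \<in> sets lebesgue"
proof -
  have "closed ((- \<Omega>) \<times> (- \<Omega>))" using assms by (intro closed_Times) (auto simp: closed_def)
  then have "cross_domain \<Omega> \<in> sets borel" unfolding cross_domain_def by (auto simp: borel_open open_Diff)
  then show ?thesis by simp
qed

text \<open>
  The cutoff power is \<open>q\<close> in both phases, because both must be compared with the same competitor.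
\<close>

definition total_error ::
  "real \<Rightarrow> real \<Rightarrow> real \<Rightarrow> real \<Rightarrow> ((real^'n) \<times> (real^'n) \<Rightarrow> real) \<Rightarrow> real^'n \<Rightarrow> (real^'n \<Rightarrow> real)
    \<Rightarrow> real \<Rightarrow> real \<Rightarrow> real \<Rightarrow> ennreal"
  where "total_error s t p q a x0 u k \<sigma> \<delta> = (\<integral>\<^sup>+ z. ennreal
      (comparison_error p q x0 \<sigma> \<delta> u k z / norm (fst z - snd z) powr (real CARD('n) + s * p)
       + a z * (comparison_error q q x0 \<sigma> \<delta> u k z / norm (fst z - snd z) powr (real CARD('n) + t * q))) \<partial>lebesgue)"

context
  fixes \<Omega> :: "(real^'n) set" and s t p q :: real and a :: "(real^'n) \<times> (real^'n) \<Rightarrow> real"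
    and x0 :: "real^'n" and u :: "real^'n \<Rightarrow> real"
  assumes \<Omega>: "open \<Omega>" and pq: "1 < p" "p \<le> q" and a: "coefficient a"
    and u: "u \<in> borel_measurable lebesgue"
begin

text \<open>
  The comparison inequality integrated.  Outside \<open>cross_domain \<Omega>\<close> the cut-off excess vanishes at both
  points, so its energy may be taken over the whole space.  The \<open>p\<close>-energy of \<open>f\<close> is kept for the
  Sobolev inequality.
\<close>

lemma double_phase_comparison:
  fixes k \<sigma> \<delta> \<Lambda> :: real
  assumes K: "fractional_kernel \<Lambda> s p Ksp" "fractional_kernel \<Lambda> t q Ktq" and \<Lambda>: "1 \<le> \<Lambda>"
    and \<delta>: "0 < \<delta>" and sub: "ball x0 \<sigma> \<subseteq> \<Omega>"
  defines "f \<equiv> cut_excess q x0 \<sigma> \<delta> u k"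
  shows "double_phase_functional Ksp Ktq a p q \<Omega> (\<lambda>x. u x - f x)
      + ennreal (2 powr (-p) / \<Lambda>) * gagliardo_energy s p f
    \<le> double_phase_functional Ksp Ktq a p q \<Omega> u + ennreal \<Lambda> * total_error s t p q a x0 u k \<sigma> \<delta>"
proof -
  note [measurable] = u coefficientD(1)[OF a] fractional_kernelD(1)[OF K(1)] fractional_kernelD(1)[OF K(2)]
    cross_domain_measurable[OF \<Omega>]
  have fm[measurable]: "f \<in> borel_measurable lebesgue" unfolding f_def by measurable
  define v where "v x = u x - f x" for x
  have [measurable]: "v \<in> borel_measurable lebesgue" unfolding v_def[abs_def] by measurable
  define G where "G w z = \<bar>w (fst z) - w (snd z)\<bar> powr p * Ksp z + a z * \<bar>w (fst z) - w (snd z)\<bar> powr q * Ktq z"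
    for w :: "real^'n \<Rightarrow> real" and z
  define L where "L z = \<bar>f (fst z) - f (snd z)\<bar> powr p / norm (fst z - snd z) powr (real CARD('n) + s * p)" for z
  define ep where "ep z = comparison_error p q x0 \<sigma> \<delta> u k z" for z
  define eq where "eq z = comparison_error q q x0 \<sigma> \<delta> u k z" for z
  define H where "H z = ep z / norm (fst z - snd z) powr (real CARD('n) + s * p)
       + a z * (eq z / norm (fst z - snd z) powr (real CARD('n) + t * q))" for z
  have e0: "ep z \<ge> 0" "eq z \<ge> 0" for z unfolding ep_def eq_def using pq by (auto intro: comparison_error_nonneg)
  have [measurable]: "ep \<in> borel_measurable lebesgue" "eq \<in> borel_measurable lebesgue"
    unfolding ep_def[abs_def] eq_def[abs_def] by measurable
  have Hm[measurable]: "H \<in> borel_measurable lebesgue" unfolding H_def[abs_def] by measurable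
  have Gm[measurable]: "G w \<in> borel_measurable lebesgue" if [measurable]: "w \<in> borel_measurable lebesgue" for w
    unfolding G_def[abs_def] by measurable
  have Lm[measurable]: "L \<in> borel_measurable lebesgue" unfolding L_def[abs_def] by measurable
  have G0: "G w z \<ge> 0" for w z
    using fractional_kernelD(2)[OF K(1), of z] fractional_kernelD(2)[OF K(2), of z] coefficientD(2)[OF a, of z]
    by (simp add: G_def)
  have L0: "L z \<ge> 0" for z by (simp add: L_def)
  have H0: "H z \<ge> 0" for z using e0[of z] coefficientD(2)[OF a, of z] by (simp add: H_def)
  have F: "double_phase_functional Ksp Ktq a p q \<Omega> w = (\<integral>\<^sup>+ z. ennreal (G w z) * indicator (cross_domain \<Omega>) z \<partial>lebesgue)" for w
    unfolding double_phase_functional_def G_def case_prod_unfold by simp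
  have fout: "f x = 0" if "x \<notin> \<Omega>" for x
  proof -
    have "x \<notin> ball x0 \<sigma>" using that sub by blast
    from plateau_eq_0[OF \<delta> this] show ?thesis using pq by (simp add: f_def cut_excess_def)
  qed
  have ptw: "G v z + 2 powr (-p) / \<Lambda> * L z \<le> G u z + \<Lambda> * H z" for z
  proof -
    obtain x y where z: "z = (x, y)" by fastforce
    show ?thesis
    proof (cases "x = y")
      case True
      then show ?thesis using H0[of z] \<Lambda> by (simp add: G_def L_def z)
    next
      case False
      let ?np = "norm (x - y) powr (real CARD('n) + s * p)" and ?nq = "norm (x - y) powr (real CARD('n) + t * q)"
      have a0: "a z \<ge> 0" using coefficientD(2)[OF a] .
      have K0: "Ksp z \<ge> 0" "Ktq z \<ge> 0"
        using fractional_kernelD(2)[OF K(1)] fractional_kernelD(2)[OF K(2)] by auto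
      have cp: "\<bar>v x - v y\<bar> powr p + 2 powr (-p) * \<bar>f x - f y\<bar> powr p \<le> \<bar>u x - u y\<bar> powr p + ep z"
        unfolding v_def f_def ep_def z by (rule comparison_pointwise) (use pq \<delta> in auto)
      have "\<bar>v x - v y\<bar> powr q + 2 powr (-q) * \<bar>f x - f y\<bar> powr q \<le> \<bar>u x - u y\<bar> powr q + eq z"
        unfolding v_def f_def eq_def z by (rule comparison_pointwise) (use pq \<delta> in auto)
      then have cq: "\<bar>v x - v y\<bar> powr q \<le> \<bar>u x - u y\<bar> powr q + eq z"
        using powr_ge_zero[of "\<bar>f x - f y\<bar>" q] powr_ge_zero[of 2 "-q"] by (smt (verit) mult_nonneg_nonneg)
      have "2 powr (-p) / \<Lambda> * L z = 2 powr (-p) * \<bar>f x - f y\<bar> powr p * (inverse \<Lambda> / ?np)"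
        by (simp add: L_def z field_simps)
      also have "\<dots> \<le> 2 powr (-p) * \<bar>f x - f y\<bar> powr p * Ksp z"
        using fractional_kernelD(3)[OF K(1) False] by (intro mult_left_mono) (auto simp: z)
      finally have l: "2 powr (-p) / \<Lambda> * L z \<le> 2 powr (-p) * \<bar>f x - f y\<bar> powr p * Ksp z" .
      have kp: "ep z * Ksp z \<le> ep z * (\<Lambda> / ?np)" and kq: "a z * eq z * Ktq z \<le> a z * eq z * (\<Lambda> / ?nq)"
        using fractional_kernelD(4)[OF K(1) False] fractional_kernelD(4)[OF K(2) False] e0 a0
        unfolding z by (auto intro!: mult_left_mono mult_nonneg_nonneg simp del: times_divide_eq_right)
      have "(\<bar>v x - v y\<bar> powr p + 2 powr (-p) * \<bar>f x - f y\<bar> powr p) * Ksp z \<le> (\<bar>u x - u y\<bar> powr p + ep z) * Ksp z"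
        by (rule mult_right_mono[OF cp K0(1)])
      moreover have "a z * \<bar>v x - v y\<bar> powr q * Ktq z \<le> a z * (\<bar>u x - u y\<bar> powr q + eq z) * Ktq z"
        by (intro mult_right_mono mult_left_mono cq K0 a0)
      ultimately have "G v z + 2 powr (-p) / \<Lambda> * L z \<le> G u z + (ep z * (\<Lambda> / ?np) + a z * eq z * (\<Lambda> / ?nq))"
        using l kp kq by (simp add: G_def z algebra_simps)
      also have "ep z * (\<Lambda> / ?np) + a z * eq z * (\<Lambda> / ?nq) = \<Lambda> * H z"
        by (simp add: H_def z algebra_simps)
      finally show ?thesis .
    qed
  qed
  let ?C = "cross_domain \<Omega>"
  have "double_phase_functional Ksp Ktq a p q \<Omega> v + ennreal (2 powr (-p) / \<Lambda>) * gagliardo_energy s p f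
     = (\<integral>\<^sup>+ z. ennreal (G v z) * indicator ?C z + ennreal (2 powr (-p) / \<Lambda>) * ennreal (L z) \<partial>lebesgue)"
    unfolding F gagliardo_energy_def L_def[symmetric] by (simp add: nn_integral_add nn_integral_cmult L_def)
  also have "\<dots> \<le> (\<integral>\<^sup>+ z. ennreal (G u z) * indicator ?C z + ennreal \<Lambda> * ennreal (H z) \<partial>lebesgue)"
  proof (rule nn_integral_mono)
    fix z
    show "ennreal (G v z) * indicator ?C z + ennreal (2 powr (-p) / \<Lambda>) * ennreal (L z)
       \<le> ennreal (G u z) * indicator ?C z + ennreal \<Lambda> * ennreal (H z)"
    proof (cases "z \<in> ?C")
      case True
      then show ?thesis using ennreal_leI[OF ptw[of z]] G0 L0[of z] H0[of z] \<Lambda>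
        by (simp add: ennreal_mult[symmetric] ennreal_plus[symmetric] del: ennreal_plus)
    next
      case False
      then have "fst z \<notin> \<Omega>" "snd z \<notin> \<Omega>" by (auto simp: cross_domain_def)
      then have "L z = 0" using fout pq by (simp add: L_def)
      then show ?thesis using False by simp
    qed
  qed
  also have "\<dots> = double_phase_functional Ksp Ktq a p q \<Omega> u + ennreal \<Lambda> * total_error s t p q a x0 u k \<sigma> \<delta>"
    unfolding F total_error_def ep_def[symmetric] eq_def[symmetric] H_def[symmetric]
    by (simp add: nn_integral_add nn_integral_cmult)
  finally show ?thesis unfolding v_def .
qed

lemma admissible_iff:
  "w \<in> admissible a s t p q \<Omega> \<longleftrightarrow> w \<in> borel_measurable lebesgue \<and>
    (\<integral>\<^sup>+ x \<in> \<Omega>. ennreal (\<bar>w x\<bar> powr p) \<partial>lebesgue) < \<infinity> \<and>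
    double_phase_functional (\<lambda>z. 1 / norm (fst z - snd z) powr (real CARD('n) + s * p))
      (\<lambda>z. 1 / norm (fst z - snd z) powr (real CARD('n) + t * q)) a p q \<Omega> w < \<infinity>"
  by (simp add: admissible_def double_phase_functional_def case_prod_unfold)

lemma cut_excess_le: "0 \<le> k \<Longrightarrow> \<bar>u x - cut_excess l x0 \<sigma> \<delta> u k x\<bar> \<le> \<bar>u x\<bar>" if "0 \<le> l"
proof -
  assume k: "0 \<le> k"
  define c where "c = plateau x0 \<sigma> \<delta> x powr l"
  have c: "0 \<le> c" "c \<le> 1" using plateau_bounds[of x0 \<sigma> \<delta> x] that by (auto simp: c_def intro: powr_le1)
  define d where "d = c * excess u k x"
  have "0 \<le> d" "d \<le> excess u k x"
    using c by (auto simp: d_def mult_left_le_one_le)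
  then have "\<bar>u x - d\<bar> \<le> \<bar>u x\<bar>"
    using k by (auto simp: excess_def max_def abs_if split: if_splits)
  then show ?thesis by (simp add: cut_excess_def c_def d_def)
qed

text \<open>
  If the error is finite, the competitor has finite energy and is admissible, and minimality
  cancels the two values of the functional.
\<close>

lemma minimizer_Caccioppoli:
  assumes K: "fractional_kernel \<Lambda> s p Ksp" "fractional_kernel \<Lambda> t q Ktq" and \<Lambda>: "1 \<le> \<Lambda>"
    and min: "is_minimizer Ksp Ktq a s t p q \<Omega> u"
    and \<delta>: "0 < \<delta>" and sub: "ball x0 \<sigma> \<subseteq> \<Omega>" and k: "0 \<le> k"
  shows "ennreal (2 powr (-p) / \<Lambda>) * gagliardo_energy s p (cut_excess q x0 \<sigma> \<delta> u k)
    \<le> ennreal \<Lambda> * total_error s t p q a x0 u k \<sigma> \<delta>"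
proof (cases "total_error s t p q a x0 u k \<sigma> \<delta> = \<infinity>")
  case True
  then show ?thesis using \<Lambda> by (simp add: ennreal_mult_eq_top_iff ennreal_top_mult) 
next
  case False
  define f where "f = cut_excess q x0 \<sigma> \<delta> u k"
  define v where "v x = u x - f x" for x
  let ?F = "double_phase_functional Ksp Ktq a p q \<Omega>"
  let ?k1 = "\<lambda>z :: (real^'n) \<times> (real^'n). 1 / norm (fst z - snd z) powr (real CARD('n) + s * p)"
  let ?k2 = "\<lambda>z :: (real^'n) \<times> (real^'n). 1 / norm (fst z - snd z) powr (real CARD('n) + t * q)"
  let ?F1 = "double_phase_functional ?k1 ?k2 a p q \<Omega>"
  note [measurable] = u
  have [measurable]: "f \<in> borel_measurable lebesgue" unfolding f_def by measurable
  have uadm: "u \<in> admissible a s t p q \<Omega>" using min by (simp add: is_minimizer_def)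
  have "?F1 v \<le> ?F1 u + ennreal 1 * total_error s t p q a x0 u k \<sigma> \<delta>"
    using double_phase_comparison[OF model_kernel model_kernel _ \<delta> sub, of k]
    unfolding v_def f_def by (rule order_trans[rotated]) auto
  also have "\<dots> < \<infinity>" using uadm False unfolding admissible_iff by (auto simp: less_top)
  finally have F1: "?F1 v < \<infinity>" .
  have "(\<integral>\<^sup>+ x \<in> \<Omega>. ennreal (\<bar>v x\<bar> powr p) \<partial>lebesgue) \<le> (\<integral>\<^sup>+ x \<in> \<Omega>. ennreal (\<bar>u x\<bar> powr p) \<partial>lebesgue)"
    using cut_excess_le[OF _ k] pq unfolding v_def f_def
    by (intro nn_integral_mono mult_right_mono ennreal_leI powr_mono2) auto
  also have "\<dots> < \<infinity>" using uadm unfolding admissible_iff by auto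
  finally have vadm: "v \<in> admissible a s t p q \<Omega>"
    unfolding admissible_iff using F1 by (auto simp: v_def[abs_def])
  have fout: "f x = 0" if "x \<notin> \<Omega>" for x
  proof -
    have "x \<notin> ball x0 \<sigma>" using that sub by blast
    from plateau_eq_0[OF \<delta> this] show ?thesis using pq by (simp add: f_def cut_excess_def)
  qed
  have le: "?F u \<le> ?F v"
    using min vadm fout unfolding is_minimizer_def by (auto simp: v_def)
  have "?F u \<le> ennreal \<Lambda> * ?F1 u"
  proof -
    have "?F u \<le> (\<integral>\<^sup>+ z. ennreal \<Lambda> * (ennreal (\<bar>u (fst z) - u (snd z)\<bar> powr p * ?k1 z + a z * \<bar>u (fst z) - u (snd z)\<bar> powr q * ?k2 z)
        * indicator (cross_domain \<Omega>) z) \<partial>lebesgue)"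
      unfolding double_phase_functional_def case_prod_unfold
    proof (rule nn_integral_mono)
      fix z :: "(real^'n) \<times> (real^'n)"
      have a0: "a z \<ge> 0" using coefficientD(2)[OF a] .
      have "\<bar>u (fst z) - u (snd z)\<bar> powr p * Ksp z + a z * \<bar>u (fst z) - u (snd z)\<bar> powr q * Ktq z
        \<le> \<Lambda> * (\<bar>u (fst z) - u (snd z)\<bar> powr p * ?k1 z + a z * \<bar>u (fst z) - u (snd z)\<bar> powr q * ?k2 z)"
      proof (cases "fst z = snd z")
        case False
        have "\<bar>u (fst z) - u (snd z)\<bar> powr p * Ksp z \<le> \<bar>u (fst z) - u (snd z)\<bar> powr p * (\<Lambda> * ?k1 z)"
          using fractional_kernelD(4)[OF K(1) False] by (intro mult_left_mono) auto
        moreover have "a z * \<bar>u (fst z) - u (snd z)\<bar> powr q * Ktq z \<le> a z * \<bar>u (fst z) - u (snd z)\<bar> powr q * (\<Lambda> * ?k2 z)"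
          using fractional_kernelD(4)[OF K(2) False] a0 by (intro mult_left_mono) auto
        ultimately show ?thesis by (simp add: algebra_simps)
      qed simp
      from ennreal_leI[OF this]
      have "ennreal (\<bar>u (fst z) - u (snd z)\<bar> powr p * Ksp z + a z * \<bar>u (fst z) - u (snd z)\<bar> powr q * Ktq z)
        \<le> ennreal \<Lambda> * ennreal (\<bar>u (fst z) - u (snd z)\<bar> powr p * ?k1 z + a z * \<bar>u (fst z) - u (snd z)\<bar> powr q * ?k2 z)"
        using \<Lambda> a0 by (subst ennreal_mult[symmetric]) auto
      from mult_right_mono[OF this, of "indicator (cross_domain \<Omega>) z"]
      show "ennreal (\<bar>u (fst z) - u (snd z)\<bar> powr p * Ksp (fst z, snd z) + a (fst z, snd z) * \<bar>u (fst z) - u (snd z)\<bar> powr q * Ktq (fst z, snd z))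
          * indicator (cross_domain \<Omega>) z
        \<le> ennreal \<Lambda> * (ennreal (\<bar>u (fst z) - u (snd z)\<bar> powr p * ?k1 z + a z * \<bar>u (fst z) - u (snd z)\<bar> powr q * ?k2 z)
        * indicator (cross_domain \<Omega>) z)"
        by (simp only: prod.collapse mult.assoc zero_le)
    qed
    also have "\<dots> \<le> ennreal \<Lambda> * ?F1 u"
      unfolding double_phase_functional_def case_prod_unfold using \<Lambda> by (intro order_trans[OF nn_integral_cmult_le]) auto
    finally show ?thesis .
  qed
  also have "\<dots> < \<infinity>" using uadm unfolding admissible_iff by (auto simp: ennreal_mult_less_top)
  finally have Fu: "?F u < \<infinity>" .
  have "?F u + ennreal (2 powr (-p) / \<Lambda>) * gagliardo_energy s p f \<le> ?F v + ennreal (2 powr (-p) / \<Lambda>) * gagliardo_energy s p f"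
    by (intro add_right_mono le)
  also have "\<dots> \<le> ?F u + ennreal \<Lambda> * total_error s t p q a x0 u k \<sigma> \<delta>"
    using double_phase_comparison[OF K \<Lambda> \<delta> sub, of k] unfolding v_def f_def .
  finally show ?thesis using Fu unfolding f_def by (auto simp: ennreal_add_left_cancel_le)
qed

end

section \<open>De Giorgi iteration\<close>

text \<open>
  By induction \<open>Y i \<le> \<epsilon> \<mu>\<^sup>i\<close>: the ratio \<open>\<mu>\<close> is chosen such that \<open>\<mu> powr (\<kappa> - 1)\<close>
  compensates \<open>b\<close>, and \<open>\<epsilon>\<close> such that \<open>C \<epsilon> powr (\<kappa> - 1) = \<mu>\<close>.
\<close>

lemma fast_geometric_convergence:
  fixes C b \<kappa> :: real
  assumes C: "0 < C" and b: "1 < b" and \<kappa>: "1 < \<kappa>"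
  obtains \<epsilon> where "0 < \<epsilon>"
    "\<And>Y :: nat \<Rightarrow> real. (\<And>i. 0 \<le> Y i) \<Longrightarrow> (\<And>i. Y (Suc i) \<le> C * b ^ i * Y i powr \<kappa>) \<Longrightarrow> Y 0 \<le> \<epsilon> \<Longrightarrow> Y \<longlonglongrightarrow> 0"
proof -
  define \<mu> where "\<mu> = b powr (- 1 / (\<kappa> - 1))"
  define \<epsilon> where "\<epsilon> = (\<mu> / C) powr (1 / (\<kappa> - 1))"
  have \<mu>: "0 < \<mu>" "\<mu> < 1" using b \<kappa> by (auto simp: \<mu>_def powr_less_one)
  have "\<mu> powr (\<kappa> - 1) = b powr (- 1)" using \<kappa> by (simp add: \<mu>_def powr_powr del: powr_minus)
  then have \<mu>b: "b * \<mu> powr (\<kappa> - 1) = 1" using b by (simp add: powr_neg_one)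
  have \<epsilon>: "\<epsilon> > 0" using \<mu> C by (simp add: \<epsilon>_def)
  have \<epsilon>C: "C * \<epsilon> powr (\<kappa> - 1) = \<mu>" using C \<mu> \<kappa> by (simp add: \<epsilon>_def powr_powr)
  have split: "c powr \<kappa> = c * c powr (\<kappa> - 1)" if "c > 0" for c
    using powr_mult_base[of c "\<kappa> - 1"] that by simp
  show ?thesis
  proof (rule that[OF \<epsilon>])
    fix Y :: "nat \<Rightarrow> real"
    assume Y0: "\<And>i. 0 \<le> Y i" and step: "\<And>i. Y (Suc i) \<le> C * b ^ i * Y i powr \<kappa>" and start: "Y 0 \<le> \<epsilon>"
    have bound: "Y i \<le> \<epsilon> * \<mu> ^ i" for i
    proof (induction i)
      case (Suc i)
      have "Y (Suc i) \<le> C * b ^ i * Y i powr \<kappa>" by (rule step)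
      also have "\<dots> \<le> C * b ^ i * (\<epsilon> * \<mu> ^ i) powr \<kappa>"
        using Suc Y0[of i] C b \<kappa> by (intro mult_left_mono powr_mono2) auto
      also have "(\<epsilon> * \<mu> ^ i) powr \<kappa> = (\<epsilon> * \<epsilon> powr (\<kappa> - 1)) * (\<mu> ^ i * (\<mu> powr (\<kappa> - 1)) ^ i)"
      proof -
        have "(\<mu> ^ i) powr (\<kappa> - 1) = (\<mu> powr (\<kappa> - 1)) ^ i"
          using \<mu> by (simp add: powr_realpow[symmetric] powr_powr mult.commute)
        then show ?thesis
          using split[OF \<epsilon>] split[of "\<mu> ^ i"] \<mu> by (simp add: powr_mult)
      qed
      also have "C * b ^ i * ((\<epsilon> * \<epsilon> powr (\<kappa> - 1)) * (\<mu> ^ i * (\<mu> powr (\<kappa> - 1)) ^ i))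
         = \<epsilon> * (C * \<epsilon> powr (\<kappa> - 1)) * \<mu> ^ i * (b * \<mu> powr (\<kappa> - 1)) ^ i"
        by (simp add: power_mult_distrib)
      also have "\<dots> = \<epsilon> * \<mu> ^ Suc i" unfolding \<mu>b \<epsilon>C by simp
      finally show ?case .
    qed (use start in simp)
    have "(\<lambda>i. \<epsilon> * \<mu> ^ i) \<longlonglongrightarrow> \<epsilon> * 0"
      using \<mu> by (intro tendsto_mult tendsto_const LIMSEQ_power_zero) auto
    then show "Y \<longlonglongrightarrow> 0"
      by (intro tendsto_sandwich[OF _ _ tendsto_const, of 0 Y sequentially "\<lambda>i. \<epsilon> * \<mu> ^ i"])
        (auto simp: Y0 bound)
  qed
qed

text \<open>
  Where the higher excess is positive, the lower one is at least \<open>d\<close>; dividing by \<open>d\<close> lets a larger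
  exponent dominate a smaller one.
\<close>

lemma excess_level_le:
  fixes u :: "'a \<Rightarrow> real"
  assumes d: "0 < d" "d \<le> 1" and m: "1 \<le> m" "m \<le> r" and k: "k + d \<le> k'"
  shows "excess u k' x powr m \<le> d powr (- r) * excess u k x powr r"
proof (cases "u x \<le> k'")
  case True
  then show ?thesis using m by (simp add: excess_def)
next
  case False
  define e where "e = excess u k x"
  have e: "d \<le> e" "excess u k' x \<le> e" using False k d by (auto simp: e_def excess_def)
  have "excess u k' x powr m \<le> e powr m" using e m by (intro powr_mono2) auto
  also have "e = d * (e / d)" using d by simp
  also have "(d * (e / d)) powr m = d powr m * (e / d) powr m" by (rule powr_mult)
  also have "\<dots> \<le> 1 * (e / d) powr r"
    using d e m by (intro mult_mono powr_mono) (auto intro: powr_le1)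
  also have "\<dots> = d powr (- r) * e powr r"
    using d e by (simp add: powr_divide powr_minus divide_simps)
  finally show ?thesis unfolding e_def .
qed

text \<open>
  The two phases are \<open>comparison_error_integral\<close> with \<open>b = 1\<close> and \<open>b = a\<close>; local boundedness of \<open>a\<close>
  enters through the near pairs, and the two tail conditions through the far pairs.
\<close>

lemma total_error_bound:
  fixes \<Omega> :: "(real^'n) set" and s t p q R :: real and a :: "(real^'n) \<times> (real^'n) \<Rightarrow> real"
    and x0 :: "real^'n" and u :: "real^'n \<Rightarrow> real"
  defines "A \<equiv> 2 * R + 1 + norm x0"
  assumes s: "0 < s" "s < 1" and t: "0 < t" "t < 1" and pq: "1 < p" "p \<le> q" and a: "coefficient a"
    and aloc: "a \<in> L_infinity_loc (\<Omega> \<times> \<Omega>)" and R: "0 < R" "cball x0 R \<subseteq> \<Omega>"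
    and u: "u \<in> tail_space s p" "u \<in> weighted_tail_space a t q \<Omega>"
  obtains C where "0 \<le> C"
    "\<And>k \<sigma> \<delta>. 0 \<le> k \<Longrightarrow> 0 < \<sigma> \<Longrightarrow> 0 < \<delta> \<Longrightarrow> \<sigma> + \<delta> \<le> R \<Longrightarrow>
      total_error s t p q a x0 u k \<sigma> \<delta> \<le> ennreal (C * (A / \<delta>) powr (real CARD('n) + 2 * q))
        * (\<integral>\<^sup>+ x. ennreal (indicator (ball x0 (\<sigma> + \<delta>)) x
            * (excess u k x powr p + excess u k x powr q + 2 * excess u k x)) \<partial>lebesgue)"
proof -
  have um[measurable]: "u \<in> borel_measurable lebesgue" using u by (simp add: tail_space_def)
  note am[measurable] = coefficientD(1)[OF a]
  define Tp where "Tp = enn2real (\<integral>\<^sup>+ x. ennreal (\<bar>u x\<bar> powr (p - 1) / (1 + norm x) powr (real CARD('n) + s * p)) \<partial>lebesgue)"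
  define Tq where "Tq = enn2real (SUP x\<in>\<Omega>. \<integral>\<^sup>+ y.
          ennreal (a (x, y) * (\<bar>u y\<bar> powr (q - 1) / (1 + norm y) powr (real CARD('n) + t * q))) \<partial>lebesgue)"
  have T0: "Tp \<ge> 0" "Tq \<ge> 0" by (simp_all add: Tp_def Tq_def)
  have Tp: "(\<integral>\<^sup>+ x. ennreal (\<bar>u x\<bar> powr (p - 1) / (1 + norm x) powr (real CARD('n) + s * p)) \<partial>lebesgue) \<le> ennreal Tp"
    using u(1) by (simp add: Tp_def tail_space_def less_top)
  have Tq: "(\<integral>\<^sup>+ y. ennreal (a (x, y) * (\<bar>u y\<bar> powr (q - 1) / (1 + norm y) powr (real CARD('n) + t * q))) \<partial>lebesgue) \<le> ennreal Tq"
    if "x \<in> ball x0 R" for x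
  proof -
    have "x \<in> \<Omega>" using that R(2) by (auto simp: subset_iff)
    then have "(\<integral>\<^sup>+ y. ennreal (a (x, y) * (\<bar>u y\<bar> powr (q - 1) / (1 + norm y) powr (real CARD('n) + t * q))) \<partial>lebesgue)
      \<le> (SUP x\<in>\<Omega>. \<integral>\<^sup>+ y. ennreal (a (x, y) * (\<bar>u y\<bar> powr (q - 1) / (1 + norm y) powr (real CARD('n) + t * q))) \<partial>lebesgue)"
      by (rule SUP_upper)
    also have "\<dots> = ennreal Tq" using u(2) by (simp add: Tq_def weighted_tail_space_def less_top)
    finally show ?thesis .
  qed
  have "compact (cball x0 R \<times> cball x0 R)" "cball x0 R \<times> cball x0 R \<subseteq> \<Omega> \<times> \<Omega>"
    using R(2) by (auto intro: compact_Times)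
  then obtain M where M: "AE z in lebesgue. z \<in> cball x0 R \<times> cball x0 R \<longrightarrow> \<bar>a z\<bar> \<le> M"
    using aloc unfolding L_infinity_loc_def by blast
  have Mq: "AE z in lebesgue. z \<in> ball x0 R \<times> ball x0 R \<longrightarrow> a z \<le> max M 0"
    using M by (rule AE_mp) (auto intro!: AE_I2 simp: max_def)
  note ep = comparison_error_integral[of p q s R u "\<lambda>_. 1" 1 x0 Tp]
  note eq = comparison_error_integral[of q q t R u a "max M 0" x0 Tq]
  show thesis
  proof (rule ep)
    fix Cp
    assume Cp0: "0 \<le> Cp" and Cp: "\<And>k \<sigma> \<delta>. 0 \<le> k \<Longrightarrow> 0 < \<sigma> \<Longrightarrow> 0 < \<delta> \<Longrightarrow> \<sigma> + \<delta> \<le> R \<Longrightarrow>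
      (\<integral>\<^sup>+ z. ennreal (1 * (comparison_error p q x0 \<sigma> \<delta> u k z / norm (fst z - snd z) powr (real DIM(real^'n) + s * p))) \<partial>lebesgue)
      \<le> ennreal (Cp * ((2 * R + 1 + norm x0) / \<delta>) powr (real DIM(real^'n) + 2 * p))
        * (\<integral>\<^sup>+ x. ennreal (indicator (ball x0 (\<sigma> + \<delta>)) x * (excess u k x powr p + excess u k x)) \<partial>lebesgue)"
    show thesis
    proof (rule eq)
      fix Cq
      assume Cq0: "0 \<le> Cq" and Cq: "\<And>k \<sigma> \<delta>. 0 \<le> k \<Longrightarrow> 0 < \<sigma> \<Longrightarrow> 0 < \<delta> \<Longrightarrow> \<sigma> + \<delta> \<le> R \<Longrightarrow>
        (\<integral>\<^sup>+ z. ennreal (a z * (comparison_error q q x0 \<sigma> \<delta> u k z / norm (fst z - snd z) powr (real DIM(real^'n) + t * q))) \<partial>lebesgue)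
        \<le> ennreal (Cq * ((2 * R + 1 + norm x0) / \<delta>) powr (real DIM(real^'n) + 2 * q))
          * (\<integral>\<^sup>+ x. ennreal (indicator (ball x0 (\<sigma> + \<delta>)) x * (excess u k x powr q + excess u k x)) \<partial>lebesgue)"
      show thesis
      proof (rule that[of "Cp + Cq"])
        show "0 \<le> Cp + Cq" using Cp0 Cq0 by simp
        fix k \<sigma> \<delta> :: real
        assume k: "0 \<le> k" and \<sigma>: "0 < \<sigma>" and \<delta>: "0 < \<delta>" and \<sigma>R: "\<sigma> + \<delta> \<le> R"
        have "\<delta> \<le> A" using \<sigma>R \<sigma> R(1) norm_ge_zero[of x0] unfolding A_def by linarith
        then have D1: "1 \<le> A / \<delta>" using \<delta> by simp
        define D where "D = (A / \<delta>) powr (real CARD('n) + 2 * q)"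
        define c where "c = Cp + Cq"
        let ?ind = "\<lambda>x. indicator (ball x0 (\<sigma> + \<delta>)) x :: real"
        let ?e = "excess u k"
        have D0: "D \<ge> 0" by (simp add: D_def)
        have cpq: "Cp * (A / \<delta>) powr (real CARD('n) + 2 * p) \<le> c * D" "Cq * D \<le> c * D"
        proof -
          have "(A / \<delta>) powr (real CARD('n) + 2 * p) \<le> D" unfolding D_def using D1 pq by (intro powr_mono) auto
          then show "Cp * (A / \<delta>) powr (real CARD('n) + 2 * p) \<le> c * D"
            using Cp0 Cq0 by (auto simp: c_def intro!: mult_mono)
          show "Cq * D \<le> c * D" using Cp0 D0 by (auto simp: c_def intro!: mult_right_mono)
        qed
        have e0: "0 \<le> comparison_error p q x0 \<sigma> \<delta> u k z" "0 \<le> comparison_error q q x0 \<sigma> \<delta> u k z" for z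
          using pq by (auto intro: comparison_error_nonneg)
        have "total_error s t p q a x0 u k \<sigma> \<delta> =
          (\<integral>\<^sup>+ z. ennreal (comparison_error p q x0 \<sigma> \<delta> u k z / norm (fst z - snd z) powr (real CARD('n) + s * p))
          + ennreal (a z * (comparison_error q q x0 \<sigma> \<delta> u k z / norm (fst z - snd z) powr (real CARD('n) + t * q))) \<partial>lebesgue)"
          unfolding total_error_def using e0 coefficientD(2)[OF a]
          by (intro nn_integral_cong ennreal_plus) (auto intro!: divide_nonneg_nonneg mult_nonneg_nonneg)
        also have "\<dots> = (\<integral>\<^sup>+ z. ennreal (comparison_error p q x0 \<sigma> \<delta> u k z / norm (fst z - snd z) powr (real CARD('n) + s * p)) \<partial>lebesgue)
          + (\<integral>\<^sup>+ z. ennreal (a z * (comparison_error q q x0 \<sigma> \<delta> u k z / norm (fst z - snd z) powr (real CARD('n) + t * q))) \<partial>lebesgue)"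
          by (intro nn_integral_add) measurable
        also have "\<dots> \<le> ennreal (Cp * (A / \<delta>) powr (real CARD('n) + 2 * p))
             * (\<integral>\<^sup>+ x. ennreal (?ind x * (?e x powr p + ?e x)) \<partial>lebesgue)
           + ennreal (Cq * D) * (\<integral>\<^sup>+ x. ennreal (?ind x * (?e x powr q + ?e x)) \<partial>lebesgue)"
          using Cp[OF k \<sigma> \<delta> \<sigma>R] Cq[OF k \<sigma> \<delta> \<sigma>R] unfolding A_def D_def by (intro add_mono) simp_all
        also have "\<dots> \<le> ennreal (c * D) * (\<integral>\<^sup>+ x. ennreal (?ind x * (?e x powr p + ?e x)) \<partial>lebesgue)
           + ennreal (c * D) * (\<integral>\<^sup>+ x. ennreal (?ind x * (?e x powr q + ?e x)) \<partial>lebesgue)"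
          by (intro add_mono mult_right_mono ennreal_leI cpq) auto
        also have "\<dots> = ennreal (c * D) * (\<integral>\<^sup>+ x. ennreal (?ind x * (?e x powr p + ?e x)) + ennreal (?ind x * (?e x powr q + ?e x)) \<partial>lebesgue)"
          by (simp add: distrib_left[symmetric] nn_integral_add)
        also have "(\<integral>\<^sup>+ x. ennreal (?ind x * (?e x powr p + ?e x)) + ennreal (?ind x * (?e x powr q + ?e x)) \<partial>lebesgue)
          = (\<integral>\<^sup>+ x. ennreal (?ind x * (?e x powr p + ?e x powr q + 2 * ?e x)) \<partial>lebesgue)"
          by (intro nn_integral_cong) (auto simp: ennreal_plus[symmetric] indicator_def simp del: ennreal_plus)
        finally show "total_error s t p q a x0 u k \<sigma> \<delta> \<le> ennreal ((Cp + Cq) * (A / \<delta>) powr (real CARD('n) + 2 * q))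
          * (\<integral>\<^sup>+ x. ennreal (?ind x * (?e x powr p + ?e x powr q + 2 * ?e x)) \<partial>lebesgue)"
          unfolding c_def D_def .
      qed
    qed (use pq t R coefficientD[OF a] Mq T0 Tq in \<open>auto\<close>)
  qed (use pq s R T0 Tp in \<open>auto\<close>)
qed

text \<open>
  The starting point of the iteration.  A function of finite \<open>p\<close>-energy should lie in the Sobolev space
  locally, but its cut-off has to be shown to have finite energy on the whole space.  This is read off from
  the comparison inequality at level 0 with coefficient 0, where the only errors are integrals of
  \<open>u\<^sup>+ powr p\<close> and \<open>u\<^sup>+\<close>; the value at the competitor is discarded.
\<close>

lemma higher_integrability:
  fixes \<Omega> :: "(real^'n) set" and s t p q r R :: real and x0 :: "real^'n" and u :: "real^'n \<Rightarrow> real"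
  assumes \<Omega>: "open \<Omega>" and s: "0 < s" "s < 1" and pq: "1 < p" "p \<le> q" and a: "coefficient a"
    and r: "p < r" "real CARD('n) * (1 - p / r) \<le> s * p"
    and R: "0 < R" "cball x0 (2 * R) \<subseteq> \<Omega>"
    and u: "u \<in> tail_space s p" "u \<in> admissible a s t p q \<Omega>"
  shows "(\<integral>\<^sup>+ x. ennreal (indicator (ball x0 R) x * excess u 0 x powr r) \<partial>lebesgue) < \<infinity>"
proof -
  define \<sigma> where "\<sigma> = 3 * R / 2"
  define \<delta> where "\<delta> = R / 2"
  have \<sigma>\<delta>: "0 < \<sigma>" "0 < \<delta>" "\<sigma> + \<delta> \<le> 2 * R" "\<sigma> - \<delta> = R" "\<sigma> + \<delta> = 2 * R" using R by (auto simp: \<sigma>_def \<delta>_def)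
  have um[measurable]: "u \<in> borel_measurable lebesgue" using u by (simp add: tail_space_def)
  define z0 :: "(real^'n) \<times> (real^'n) \<Rightarrow> real" where "z0 = (\<lambda>_. 0)"
  have z0: "coefficient z0" by (simp add: z0_def coefficient_def)
  have sub: "ball x0 \<sigma> \<subseteq> \<Omega>" using R by (auto simp: \<sigma>_def subset_iff)
  define f where "f = cut_excess p x0 \<sigma> \<delta> u 0"
  have [measurable]: "f \<in> borel_measurable lebesgue" unfolding f_def by measurable
  let ?k1 = "\<lambda>z :: (real^'n) \<times> (real^'n). 1 / norm (fst z - snd z) powr (real CARD('n) + s * p)"
  let ?k2 = "\<lambda>z :: (real^'n) \<times> (real^'n). 1 / norm (fst z - snd z) powr (real CARD('n) + t * q)"
  let ?G = "gagliardo_energy s p f"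
  have "double_phase_functional ?k1 ?k1 z0 p p \<Omega> u \<le> double_phase_functional ?k1 ?k2 a p q \<Omega> u"
    unfolding double_phase_functional_def case_prod_unfold using coefficientD(2)[OF a]
    by (intro nn_integral_mono mult_right_mono ennreal_leI) (auto simp: z0_def)
  also have "\<dots> < \<infinity>" using u(2) unfolding admissible_iff[OF \<Omega> pq a um] by simp
  finally have F: "double_phase_functional ?k1 ?k1 z0 p p \<Omega> u < \<infinity>" .
  have E: "total_error s s p p z0 x0 u 0 \<sigma> \<delta> < \<infinity>"
  proof (rule total_error_bound[of s s p p z0 \<Omega> "2 * R" x0 u])
    have "AE z in lebesgue. z \<in> C \<longrightarrow> \<bar>z0 z\<bar> \<le> 0" for C by (simp add: z0_def)
    then show "z0 \<in> L_infinity_loc (\<Omega> \<times> \<Omega>)"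
      unfolding L_infinity_loc_def set_borel_measurable_def by (auto simp: z0_def)
    show "u \<in> weighted_tail_space z0 s p \<Omega>" using um by (cases "\<Omega> = {}") (auto simp: weighted_tail_space_def z0_def bot_ennreal)
    fix C assume C: "0 \<le> C" "\<And>k \<sigma> \<delta>. 0 \<le> k \<Longrightarrow> 0 < \<sigma> \<Longrightarrow> 0 < \<delta> \<Longrightarrow> \<sigma> + \<delta> \<le> 2 * R \<Longrightarrow>
      total_error s s p p z0 x0 u k \<sigma> \<delta> \<le> ennreal (C * ((2 * (2 * R) + 1 + norm x0) / \<delta>) powr (real CARD('n) + 2 * p))
        * (\<integral>\<^sup>+ x. ennreal (indicator (ball x0 (\<sigma> + \<delta>)) x
            * (excess u k x powr p + excess u k x powr p + 2 * excess u k x)) \<partial>lebesgue)"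
    have "(\<integral>\<^sup>+ x. ennreal (indicator (ball x0 (\<sigma> + \<delta>)) x
            * (excess u 0 x powr p + excess u 0 x powr p + 2 * excess u 0 x)) \<partial>lebesgue)
       \<le> (\<integral>\<^sup>+ x. 2 * indicator (ball x0 (2 * R)) x + 4 * (ennreal (\<bar>u x\<bar> powr p) * indicator \<Omega> x) \<partial>lebesgue)"
    proof (rule nn_integral_mono)
      fix x
      have e: "excess u 0 x \<le> \<bar>u x\<bar>" "0 \<le> excess u 0 x" by (auto simp: excess_def)
      have "excess u 0 x powr p \<le> \<bar>u x\<bar> powr p" using e pq by (intro powr_mono2) auto
      moreover have "\<bar>u x\<bar> \<le> 1 + \<bar>u x\<bar> powr p"
      proof (cases "\<bar>u x\<bar> \<le> 1")
        case False
        then show ?thesis using powr_mono[of 1 p "\<bar>u x\<bar>"] pq by simp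
      qed (simp add: add_increasing2)
      ultimately have le: "excess u 0 x powr p + excess u 0 x powr p + 2 * excess u 0 x \<le> 2 + 4 * \<bar>u x\<bar> powr p"
        using e by linarith
      show "ennreal (indicator (ball x0 (\<sigma> + \<delta>)) x
            * (excess u 0 x powr p + excess u 0 x powr p + 2 * excess u 0 x))
        \<le> 2 * indicator (ball x0 (2 * R)) x + 4 * (ennreal (\<bar>u x\<bar> powr p) * indicator \<Omega> x)"
      proof (cases "x \<in> ball x0 (2 * R)")
        case True
        then have "x \<in> \<Omega>" using R(2) by (auto simp: subset_iff)
        have "ennreal (2 + 4 * \<bar>u x\<bar> powr p) = 2 + 4 * ennreal (\<bar>u x\<bar> powr p)"
          by (simp add: ennreal_plus ennreal_mult)
        then show ?thesis using True \<open>x \<in> \<Omega>\<close> ennreal_leI[OF le] \<sigma>\<delta>(5) by simp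
      qed (simp add: \<sigma>\<delta>(5))
    qed
    also have "\<dots> = 2 * emeasure lebesgue (ball x0 (2 * R)) + 4 * (\<integral>\<^sup>+ x \<in> \<Omega>. ennreal (\<bar>u x\<bar> powr p) \<partial>lebesgue)"
    proof -
      have m: "(\<lambda>x. 2 * indicator (ball x0 (2 * R)) x :: ennreal) \<in> borel_measurable lebesgue"
        "(\<lambda>x. ennreal (\<bar>u x\<bar> powr p) * indicator \<Omega> x) \<in> borel_measurable lebesgue"
        using \<Omega> um by (auto intro!: borel_measurable_times_ennreal borel_measurable_indicator)
      then have "(\<lambda>x. 4 * (ennreal (\<bar>u x\<bar> powr p) * indicator \<Omega> x)) \<in> borel_measurable lebesgue"
        using borel_measurable_times_ennreal[OF borel_measurable_const] by blast
      from nn_integral_add[OF m(1) this] nn_integral_cmult[OF m(2), of 4] show ?thesis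
        by (simp add: nn_integral_cmult_indicator)
    qed
    also have "\<dots> < \<infinity>"
      using u(2) R unfolding admissible_iff[OF \<Omega> pq a um] by (simp add: ennreal_mult_less_top emeasure_ball)
    finally have J: "(\<integral>\<^sup>+ x. ennreal (indicator (ball x0 (\<sigma> + \<delta>)) x
            * (excess u 0 x powr p + excess u 0 x powr p + 2 * excess u 0 x)) \<partial>lebesgue) < \<infinity>" .
    have "total_error s s p p z0 x0 u 0 \<sigma> \<delta> \<le> ennreal (C * ((2 * (2 * R) + 1 + norm x0) / \<delta>) powr (real CARD('n) + 2 * p))
        * (\<integral>\<^sup>+ x. ennreal (indicator (ball x0 (\<sigma> + \<delta>)) x
            * (excess u 0 x powr p + excess u 0 x powr p + 2 * excess u 0 x)) \<partial>lebesgue)"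
      by (rule C(2)) (use \<sigma>\<delta> in auto)
    also have "\<dots> < \<infinity>" using J by (simp add: ennreal_mult_less_top)
    finally show ?thesis .
  qed (use s pq R z0 u in auto)
  have "ennreal (2 powr (-p) / 1) * ?G \<le> double_phase_functional ?k1 ?k1 z0 p p \<Omega> (\<lambda>x. u x - f x) + ennreal (2 powr (-p) / 1) * ?G"
    by (simp add: add_increasing)
  also have "\<dots> \<le> double_phase_functional ?k1 ?k1 z0 p p \<Omega> u + ennreal 1 * total_error s s p p z0 x0 u 0 \<sigma> \<delta>"
    unfolding f_def using double_phase_comparison[OF \<Omega> pq(1) order_refl z0 um model_kernel model_kernel order_refl \<sigma>\<delta>(2) sub] .
  also have "\<dots> < \<infinity>" using F E by simp
  finally have "?G < \<infinity>" by (auto simp: ennreal_mult_less_top)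
  then obtain E where E: "?G = ennreal E" "0 \<le> E" by (cases ?G) auto
  show ?thesis
  proof (rule fractional_Sobolev[of p r s "2 * R" x0])
    fix C assume C: "0 < C" "\<And>f E. f \<in> borel_measurable lebesgue \<Longrightarrow> (\<And>x. 0 \<le> f x) \<Longrightarrow> (\<And>x. x \<notin> ball x0 (2 * R) \<Longrightarrow> f x = 0) \<Longrightarrow>
      0 \<le> E \<Longrightarrow> gagliardo_energy s p f \<le> ennreal E \<Longrightarrow> (\<integral>\<^sup>+ x. ennreal (f x powr r) \<partial>lebesgue) \<le> ennreal (C * E powr (r / p))"
    have "(\<integral>\<^sup>+ x. ennreal (indicator (ball x0 R) x * excess u 0 x powr r) \<partial>lebesgue) \<le> (\<integral>\<^sup>+ x. ennreal (f x powr r) \<partial>lebesgue)"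
    proof (intro nn_integral_mono ennreal_leI)
      fix x
      show "indicator (ball x0 R) x * excess u 0 x powr r \<le> f x powr r"
      proof (cases "x \<in> ball x0 R")
        case True
        then have "plateau x0 \<sigma> \<delta> x = 1" using \<sigma>\<delta> by (intro plateau_eq_1) auto
        then show ?thesis using True by (simp add: f_def cut_excess_def)
      qed simp
    qed
    also have "\<dots> \<le> ennreal (C * E powr (r / p))"
    proof (rule C(2))
      fix x
      show "0 \<le> f x" by (simp add: f_def cut_excess_def)
      assume "x \<notin> ball x0 (2 * R)"
      then have "x \<notin> ball x0 \<sigma>" using R by (auto simp: \<sigma>_def)
      from plateau_eq_0[OF \<sigma>\<delta>(2) this] show "f x = 0" using pq by (simp add: f_def cut_excess_def)
    qed (use E in auto)
    also have "\<dots> < \<infinity>" by simp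
    finally show ?thesis .
  qed (use pq r R s in auto)
qed

text \<open>
  The iteration with radii \<open>\<rho> i\<close> decreasing from \<open>R\<close> to \<open>R / 2\<close> and levels \<open>k0 + 1 - 1 / 2\<^sup>i\<close>
  increasing from \<open>k0\<close> to \<open>k0 + 1\<close>.  Along it, \<open>\<delta> i\<close> is half the gap between consecutive radii: one
  half is the slope region of the cutoff and the other separates its support from the outer ball.
\<close>

lemma minimizer_bounded_above:
  fixes \<Omega> :: "(real^'n) set" and s t p q r R \<Lambda> :: real and x0 :: "real^'n" and u :: "real^'n \<Rightarrow> real"
  assumes \<Omega>: "open \<Omega>" and s: "0 < s" "s < 1" and t: "0 < t" "t < 1" and pq: "1 < p" "p \<le> q"
    and K: "fractional_kernel \<Lambda> s p Ksp" "fractional_kernel \<Lambda> t q Ktq" and \<Lambda>: "1 \<le> \<Lambda>"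
    and a: "coefficient a" and aloc: "a \<in> L_infinity_loc (\<Omega> \<times> \<Omega>)"
    and r: "p < r" "q \<le> r" "real CARD('n) * (1 - p / r) \<le> s * p"
    and R: "0 < R" "cball x0 (2 * R) \<subseteq> \<Omega>"
    and u: "u \<in> tail_space s p" "u \<in> weighted_tail_space a t q \<Omega>"
    and min: "is_minimizer Ksp Ktq a s t p q \<Omega> u"
  shows "\<exists>M. AE x in lebesgue. x \<in> ball x0 (R / 2) \<longrightarrow> u x \<le> M"
proof -
  have um[measurable]: "u \<in> borel_measurable lebesgue" using u by (simp add: tail_space_def)
  have uadm: "u \<in> admissible a s t p q \<Omega>" using min by (simp add: is_minimizer_def)
  have RO: "cball x0 R \<subseteq> \<Omega>" using R by (intro order_trans[OF _ R(2)] subset_cball) auto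
  define A where "A = 2 * R + 1 + norm x0"
  define g where "g = real CARD('n) + 2 * q"
  define \<kappa> where "\<kappa> = r / p"
  have \<kappa>: "\<kappa> > 1" using r pq by (simp add: \<kappa>_def)
  have g: "g > 0" using pq by (simp add: g_def add_pos_pos)
  have A: "A > 0" using R norm_ge_zero[of x0] unfolding A_def by linarith
  define \<delta> where "\<delta> i = R / (8 * 2 ^ i)" for i :: nat
  define \<rho> where "\<rho> i = R / 2 * (1 + 1 / 2 ^ i)" for i :: nat
  define d :: "nat \<Rightarrow> real" where "d i = 1 / 2 ^ Suc i" for i
  have \<delta>: "\<delta> i > 0" for i using R by (simp add: \<delta>_def)
  have \<rho>: "R / 2 < \<rho> i" "\<rho> i \<le> R" for i using R by (auto simp: \<rho>_def field_simps)
  have \<rho>Suc: "\<rho> i - \<delta> i - \<delta> i = \<rho> (Suc i)" for i by (simp add: \<rho>_def \<delta>_def field_simps)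
  have \<rho>\<delta>: "0 < \<rho> i - \<delta> i" for i using \<rho>Suc[of i] \<delta>[of i] \<rho>[of "Suc i"] R by linarith
  have d: "0 < d i" "d i \<le> 1" for i
    using one_le_power[of "2::real" "Suc i"] by (auto simp: d_def simp del: power_Suc)
  define Y where "Y k0 i = (\<integral>\<^sup>+ x. ennreal (indicator (ball x0 (\<rho> i)) x * excess u (k0 + 1 - 1 / 2 ^ i) x powr r) \<partial>lebesgue)"
    for k0 :: real and i :: nat
  have u0: "(\<integral>\<^sup>+ x. ennreal (indicator (ball x0 R) x * excess u 0 x powr r) \<partial>lebesgue) < \<infinity>"
    by (rule higher_integrability[OF \<Omega> s pq a r(1,3) R u(1) uadm])
  have Yfin: "Y k0 i < \<infinity>" if "0 \<le> k0" for k0 i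
  proof -
    have "Y k0 i \<le> (\<integral>\<^sup>+ x. ennreal (indicator (ball x0 R) x * excess u 0 x powr r) \<partial>lebesgue)"
      unfolding Y_def
    proof (intro nn_integral_mono ennreal_leI mult_mono)
      fix x
      show "indicator (ball x0 (\<rho> i)) x \<le> (indicator (ball x0 R) x :: real)"
        using \<rho>(2)[of i] by (auto simp: indicator_def)
      have "1 / 2 ^ i \<le> (1::real)" by simp
      then have "0 \<le> k0 + 1 - 1 / 2 ^ i" using that by linarith
      then show "excess u (k0 + 1 - 1 / 2 ^ i) x powr r \<le> excess u 0 x powr r"
        using r pq by (intro powr_mono2) (auto simp: excess_def)
    qed auto
    then show ?thesis using u0 by (rule order_le_less_trans)
  qed
  show ?thesis
  proof (rule total_error_bound[OF s t pq a aloc R(1) RO u])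
    fix C assume C: "0 \<le> C" "\<And>k \<sigma> \<delta>. 0 \<le> k \<Longrightarrow> 0 < \<sigma> \<Longrightarrow> 0 < \<delta> \<Longrightarrow> \<sigma> + \<delta> \<le> R \<Longrightarrow>
      total_error s t p q a x0 u k \<sigma> \<delta> \<le> ennreal (C * ((2 * R + 1 + norm x0) / \<delta>) powr (real CARD('n) + 2 * q))
        * (\<integral>\<^sup>+ x. ennreal (indicator (ball x0 (\<sigma> + \<delta>)) x
            * (excess u k x powr p + excess u k x powr q + 2 * excess u k x)) \<partial>lebesgue)"
    show ?thesis
    proof (rule fractional_Sobolev[of p r s R x0])
      fix S assume S: "0 < S" "\<And>f E. f \<in> borel_measurable lebesgue \<Longrightarrow> (\<And>x. 0 \<le> f x) \<Longrightarrow> (\<And>x. x \<notin> ball x0 R \<Longrightarrow> f x = 0) \<Longrightarrow>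
        0 \<le> E \<Longrightarrow> gagliardo_energy s p f \<le> ennreal E \<Longrightarrow> (\<integral>\<^sup>+ x. ennreal (f x powr r) \<partial>lebesgue) \<le> ennreal (S * E powr (r / p))"
      \<comment> \<open>The summand 1 only makes the constant positive.\<close>
      define c where "c = \<Lambda> * \<Lambda> * 2 powr p * (C * (8 * A / R) powr g * (4 * 2 powr r)) + 1"
      have c: "c > 0" using C(1) \<Lambda> by (simp add: c_def add_nonneg_pos)
      define b where "b = 2 powr (g + r)"
      have b: "b > 1" using g r pq by (simp add: b_def)
      have step: "enn2real (Y k0 (Suc i)) \<le> S * c powr \<kappa> * (b powr \<kappa>) ^ i * enn2real (Y k0 i) powr \<kappa>"
        if k0: "0 \<le> k0" for k0 i
      proof -
        define k where "k = k0 + 1 - 1 / 2 ^ Suc i"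
        define f where "f = cut_excess q x0 (\<rho> i - \<delta> i) (\<delta> i) u k"
        define y where "y = enn2real (Y k0 i)"
        have y: "Y k0 i = ennreal y" "0 \<le> y" using Yfin[OF k0, of i] by (auto simp: y_def)
        have k: "0 \<le> k" "k0 + 1 - 1 / 2 ^ i + d i \<le> k"
        proof -
          have "1 / 2 ^ Suc i \<le> (1::real)" using d(2)[of i] by (simp only: d_def)
          then show "0 \<le> k" using k0 unfolding k_def by linarith
        qed (simp add: k_def d_def field_simps)
        have [measurable]: "f \<in> borel_measurable lebesgue" unfolding f_def by measurable
        have sub: "ball x0 (\<rho> i - \<delta> i) \<subseteq> \<Omega>"
          using RO \<delta>[of i] \<rho>(2)[of i] by (intro order_trans[OF _ RO]) (auto simp: subset_iff)
        have lev: "(\<integral>\<^sup>+ x. ennreal (indicator (ball x0 (\<rho> i)) x * (excess u k x powr p + excess u k x powr q + 2 * excess u k x)) \<partial>lebesgue)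
          \<le> ennreal (4 * d i powr (- r)) * Y k0 i"
        proof -
          have "(\<integral>\<^sup>+ x. ennreal (indicator (ball x0 (\<rho> i)) x * (excess u k x powr p + excess u k x powr q + 2 * excess u k x)) \<partial>lebesgue)
            \<le> (\<integral>\<^sup>+ x. ennreal (4 * d i powr (- r)) * ennreal (indicator (ball x0 (\<rho> i)) x * excess u (k0 + 1 - 1 / 2 ^ i) x powr r) \<partial>lebesgue)"
          proof (rule nn_integral_mono)
            fix x
            note le = excess_level_le[OF d _ _ k(2), of _ r u x]
            have "excess u k x powr p + excess u k x powr q + 2 * excess u k x powr 1
               \<le> 4 * (d i powr (- r) * excess u (k0 + 1 - 1 / 2 ^ i) x powr r)"
              using le[of p] le[of q] le[of 1] pq r by linarith
            then have "indicator (ball x0 (\<rho> i)) x * (excess u k x powr p + excess u k x powr q + 2 * excess u k x)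
              \<le> 4 * d i powr (- r) * (indicator (ball x0 (\<rho> i)) x * excess u (k0 + 1 - 1 / 2 ^ i) x powr r)"
              by (auto simp: indicator_def)
            from ennreal_leI[OF this]
            show "ennreal (indicator (ball x0 (\<rho> i)) x * (excess u k x powr p + excess u k x powr q + 2 * excess u k x))
              \<le> ennreal (4 * d i powr (- r)) * ennreal (indicator (ball x0 (\<rho> i)) x * excess u (k0 + 1 - 1 / 2 ^ i) x powr r)"
              by (subst ennreal_mult[symmetric]) auto
          qed
          also have "\<dots> = ennreal (4 * d i powr (- r)) * Y k0 i"
            unfolding Y_def by (intro nn_integral_cmult) measurable
          finally show ?thesis .
        qed
        define e where "e = C * (A / \<delta> i) powr g * (4 * d i powr (- r)) * y"
        have e0: "e \<ge> 0" using C(1) y by (simp add: e_def)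
        have "total_error s t p q a x0 u k (\<rho> i - \<delta> i) (\<delta> i)
          \<le> ennreal (C * (A / \<delta> i) powr g) * (\<integral>\<^sup>+ x. ennreal (indicator (ball x0 (\<rho> i)) x
            * (excess u k x powr p + excess u k x powr q + 2 * excess u k x)) \<partial>lebesgue)"
          using C(2)[OF k(1) \<rho>\<delta>[of i] \<delta>[of i]] \<rho>(2)[of i] by (simp add: A_def g_def)
        also have "\<dots> \<le> ennreal (C * (A / \<delta> i) powr g) * (ennreal (4 * d i powr (- r)) * Y k0 i)"
          by (intro mult_left_mono lev) auto
        also have "\<dots> = ennreal e"
          using C(1) y by (simp add: e_def ennreal_mult[symmetric] mult.assoc)
        finally have te: "total_error s t p q a x0 u k (\<rho> i - \<delta> i) (\<delta> i) \<le> ennreal e" .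
        have "gagliardo_energy s p f = ennreal (\<Lambda> * 2 powr p) * (ennreal (2 powr (-p) / \<Lambda>) * gagliardo_energy s p f)"
          using \<Lambda> by (simp add: mult.assoc[symmetric] ennreal_mult[symmetric] powr_minus)
        also have "\<dots> \<le> ennreal (\<Lambda> * 2 powr p) * (ennreal \<Lambda> * total_error s t p q a x0 u k (\<rho> i - \<delta> i) (\<delta> i))"
          unfolding f_def using minimizer_Caccioppoli[OF \<Omega> pq a um K \<Lambda> min \<delta> sub k(1)] by (intro mult_left_mono) auto
        also have "\<dots> \<le> ennreal (\<Lambda> * 2 powr p) * (ennreal \<Lambda> * ennreal e)"
          by (intro mult_left_mono te) auto
        also have "\<dots> = ennreal (\<Lambda> * \<Lambda> * 2 powr p * e)"
          using \<Lambda> e0 by (simp add: ennreal_mult[symmetric] mult_ac)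
        also have "\<dots> \<le> ennreal (c * b ^ i * y)"
        proof (rule ennreal_leI)
          have p2: "(2::real) ^ i = 2 powr i" by (simp add: powr_realpow)
          have "A / \<delta> i = (8 * A / R) * 2 ^ i" by (simp add: \<delta>_def)
          then have "(A / \<delta> i) powr g = (8 * A / R) powr g * (2 ^ i) powr g" by (simp only: powr_mult)
          also have "((2::real) ^ i) powr g = (2 powr g) ^ i"
            by (simp add: p2 powr_powr powr_power mult.commute)
          finally have 1: "(A / \<delta> i) powr g = (8 * A / R) powr g * (2 powr g) ^ i" .
          have "d i = 2 powr (- real (Suc i))"
            unfolding powr_minus_divide d_def by (subst powr_realpow) auto
          then have "d i powr (- r) = 2 powr (r * real (Suc i))"
            by (simp only: powr_powr minus_mult_minus mult.commute)
          also have "\<dots> = 2 powr (r + r * real i)" by (simp add: distrib_left)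
          also have "\<dots> = 2 powr r * (2 powr r) ^ i" by (simp add: powr_add powr_power mult.commute)
          finally have 2: "d i powr (- r) = 2 powr r * (2 powr r) ^ i" .
          have "\<Lambda> * \<Lambda> * 2 powr p * e = (c - 1) * ((2 powr g) ^ i * (2 powr r) ^ i) * y"
            unfolding e_def 1 2 by (simp add: c_def)
          also have "(2 powr g) ^ i * (2 powr r) ^ i = b ^ i" by (simp add: b_def powr_add power_mult_distrib)
          also have "(c - 1) * b ^ i * y \<le> c * b ^ i * y" using b y by (intro mult_right_mono) auto
          finally show "\<Lambda> * \<Lambda> * 2 powr p * e \<le> c * b ^ i * y" .
        qed
        finally have gag: "gagliardo_energy s p f \<le> ennreal (c * b ^ i * y)" .
        have "Y k0 (Suc i) \<le> (\<integral>\<^sup>+ x. ennreal (f x powr r) \<partial>lebesgue)"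
          unfolding Y_def
        proof (intro nn_integral_mono ennreal_leI)
          fix x
          show "indicator (ball x0 (\<rho> (Suc i))) x * excess u (k0 + 1 - 1 / 2 ^ Suc i) x powr r \<le> f x powr r"
          proof (cases "x \<in> ball x0 (\<rho> (Suc i))")
            case True
            then have "plateau x0 (\<rho> i - \<delta> i) (\<delta> i) x = 1"
              using \<rho>Suc[of i] by (intro plateau_eq_1 \<delta>) auto
            then show ?thesis using True by (simp add: f_def cut_excess_def k_def)
          qed simp
        qed
        also have "\<dots> \<le> ennreal (S * (c * b ^ i * y) powr (r / p))"
        proof (rule S(2)[OF _ _ _ _ gag])
          fix x
          show "0 \<le> f x" by (simp add: f_def cut_excess_def)
          assume "x \<notin> ball x0 R"
          then have "x \<notin> ball x0 (\<rho> i - \<delta> i)" using \<rho>(2)[of i] \<delta>[of i] by auto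
          from plateau_eq_0[OF \<delta> this] show "f x = 0" using pq by (simp add: f_def cut_excess_def)
        qed (use c b y in auto)
        finally have "enn2real (Y k0 (Suc i)) \<le> S * (c * b ^ i * y) powr \<kappa>"
          using S(1) by (intro enn2real_leI) (auto simp: \<kappa>_def)
        also have "\<dots> = S * c powr \<kappa> * (b powr \<kappa>) ^ i * y powr \<kappa>"
          using c b y by (simp add: powr_mult powr_realpow[symmetric] powr_powr mult_ac)
        finally show ?thesis unfolding y_def .
      qed
      show ?thesis
      proof (rule fast_geometric_convergence[of "S * c powr \<kappa>" "b powr \<kappa>" \<kappa>])
        fix \<epsilon> assume \<epsilon>: "0 < \<epsilon>" and conv: "\<And>Y :: nat \<Rightarrow> real. (\<And>i. 0 \<le> Y i) \<Longrightarrow>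
          (\<And>i. Y (Suc i) \<le> S * c powr \<kappa> * (b powr \<kappa>) ^ i * Y i powr \<kappa>) \<Longrightarrow> Y 0 \<le> \<epsilon> \<Longrightarrow> Y \<longlonglongrightarrow> 0"
        \<comment> \<open>The admissible size \<open>\<epsilon>\<close> of \<open>Y 0\<close> is independent of the initial level, so the level can be chosen
          afterwards.\<close>
        have "(\<lambda>j. Y (real j) 0) \<longlonglongrightarrow> (\<integral>\<^sup>+ x. 0 \<partial>(lebesgue :: (real^'n) measure))"
          unfolding Y_def
        proof (rule nn_integral_dominated_convergence[OF _ _ _ _ u0])
          show "AE x in lebesgue. ennreal (indicator (ball x0 (\<rho> 0)) x * excess u (real j + 1 - 1 / 2 ^ 0) x powr r)
            \<le> ennreal (indicator (ball x0 R) x * excess u 0 x powr r)" for j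
            using r pq \<rho>(2)[of 0] by (intro AE_I2 ennreal_leI mult_mono powr_mono2) (auto simp: indicator_def excess_def)
          show "AE x in lebesgue. (\<lambda>j. ennreal (indicator (ball x0 (\<rho> 0)) x * excess u (real j + 1 - 1 / 2 ^ 0) x powr r)) \<longlonglongrightarrow> 0"
          proof (rule AE_I2)
            fix x
            obtain N where N: "u x \<le> real N" using real_arch_simple by blast
            have "ennreal (indicator (ball x0 (\<rho> 0)) x * excess u (real j + 1 - 1 / 2 ^ 0) x powr r) = 0" if "N \<le> j" for j
              using N that r pq by (simp add: excess_def)
            then show "(\<lambda>j. ennreal (indicator (ball x0 (\<rho> 0)) x * excess u (real j + 1 - 1 / 2 ^ 0) x powr r)) \<longlonglongrightarrow> 0"
              by (intro tendsto_eventually) (auto simp: eventually_sequentially)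
          qed
        qed measurable
        then have "(\<lambda>j. Y (real j) 0) \<longlonglongrightarrow> 0" by simp
        then have "\<forall>\<^sub>F j in sequentially. Y (real j) 0 < ennreal \<epsilon>"
          using \<epsilon> by (intro order_tendstoD(2)) auto
        then obtain j where j: "Y (real j) 0 < ennreal \<epsilon>" by (auto simp: eventually_sequentially)
        define k0 where "k0 = real j"
        have lim: "(\<lambda>i. enn2real (Y k0 i)) \<longlonglongrightarrow> 0"
        proof (rule conv)
          show "enn2real (Y k0 0) \<le> \<epsilon>" using j \<epsilon> by (intro enn2real_leI) (auto simp: k0_def)
        qed (use step[of k0] in \<open>auto simp: k0_def\<close>)
        define Z where "Z = (\<integral>\<^sup>+ x. ennreal (indicator (ball x0 (R / 2)) x * excess u (k0 + 1) x powr r) \<partial>lebesgue)"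
        have ZY: "Z \<le> Y k0 i" for i
          unfolding Z_def Y_def
        proof (intro nn_integral_mono ennreal_leI mult_mono)
          fix x
          show "indicator (ball x0 (R / 2)) x \<le> (indicator (ball x0 (\<rho> i)) x :: real)"
            using \<rho>(1)[of i] by (auto simp: indicator_def)
          have "excess u (k0 + 1) x \<le> excess u (k0 + 1 - 1 / 2 ^ i) x"
            unfolding excess_def by (intro max.mono) simp_all
          then show "excess u (k0 + 1) x powr r \<le> excess u (k0 + 1 - 1 / 2 ^ i) x powr r"
            using r pq by (intro powr_mono2) auto
        qed auto
        have k00: "0 \<le> k0" by (simp add: k0_def)
        have "enn2real Z \<le> enn2real (Y k0 i)" for i
          using ZY[of i] Yfin[OF k00, of i] by (intro enn2real_mono) auto
        then have "enn2real Z \<le> 0" by (intro LIMSEQ_le_const[OF lim]) auto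
        moreover have "Z < \<infinity>" using ZY[of 0] Yfin[OF k00, of 0] by (rule order_le_less_trans)
        ultimately have "Z = 0" by (cases Z) auto
        then have "AE x in lebesgue. ennreal (indicator (ball x0 (R / 2)) x * excess u (k0 + 1) x powr r) = 0"
          unfolding Z_def by (subst (asm) nn_integral_0_iff_AE) auto
        then have "AE x in lebesgue. x \<in> ball x0 (R / 2) \<longrightarrow> u x \<le> k0 + 1"
          by (rule AE_mp) (auto intro!: AE_I2 simp: ennreal_eq_0_iff excess_def)
        then show ?thesis by blast
      qed (use S(1) c b \<kappa> in \<open>auto intro: gr_one_powr\<close>)
    qed (use pq r R s in auto)
  qed
qed

lemma minimizer_uminus:
  fixes \<Omega> :: "(real^'n) set"
  assumes "is_minimizer Ksp Ktq a s t p q \<Omega> u"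
  shows "is_minimizer Ksp Ktq a s t p q \<Omega> (\<lambda>x. - u x)"
proof -
  have e: "\<bar>- v x - - v y\<bar> = \<bar>v x - v y\<bar>" for v :: "real^'n \<Rightarrow> real" and x y by arith
  have adm: "(\<lambda>x. - v x) \<in> admissible a s t p q \<Omega>" if "v \<in> admissible a s t p q \<Omega>" for v
    using that unfolding admissible_def mem_Collect_eq e abs_minus_cancel by simp
  have F: "double_phase_functional Ksp Ktq a p q \<Omega> (\<lambda>x. - v x) = double_phase_functional Ksp Ktq a p q \<Omega> v" for v
    unfolding double_phase_functional_def e ..
  show ?thesis
    unfolding is_minimizer_def
  proof (intro conjI ballI impI)
    show "(\<lambda>x. - u x) \<in> admissible a s t p q \<Omega>" using assms adm by (simp add: is_minimizer_def)
    fix v assume v: "v \<in> admissible a s t p q \<Omega>" "AE x in lebesgue. x \<notin> \<Omega> \<longrightarrow> v x = - u x"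
    have "AE x in lebesgue. x \<notin> \<Omega> \<longrightarrow> - v x = u x" using v(2) by eventually_elim auto
    then have "double_phase_functional Ksp Ktq a p q \<Omega> u \<le> double_phase_functional Ksp Ktq a p q \<Omega> (\<lambda>x. - v x)"
      using conjunct2[OF assms[unfolded is_minimizer_def], rule_format, OF adm[OF v(1)]] by simp
    then show "double_phase_functional Ksp Ktq a p q \<Omega> (\<lambda>x. - u x) \<le> double_phase_functional Ksp Ktq a p q \<Omega> v"
      by (simp only: F)
  qed
qed

lemma L_infinity_loc_from_balls:
  fixes u :: "'a::euclidean_space \<Rightarrow> real"
  assumes "open \<Omega>" and um: "u \<in> borel_measurable lebesgue"
    and loc: "\<And>x. x \<in> \<Omega> \<Longrightarrow> \<exists>e M. 0 < e \<and> (AE y in lebesgue. y \<in> ball x e \<longrightarrow> \<bar>u y\<bar> \<le> M)"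
  shows "u \<in> L_infinity_loc \<Omega>"
proof -
  obtain e M where e: "\<And>x. x \<in> \<Omega> \<Longrightarrow> 0 < e x" "\<And>x. x \<in> \<Omega> \<Longrightarrow> AE y in lebesgue. y \<in> ball x (e x) \<longrightarrow> \<bar>u y\<bar> \<le> M x"
    using loc by metis
  have "\<exists>M. AE y in lebesgue. y \<in> C \<longrightarrow> \<bar>u y\<bar> \<le> M" if C: "compact C" "C \<subseteq> \<Omega>" for C
  proof -
    have "C \<subseteq> (\<Union>x\<in>C. ball x (e x))" using e(1) C(2) by force
    then obtain F where F: "F \<subseteq> C" "finite F" "C \<subseteq> (\<Union>x\<in>F. ball x (e x))"
      using compactE_image[OF C(1), of C "\<lambda>x. ball x (e x)"] by auto
    have "AE y in lebesgue. \<forall>x\<in>F. y \<in> ball x (e x) \<longrightarrow> \<bar>u y\<bar> \<le> M x"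
      using F C e(2) by (intro AE_finite_allI) auto
    then have "AE y in lebesgue. y \<in> C \<longrightarrow> \<bar>u y\<bar> \<le> (\<Sum>x\<in>F. \<bar>M x\<bar>)"
    proof (rule AE_mp, intro AE_I2 impI)
      fix y assume y: "\<forall>x\<in>F. y \<in> ball x (e x) \<longrightarrow> \<bar>u y\<bar> \<le> M x" "y \<in> C"
      then obtain x where x: "x \<in> F" "y \<in> ball x (e x)" using F by blast
      then have "\<bar>u y\<bar> \<le> \<bar>M x\<bar>" using y by force
      also have "\<dots> \<le> (\<Sum>x\<in>F. \<bar>M x\<bar>)" using F x by (intro member_le_sum) auto
      finally show "\<bar>u y\<bar> \<le> (\<Sum>x\<in>F. \<bar>M x\<bar>)" .
    qed
    then show ?thesis by blast
  qed
  moreover have "set_borel_measurable lebesgue \<Omega> u"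
    unfolding set_borel_measurable_def using assms(1) um
    by (intro borel_measurable_scaleR borel_measurable_indicator) auto
  ultimately show ?thesis by (auto simp: L_infinity_loc_def)
qed

section \<open>Local boundedness\<close>

theorem theorem1p5:
  fixes \<Omega> :: "(real^'n) set"
    and s t p q \<Lambda> :: real
    and Ksp Ktq a :: "(real^'n) \<times> (real^'n) \<Rightarrow> real"
    and u :: "real^'n \<Rightarrow> real"
  assumes "CARD('n) \<ge> 2"
    and "open \<Omega>" and "bounded \<Omega>"
    and "0 < s" and "s \<le> t" and "t < 1"
    and "1 < p" and "p \<le> q"
    and "1 \<le> \<Lambda>"
    and "fractional_kernel \<Lambda> s p Ksp"
    and "fractional_kernel \<Lambda> t q Ktq"
    and "coefficient a"
    and "a \<in> L_infinity_loc (\<Omega> \<times> \<Omega>)"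
    and "if s * p < real CARD('n)
         then q / p \<le> 1 + s * p / (real CARD('n) - s * p)
         else p \<le> q"
    and "u \<in> admissible a s t p q \<Omega> \<inter> tail_space s p \<inter> weighted_tail_space a t q \<Omega>"
    and "is_minimizer Ksp Ktq a s t p q \<Omega> u"
  shows "u \<in> L_infinity_loc \<Omega>"
proof -
  define n where "n = real CARD('n)"
  have n: "n > 0" by (simp add: n_def)
  \<comment> \<open>Below the critical dimension \<open>r\<close> is the Sobolev exponent; otherwise the last inequality holds
    for every \<open>r > p\<close>.\<close>
  obtain r where r: "p < r" "q \<le> r" "n * (1 - p / r) \<le> s * p"
  proof (cases "s * p < n")
    case True
    define r where "r = n * p / (n - s * p)"
    have sp: "s * p > 0" using assms(4,7) by simp
    have "q / p \<le> n / (n - s * p)"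
      using assms(14) True by (simp add: n_def[symmetric] add_divide_distrib[symmetric] field_simps)
    then have "q \<le> r" using assms(7) by (simp add: r_def field_simps)
    moreover have "p < r" using True sp assms(7) n by (simp add: r_def field_simps)
    moreover have "n * (1 - p / r) \<le> s * p"
      using True n assms(7) by (simp add: r_def field_simps)
    ultimately show ?thesis using that by blast
  next
    case False
    have "n * (1 - p / (q + 1)) \<le> n * 1" using assms(7,8) n by (intro mult_left_mono) auto
    then show ?thesis using that[of "q + 1"] assms(7,8) False by simp
  qed
  have s: "s < 1" and t: "0 < t" using assms(4-6) by auto
  have u: "u \<in> tail_space s p" "u \<in> weighted_tail_space a t q \<Omega>" using assms(15) by auto
  then have u': "(\<lambda>x. - u x) \<in> tail_space s p" "(\<lambda>x. - u x) \<in> weighted_tail_space a t q \<Omega>"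
    by (auto simp: tail_space_def weighted_tail_space_def)
  have um: "u \<in> borel_measurable lebesgue" using u by (simp add: tail_space_def)
  show ?thesis
  proof (rule L_infinity_loc_from_balls[OF assms(2) um])
    fix x assume "x \<in> \<Omega>"
    then obtain R' where R': "0 < R'" "cball x R' \<subseteq> \<Omega>" using assms(2) open_contains_cball by blast
    define R where "R = R' / 2"
    have R: "0 < R" "cball x (2 * R) \<subseteq> \<Omega>" using R' by (auto simp: R_def)
    note bd = minimizer_bounded_above[OF assms(2,4) s t assms(6-8,10,11,9,12,13) r(1,2) r(3)[unfolded n_def] R]
    obtain M1 where M1: "AE y in lebesgue. y \<in> ball x (R / 2) \<longrightarrow> u y \<le> M1"
      using bd[OF u assms(16)] by blast
    obtain M2 where M2: "AE y in lebesgue. y \<in> ball x (R / 2) \<longrightarrow> - u y \<le> M2"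
      using bd[OF u' minimizer_uminus[OF assms(16)]] by blast
    have "AE y in lebesgue. y \<in> ball x (R / 2) \<longrightarrow> \<bar>u y\<bar> \<le> max M1 M2"
      using M1 M2 by eventually_elim auto
    then show "\<exists>e M. 0 < e \<and> (AE y in lebesgue. y \<in> ball x e \<longrightarrow> \<bar>u y\<bar> \<le> M)"
      using R(1) by (intro exI[of _ "R / 2"] exI[of _ "max M1 M2"]) auto
  qed
qed

end
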